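(* Let $2n\ge4$ and let $\omega$ be a $T^{2n}$-invariant symplectic form on the torus $T^{2n}$. Let $\nabla^t$ be an analytic curve of analytic symplectic connections on $(T^{2n},\omega)$ such that $\nabla^0$ is the standard flat connection on $T^{2n}$ and such that $W^t=0$ for all $t$. Then the curvature $R^t$ of $\nabla^t$ vanishes for all $t$.
   Context: $T^{2n}=\mathbb{R}^{2n}/\mathbb{Z}^{2n}$ with angle coordinates $x^a$ and invariant vector fields $\partial_a$; the standard flat connection $\nabla^0$ is defined by $\nabla^0_{\partial_a}\partial_b=0$. $\omega$ is $T^{2n}$-invariant if it has constant components in these coordinates. A symplectic connection is a torsion-free linear connection $\nabla$ with $\nabla\omega=0$. An analytic curve of analytic symplectic connections is a family $\nabla^t$ of symplectic connections, $t$ in an open interval containing $0$, whose Christoffel symbols in the coordinates $x^a$ are real analytic functions of $(t,x)$. For a symplectic connection, $R(X,Y)Z=(\nabla_X\nabla_Y-\nabla_Y\nabla_X-\nabla_{[X,Y]})Z$, $R(X,Y;Z,T)=\omega(R(X,Y)Z,T)$, $r(X,Y)=\operatorname{Trace}[Z\mapsto R(X,Z)Y]$, $$E(X,Y;Z,T)=\tfrac{-1}{2(n+1)}\big[2\omega(X,Y)r(Z,T)+\omega(X,Z)r(Y,T)+\omega(X,T)r(Y,Z)-\omega(Y,Z)r(X,T)-\omega(Y,T)r(X,Z)\big],$$ and $W=R-E$. $R^t$ and $W^t$ denote these tensors for $\nabla^t$. *)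

theory Defs
  imports "HOL-Analysis.Analysis"
begin

text \<open>
  Conventions. The torus is the quotient of \<open>real ^ 'm\<close> by the integer lattice, where
  \<open>CARD('m)\<close> is its dimension. Its tangent bundle is trivialised by the invariant fields, so
  functions and vector fields on the torus are lattice-periodic maps on \<open>real ^ 'm\<close> (with values
  in \<open>real\<close> and \<open>real ^ 'm\<close> respectively).
\<close>

section \<open>Functions and vector fields on the torus\<close>

type_synonym 'm vec_field = "real ^ 'm \<Rightarrow> real ^ 'm"

definition lattice_periodic :: "(real ^ 'm \<Rightarrow> 'b) \<Rightarrow> bool" where
  "lattice_periodic f \<longleftrightarrow> (\<forall>x k. (\<forall>i. k $ i \<in> \<int>) \<longrightarrow> f (x + k) = f x)"

definition coord_field :: "'m \<Rightarrow> 'm::finite vec_field" where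
  "coord_field a = (\<lambda>x. axis a 1)"

text \<open>The derivative \<open>X f\<close> of a function along a vector field.\<close>

definition field_deriv :: "'m::finite vec_field \<Rightarrow> (real ^ 'm \<Rightarrow> real) \<Rightarrow> real ^ 'm \<Rightarrow> real" where
  "field_deriv X f = (\<lambda>x. frechet_derivative f (at x) (X x))"

text \<open>
  If all iterated partial derivatives are Frechet differentiable, they are all continuous, so this
  is the usual notion of an infinitely differentiable function.
\<close>

definition smooth_fun :: "(real ^ 'm::finite \<Rightarrow> real) \<Rightarrow> bool" where
  "smooth_fun f \<longleftrightarrow>
     (\<forall>as x. foldr (\<lambda>a. field_deriv (coord_field a)) as f differentiable (at x))"

definition torus_fun :: "(real ^ 'm::finite \<Rightarrow> real) \<Rightarrow> bool" where
  "torus_fun f \<longleftrightarrow> smooth_fun f \<and> lattice_periodic f"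

definition torus_field :: "'m::finite vec_field \<Rightarrow> bool" where
  "torus_field X \<longleftrightarrow> (\<forall>a. torus_fun (\<lambda>x. X x $ a))"

definition lie_bracket :: "'m::finite vec_field \<Rightarrow> 'm vec_field \<Rightarrow> 'm vec_field" where
  "lie_bracket X Y =
     (\<lambda>x. \<chi> a. field_deriv X (\<lambda>y. Y y $ a) x - field_deriv Y (\<lambda>y. X y $ a) x)"

section \<open>Symplectic forms\<close>

text \<open>\<open>\<omega> x u v\<close> is the value of the 2-form at the point \<open>x\<close> on the tangent vectors \<open>u\<close>, \<open>v\<close>.\<close>

type_synonym 'm two_form = "real ^ 'm \<Rightarrow> real ^ 'm \<Rightarrow> real ^ 'm \<Rightarrow> real"

definition form_comp :: "'m::finite two_form \<Rightarrow> 'm \<Rightarrow> 'm \<Rightarrow> real ^ 'm \<Rightarrow> real" where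
  "form_comp \<omega> a b = (\<lambda>x. \<omega> x (coord_field a x) (coord_field b x))"

definition torus_two_form :: "'m::finite two_form \<Rightarrow> bool" where
  "torus_two_form \<omega> \<longleftrightarrow>
     (\<forall>x. bilinear (\<omega> x)) \<and> (\<forall>x u. \<omega> x u u = 0) \<and> (\<forall>a b. torus_fun (form_comp \<omega> a b))"

definition closed_form :: "'m::finite two_form \<Rightarrow> bool" where
  "closed_form \<omega> \<longleftrightarrow>
     (\<forall>a b c x. field_deriv (coord_field a) (form_comp \<omega> b c) x
              + field_deriv (coord_field b) (form_comp \<omega> c a) x
              + field_deriv (coord_field c) (form_comp \<omega> a b) x = 0)"

definition nondegenerate_form :: "'m::finite two_form \<Rightarrow> bool" where
  "nondegenerate_form \<omega> \<longleftrightarrow> (\<forall>x u. (\<forall>v. \<omega> x u v = 0) \<longrightarrow> u = 0)"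

definition symplectic_form :: "'m::finite two_form \<Rightarrow> bool" where
  "symplectic_form \<omega> \<longleftrightarrow> torus_two_form \<omega> \<and> closed_form \<omega> \<and> nondegenerate_form \<omega>"

definition invariant_form :: "'m::finite two_form \<Rightarrow> bool" where
  "invariant_form \<omega> \<longleftrightarrow> (\<forall>a b x y. form_comp \<omega> a b x = form_comp \<omega> a b y)"

section \<open>Connections\<close>

text \<open>
  A connection is a covariant derivative operator. Only its values on torus fields are constrained
  or ever used; real linearity in the second argument follows from additivity and the Leibniz rule.
\<close>

type_synonym 'm connection = "'m vec_field \<Rightarrow> 'm vec_field \<Rightarrow> 'm vec_field"

definition linear_connection :: "'m::finite connection \<Rightarrow> bool" where
  "linear_connection D \<longleftrightarrow>
     (\<forall>X Y. torus_field X \<longrightarrow> torus_field Y \<longrightarrow> torus_field (D X Y)) \<and>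
     (\<forall>X X' Y. torus_field X \<longrightarrow> torus_field X' \<longrightarrow> torus_field Y \<longrightarrow>
        D (\<lambda>x. X x + X' x) Y = (\<lambda>x. D X Y x + D X' Y x)) \<and>
     (\<forall>f X Y. torus_fun f \<longrightarrow> torus_field X \<longrightarrow> torus_field Y \<longrightarrow>
        D (\<lambda>x. f x *\<^sub>R X x) Y = (\<lambda>x. f x *\<^sub>R D X Y x)) \<and>
     (\<forall>X Y Y'. torus_field X \<longrightarrow> torus_field Y \<longrightarrow> torus_field Y' \<longrightarrow>
        D X (\<lambda>x. Y x + Y' x) = (\<lambda>x. D X Y x + D X Y' x)) \<and>
     (\<forall>f X Y. torus_fun f \<longrightarrow> torus_field X \<longrightarrow> torus_field Y \<longrightarrow>
        D X (\<lambda>x. f x *\<^sub>R Y x) = (\<lambda>x. field_deriv X f x *\<^sub>R Y x + f x *\<^sub>R D X Y x))"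

definition torsion_free :: "'m::finite connection \<Rightarrow> bool" where
  "torsion_free D \<longleftrightarrow>
     (\<forall>X Y. torus_field X \<longrightarrow> torus_field Y \<longrightarrow>
        (\<forall>x. D X Y x - D Y X x - lie_bracket X Y x = 0))"

definition parallel_form :: "'m::finite two_form \<Rightarrow> 'm connection \<Rightarrow> bool" where
  "parallel_form \<omega> D \<longleftrightarrow>
     (\<forall>X Y Z. torus_field X \<longrightarrow> torus_field Y \<longrightarrow> torus_field Z \<longrightarrow>
        (\<forall>x. field_deriv X (\<lambda>y. \<omega> y (Y y) (Z y)) x
               - \<omega> x (D X Y x) (Z x) - \<omega> x (Y x) (D X Z x) = 0))"

definition symplectic_connection :: "'m::finite two_form \<Rightarrow> 'm connection \<Rightarrow> bool" where
  "symplectic_connection \<omega> D \<longleftrightarrow> linear_connection D \<and> torsion_free D \<and> parallel_form \<omega> D"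

definition standard_flat_connection :: "'m::finite connection \<Rightarrow> bool" where
  "standard_flat_connection D \<longleftrightarrow>
     linear_connection D \<and> (\<forall>a b x. D (coord_field a) (coord_field b) x = 0)"

definition christoffel :: "'m::finite connection \<Rightarrow> 'm \<Rightarrow> 'm \<Rightarrow> 'm \<Rightarrow> real ^ 'm \<Rightarrow> real" where
  "christoffel D c a b = (\<lambda>x. D (coord_field a) (coord_field b) x $ c)"

section \<open>Curvature\<close>

definition curvature ::
  "'m::finite connection \<Rightarrow> 'm vec_field \<Rightarrow> 'm vec_field \<Rightarrow> 'm vec_field \<Rightarrow> 'm vec_field" where
  "curvature D X Y Z = (\<lambda>x. D X (D Y Z) x - D Y (D X Z) x - D (lie_bracket X Y) Z x)"

definition curvature4 ::
  "'m::finite two_form \<Rightarrow> 'm connection \<Rightarrow>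
     'm vec_field \<Rightarrow> 'm vec_field \<Rightarrow> 'm vec_field \<Rightarrow> 'm vec_field \<Rightarrow> real ^ 'm \<Rightarrow> real" where
  "curvature4 \<omega> D X Y Z T = (\<lambda>x. \<omega> x (curvature D X Y Z x) (T x))"

text \<open>
  The trace at \<open>x\<close> is that of an endomorphism of the tangent space at \<open>x\<close>; since the curvature is a
  tensor, a tangent vector \<open>z\<close> may be extended to the constant field with value \<open>z\<close>.
\<close>

definition ricci ::
  "'m::finite connection \<Rightarrow> 'm vec_field \<Rightarrow> 'm vec_field \<Rightarrow> real ^ 'm \<Rightarrow> real" where
  "ricci D X Y = (\<lambda>x. trace (matrix (\<lambda>z. curvature D X (\<lambda>_. z) Y x)))"

text \<open>With \<open>2 n = CARD('m)\<close>, the factor below is \<open>- 1 / (2 (n + 1))\<close>.\<close>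

definition ricci_part ::
  "'m::finite two_form \<Rightarrow> 'm connection \<Rightarrow>
     'm vec_field \<Rightarrow> 'm vec_field \<Rightarrow> 'm vec_field \<Rightarrow> 'm vec_field \<Rightarrow> real ^ 'm \<Rightarrow> real" where
  "ricci_part \<omega> D X Y Z T = (\<lambda>x.
     - 1 / (2 * (real CARD('m) / 2 + 1)) *
       (2 * \<omega> x (X x) (Y x) * ricci D Z T x
        + \<omega> x (X x) (Z x) * ricci D Y T x
        + \<omega> x (X x) (T x) * ricci D Y Z x
        - \<omega> x (Y x) (Z x) * ricci D X T x
        - \<omega> x (Y x) (T x) * ricci D X Z x))"

definition weyl_part ::
  "'m::finite two_form \<Rightarrow> 'm connection \<Rightarrow>
     'm vec_field \<Rightarrow> 'm vec_field \<Rightarrow> 'm vec_field \<Rightarrow> 'm vec_field \<Rightarrow> real ^ 'm \<Rightarrow> real" where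
  "weyl_part \<omega> D X Y Z T = (\<lambda>x. curvature4 \<omega> D X Y Z T x - ricci_part \<omega> D X Y Z T x)"

definition weyl_part_vanishes :: "'m::finite two_form \<Rightarrow> 'm connection \<Rightarrow> bool" where
  "weyl_part_vanishes \<omega> D \<longleftrightarrow>
     (\<forall>X Y Z T. torus_field X \<longrightarrow> torus_field Y \<longrightarrow> torus_field Z \<longrightarrow> torus_field T \<longrightarrow>
        (\<forall>x. weyl_part \<omega> D X Y Z T x = 0))"

definition curvature_vanishes :: "'m::finite connection \<Rightarrow> bool" where
  "curvature_vanishes D \<longleftrightarrow>
     (\<forall>X Y Z. torus_field X \<longrightarrow> torus_field Y \<longrightarrow> torus_field Z \<longrightarrow>
        (\<forall>x. curvature D X Y Z x = 0))"

section \<open>Analytic curves of connections\<close>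

text \<open>
  On an open set \<open>S\<close>: near each point \<open>p\<close> of \<open>S\<close>, \<open>f\<close> is the sum of a (necessarily absolutely)
  convergent power series in the coordinates of \<open>x - p\<close>; \<open>\<alpha>\<close> ranges over the multi-indices.
\<close>

definition real_analytic_on :: "('a::euclidean_space \<Rightarrow> real) \<Rightarrow> 'a set \<Rightarrow> bool" where
  "real_analytic_on f S \<longleftrightarrow>
     (\<forall>p\<in>S. \<exists>r>0. \<exists>c :: ('a \<Rightarrow> nat) \<Rightarrow> real. \<forall>x\<in>ball p r.
        ((\<lambda>\<alpha>. c \<alpha> * (\<Prod>b\<in>Basis. ((x - p) \<bullet> b) ^ \<alpha> b)) has_sum f x) (Basis \<rightarrow>\<^sub>E UNIV))"

definition analytic_symplectic_curve ::
  "'m::finite two_form \<Rightarrow> real set \<Rightarrow> (real \<Rightarrow> 'm connection) \<Rightarrow> bool" where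
  "analytic_symplectic_curve \<omega> I D \<longleftrightarrow>
     (\<forall>t\<in>I. symplectic_connection \<omega> (D t)) \<and>
     (\<forall>a b c. real_analytic_on (\<lambda>(t, x). christoffel (D t) c a b x) (I \<times> UNIV))"

end

theory Submission
  imports Defs "HOL-Complex_Analysis.Complex_Analysis"
begin

no_notation fps_nth (infixl "$" 75)

text \<open>
  Expand the curve in powers of \<open>t\<close>. A connection with \<open>W = 0\<close> is governed by its Ricci
  endomorphism \<open>\<rho>\<close>, a vector field \<open>u\<close> and a function \<open>\<beta>\<close> determined by \<open>\<nabla>u\<close>.
  These data assemble into a symplectic tractor connection \<open>d + h\<close> on the sum of two line bundles
  and the tangent bundle \<open>T\<close>, whose curvature is \<open>\<omega> A\<close> for an endomorphism \<open>A\<close>. Order by order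
  in \<open>t\<close>, closed periodic 1-forms being constant up to exact ones, a periodic gauge transformation
  \<open>G\<close> makes the connection constant; it becomes a representation
  \<open>[a\<^sub>c, a\<^sub>d] = \<omega>\<^sub>c\<^sub>d Z\<close> of a Heisenberg algebra with \<open>A G = G Z\<close>. Algebra over the field of Laurent
  series forces \<open>Z\<close>, hence \<open>A\<close>, to have rank one. The 2 x 2 minors of \<open>A\<close> then give \<open>\<rho> = 0\<close>, so the
  curvature vanishes as a formal power series in \<open>t\<close>, and on all of \<open>I\<close> by analyticity.
\<close>

section \<open>Smooth functions on the torus\<close>

text \<open>The gauge argument needs a connection form without constant term in the parameter, but
  the tractor form contains the soldering form \<open>axis c 1\<close>, which does not depend on the
  parameter at all. Conjugation by the weights cures this at the price of dividing some entries by
  up to the square of the parameter, and it moves the corner entry 1 of the curvature to order 2.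
  This corner must be the leading term of \<open>A\<close>, so all other entries need order at least
  3 after the division and order 5 before it: hence the fifth power substituted for the parameter.
  Because of the corner, some vector \<open>f\<close> pairs nontrivially with \<open>Z *v f\<close>.
  Then \<open>f\<close>, \<open>Z *v f\<close> and the images of \<open>f\<close> under the
  corrected generators \<open>h c\<close> form a basis, in which the representation again looks like
  a Ricci type connection, now with constant coefficients; trace identities show that such a
  connection is flat. Dimension at least four enters twice: wedging 1-forms with omega is injective,
  and \<open>n - 1\<close> is nonzero in the trace identities.\<close>

abbreviation pd :: "'m::finite \<Rightarrow> (real ^ 'm \<Rightarrow> real) \<Rightarrow> real ^ 'm \<Rightarrow> real" where
  "pd a \<equiv> field_deriv (coord_field a)"

lemma pd_def: "pd a f x = frechet_derivative f (at x) (axis a 1)"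
  by (simp add: field_deriv_def coord_field_def)

lemma smooth_fun_differentiable: "smooth_fun f \<Longrightarrow> f differentiable (at x)"
  unfolding smooth_fun_def by (drule spec[of _ "[]"]) simp

lemma smooth_fun_pd: "smooth_fun f \<Longrightarrow> smooth_fun (pd a f)"
  unfolding smooth_fun_def by (intro allI, drule_tac x="as @ [a]" in spec) simp

lemma smooth_funI:
  assumes "\<And>x. f differentiable (at x)" "\<And>a. smooth_fun (pd a f)"
  shows "smooth_fun f"
  unfolding smooth_fun_def
proof (intro allI)
  fix as :: "'a list" and x
  show "foldr pd as f differentiable at x"
    using assms by (cases as rule: rev_cases) (auto simp: smooth_fun_def)
qed

lemma smooth_fun_coinduct:
  assumes "P f"
    and "\<And>f x. P f \<Longrightarrow> f differentiable (at x)"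
    and "\<And>f a. P f \<Longrightarrow> P (pd a f)"
  shows "smooth_fun f"
proof -
  have "P (foldr pd as f)" for as
    by (induction as) (use assms in auto)
  then show ?thesis
    unfolding smooth_fun_def using assms(2) by blast
qed

lemma has_derivative_pd:
  assumes "(f has_derivative f') (at x)"
  shows "pd a f x = f' (axis a 1)"
  using frechet_derivative_at[OF assms] by (simp add: pd_def)

lemma smooth_fun_has_derivative:
  "smooth_fun f \<Longrightarrow> (f has_derivative (\<lambda>h. \<Sum>a\<in>UNIV. h $ a * pd a f x)) (at x)"
proof -
  assume "smooth_fun f"
  then have d: "(f has_derivative frechet_derivative f (at x)) (at x)"
    using frechet_derivative_works smooth_fun_differentiable by blast
  interpret bounded_linear "frechet_derivative f (at x)"
    using d has_derivative_bounded_linear by blast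
  have "frechet_derivative f (at x) h = (\<Sum>a\<in>UNIV. h $ a * pd a f x)" for h
  proof -
    have "frechet_derivative f (at x) h = frechet_derivative f (at x) (\<Sum>a\<in>UNIV. (h $ a) *\<^sub>R axis a 1)"
      by (metis basis_expansion scalar_mult_eq_scaleR)
    then show ?thesis by (simp add: sum scaleR pd_def)
  qed
  then show ?thesis using d by presburger
qed

lemma smooth_fun_continuous_on: "smooth_fun f \<Longrightarrow> continuous_on S f"
  by (meson continuous_at_imp_continuous_on differentiable_imp_continuous_within smooth_fun_differentiable)

lemma pd_add_at:
  assumes "f differentiable (at x)" "g differentiable (at x)"
  shows "pd a (\<lambda>x. f x + g x) x = pd a f x + pd a g x"
  by (rule trans, rule has_derivative_pd, rule has_derivative_add)
    (use assms in \<open>auto simp: pd_def frechet_derivative_works[symmetric]\<close>)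

lemma pd_mult_at:
  assumes "f differentiable (at x)" "g differentiable (at x)"
  shows "pd a (\<lambda>x. f x * g x) x = f x * pd a g x + pd a f x * g x"
  by (rule trans, rule has_derivative_pd, rule has_derivative_mult)
    (use assms in \<open>auto simp: pd_def frechet_derivative_works[symmetric]\<close>)

lemma pd_add: "smooth_fun f \<Longrightarrow> smooth_fun g \<Longrightarrow> pd a (\<lambda>x. f x + g x) = (\<lambda>x. pd a f x + pd a g x)"
  by (rule ext) (simp add: pd_add_at smooth_fun_differentiable)

lemma pd_mult: "smooth_fun f \<Longrightarrow> smooth_fun g \<Longrightarrow>
    pd a (\<lambda>x. f x * g x) = (\<lambda>x. f x * pd a g x + pd a f x * g x)"
  by (rule ext) (simp add: pd_mult_at smooth_fun_differentiable)

lemma pd_const [simp]: "pd a (\<lambda>_. c) = (\<lambda>_. 0)"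
  by (rule ext, rule trans, rule has_derivative_pd, rule has_derivative_const) auto

lemma smooth_fun_const [simp]: "smooth_fun (\<lambda>_. c)"
  by (rule smooth_fun_coinduct[where P="\<lambda>f. \<exists>c. f = (\<lambda>_. c)"]) auto

lemma pd_component: "pd a (\<lambda>x. x $ b) = (\<lambda>_. if a = b then 1 else 0)"
  by (rule ext, rule trans, rule has_derivative_pd,
     rule bounded_linear.has_derivative[OF bounded_linear_vec_nth has_derivative_ident])
   (simp add: axis_def)

lemma smooth_fun_component [simp]: "smooth_fun (\<lambda>x. x $ b)"
  by (rule smooth_funI) (auto simp: pd_component intro!: bounded_linear_imp_differentiable bounded_linear_vec_nth)

text \<open>Products alone are not stable under \<open>pd\<close>, since the product rule yields
  sums of products; closing under both operations gives an invariant for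
  \<open>smooth_fun_coinduct\<close>.\<close>

inductive smooth_poly :: "(real ^ 'm::finite \<Rightarrow> real) \<Rightarrow> bool" where
  "smooth_fun f \<Longrightarrow> smooth_poly f"
| "smooth_poly f \<Longrightarrow> smooth_poly g \<Longrightarrow> smooth_poly (\<lambda>x. f x + g x)"
| "smooth_poly f \<Longrightarrow> smooth_poly g \<Longrightarrow> smooth_poly (\<lambda>x. f x * g x)"

lemma smooth_poly_deriv:
  assumes "smooth_poly f"
  shows "(\<forall>x. f differentiable (at x)) \<and> (\<forall>a. smooth_poly (pd a f))"
  using assms
proof induction
  case (1 f)
  then show ?case by (simp add: smooth_fun_differentiable smooth_fun_pd smooth_poly.intros)
next
  case (2 f g)
  then have "pd a (\<lambda>x. f x + g x) = (\<lambda>x. pd a f x + pd a g x)" for a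
    by (intro ext) (simp add: pd_add_at)
  then show ?case using 2 by (auto intro: smooth_poly.intros)
next
  case (3 f g)
  then have "pd a (\<lambda>x. f x * g x) = (\<lambda>x. f x * pd a g x + pd a f x * g x)" for a
    by (intro ext) (simp add: pd_mult_at)
  moreover have "smooth_poly (\<lambda>x. f x * pd a g x + pd a f x * g x)" for a
    using 3 by (intro smooth_poly.intros(2) smooth_poly.intros(3)) auto
  ultimately show ?case using 3 by simp
qed

lemma smooth_poly_imp_smooth_fun: "smooth_poly f \<Longrightarrow> smooth_fun f"
  by (rule smooth_fun_coinduct[where P=smooth_poly]) (auto dest: smooth_poly_deriv)

lemma smooth_fun_add: "smooth_fun f \<Longrightarrow> smooth_fun g \<Longrightarrow> smooth_fun (\<lambda>x. f x + g x)"
  and smooth_fun_mult: "smooth_fun f \<Longrightarrow> smooth_fun g \<Longrightarrow> smooth_fun (\<lambda>x. f x * g x)"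
  by (auto intro!: smooth_poly_imp_smooth_fun intro: smooth_poly.intros)

lemma smooth_fun_cmult: "smooth_fun f \<Longrightarrow> smooth_fun (\<lambda>x. c * f x)"
  by (auto intro: smooth_fun_mult)

lemma smooth_fun_uminus: "smooth_fun f \<Longrightarrow> smooth_fun (\<lambda>x. - f x)"
  using smooth_fun_cmult[of f "-1"] by simp

lemma smooth_fun_diff: "smooth_fun f \<Longrightarrow> smooth_fun g \<Longrightarrow> smooth_fun (\<lambda>x. f x - g x)"
  using smooth_fun_add[of f "\<lambda>x. - g x"] smooth_fun_uminus[of g] by simp

lemma smooth_fun_sum: "(\<And>i. i \<in> A \<Longrightarrow> smooth_fun (f i)) \<Longrightarrow> smooth_fun (\<lambda>x. \<Sum>i\<in>A. f i x)"
  by (induction A rule: infinite_finite_induct) (auto intro: smooth_fun_add)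

lemmas smooth_intros = smooth_fun_add smooth_fun_mult smooth_fun_cmult smooth_fun_uminus smooth_fun_diff
  smooth_fun_sum smooth_fun_pd

lemma pd_cmult: "smooth_fun f \<Longrightarrow> pd a (\<lambda>x. c * f x) = (\<lambda>x. c * pd a f x)"
  by (simp add: pd_mult)

lemma pd_uminus: "smooth_fun f \<Longrightarrow> pd a (\<lambda>x. - f x) = (\<lambda>x. - pd a f x)"
  using pd_cmult[of f a "-1"] by simp

lemma pd_diff: "smooth_fun f \<Longrightarrow> smooth_fun g \<Longrightarrow> pd a (\<lambda>x. f x - g x) = (\<lambda>x. pd a f x - pd a g x)"
  using pd_add[of f "\<lambda>x. - g x" a] by (simp add: pd_uminus smooth_fun_uminus)

lemma pd_sum: "(\<And>i. i \<in> A \<Longrightarrow> smooth_fun (f i)) \<Longrightarrow> pd a (\<lambda>x. \<Sum>i\<in>A. f i x) = (\<lambda>x. \<Sum>i\<in>A. pd a (f i) x)"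
  by (induction A rule: infinite_finite_induct) (auto simp: pd_add smooth_fun_sum)

lemma pd_zero_imp_const:
  assumes "smooth_fun f" "\<And>a x. pd a f x = 0"
  shows "f x = f y"
proof -
  have "(f has_derivative (\<lambda>h. 0)) (at x within UNIV)" for x
    using smooth_fun_has_derivative[OF assms(1)] assms(2) by simp
  then show ?thesis
    by (metis has_derivative_zero_unique UNIV_I convex_UNIV)
qed

section \<open>Symmetry of mixed second derivatives\<close>

lemma has_real_derivative_along:
  assumes "g differentiable (at (y + s *\<^sub>R u))"
  shows "((\<lambda>s. g (y + s *\<^sub>R u)) has_real_derivative frechet_derivative g (at (y + s *\<^sub>R u)) u) (at s)"
proof -
  have g: "(g has_derivative frechet_derivative g (at (y + s *\<^sub>R u))) (at (y + s *\<^sub>R u))"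
    using assms frechet_derivative_works by blast
  have "((\<lambda>s. g (y + s *\<^sub>R u)) has_derivative (\<lambda>r. frechet_derivative g (at (y + s *\<^sub>R u)) (r *\<^sub>R u))) (at s)"
    by (rule has_derivative_compose[of "\<lambda>s. y + s *\<^sub>R u", OF _ g]) (auto intro!: derivative_eq_intros)
  moreover have "(\<lambda>r. frechet_derivative g (at (y + s *\<^sub>R u)) (r *\<^sub>R u)) = (*) (frechet_derivative g (at (y + s *\<^sub>R u)) u)"
    using linear_frechet_derivative[OF assms] by (auto simp: linear_scale)
  ultimately show ?thesis by (simp add: has_field_derivative_def)
qed

text \<open>Mean value theorem twice: first for the difference of \<open>f\<close> between the two
  edges parallel to \<open>u\<close>, then for the derivative along \<open>u\<close> as a function
  of the position along \<open>v\<close>.\<close>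

lemma mixed_difference:
  fixes f :: "'a::real_normed_vector \<Rightarrow> real"
  assumes h: "h > 0" and S: "\<And>s t. 0 \<le> s \<Longrightarrow> s \<le> h \<Longrightarrow> 0 \<le> t \<Longrightarrow> t \<le> h \<Longrightarrow> x + s *\<^sub>R u + t *\<^sub>R v \<in> S"
    and f: "\<And>y. y \<in> S \<Longrightarrow> f differentiable (at y)"
    and f': "\<And>y. y \<in> S \<Longrightarrow> (\<lambda>z. frechet_derivative f (at z) u) differentiable (at y)"
  obtains s t where "0 < s" "s < h" "0 < t" "t < h"
    "f (x + h *\<^sub>R u + h *\<^sub>R v) - f (x + h *\<^sub>R u) - f (x + h *\<^sub>R v) + f x
      = h * h * frechet_derivative (\<lambda>z. frechet_derivative f (at z) u) (at (x + s *\<^sub>R u + t *\<^sub>R v)) v"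
proof -
  define f1 where "f1 z = frechet_derivative f (at z) u" for z
  define \<phi> where "\<phi> s = f (x + h *\<^sub>R v + s *\<^sub>R u) - f (x + s *\<^sub>R u)" for s
  have "(\<phi> has_real_derivative f1 (x + h *\<^sub>R v + s *\<^sub>R u) - f1 (x + s *\<^sub>R u)) (at s)" if "0 \<le> s" "s \<le> h" for s
    unfolding \<phi>_def f1_def
    by (intro DERIV_diff has_real_derivative_along f) (use S[of s h] S[of s 0] that h in \<open>simp_all add: ac_simps\<close>)
  then obtain s where s: "0 < s" "s < h"
    and 1: "\<phi> h - \<phi> 0 = h * (f1 (x + h *\<^sub>R v + s *\<^sub>R u) - f1 (x + s *\<^sub>R u))"
    using MVT2[OF h, of \<phi> "\<lambda>s. f1 (x + h *\<^sub>R v + s *\<^sub>R u) - f1 (x + s *\<^sub>R u)"] by auto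
  have "((\<lambda>t. f1 (x + s *\<^sub>R u + t *\<^sub>R v)) has_real_derivative frechet_derivative f1 (at (x + s *\<^sub>R u + t *\<^sub>R v)) v) (at t)"
    if "0 \<le> t" "t \<le> h" for t
    using f' S[of s t] that s unfolding f1_def by (intro has_real_derivative_along) auto
  then obtain t where t: "0 < t" "t < h" and 2: "f1 (x + s *\<^sub>R u + h *\<^sub>R v) - f1 (x + s *\<^sub>R u + 0 *\<^sub>R v)
      = h * frechet_derivative f1 (at (x + s *\<^sub>R u + t *\<^sub>R v)) v"
    using MVT2[OF h, of "\<lambda>t. f1 (x + s *\<^sub>R u + t *\<^sub>R v)" "\<lambda>t. frechet_derivative f1 (at (x + s *\<^sub>R u + t *\<^sub>R v)) v"] by auto
  show ?thesis
    using s t 1 2 by (intro that[of s t]) (simp_all add: \<phi>_def f1_def[abs_def] ac_simps)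
qed

text \<open>The second difference over a small parallelogram is symmetric in \<open>u\<close> and
  \<open>v\<close>, and it equals \<open>h * h\<close> times either mixed derivative at some nearby
  point; continuity at \<open>x\<close> identifies the limits. The open set \<open>S\<close> allows
  functions of time and position that are controlled only for times in \<open>I\<close>.\<close>

lemma mixed_derivatives_commute:
  fixes f :: "'a::real_normed_vector \<Rightarrow> real"
  assumes S: "open S" "x \<in> S"
    and f: "\<And>y. y \<in> S \<Longrightarrow> f differentiable (at y)"
    and fu: "\<And>y. y \<in> S \<Longrightarrow> (\<lambda>z. frechet_derivative f (at z) u) differentiable (at y)"
    and fv: "\<And>y. y \<in> S \<Longrightarrow> (\<lambda>z. frechet_derivative f (at z) v) differentiable (at y)"
    and c1: "isCont (\<lambda>y. frechet_derivative (\<lambda>z. frechet_derivative f (at z) u) (at y) v) x"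
    and c2: "isCont (\<lambda>y. frechet_derivative (\<lambda>z. frechet_derivative f (at z) v) (at y) u) x"
  shows "frechet_derivative (\<lambda>z. frechet_derivative f (at z) u) (at x) v =
     frechet_derivative (\<lambda>z. frechet_derivative f (at z) v) (at x) u"
proof -
  define g1 where "g1 y = frechet_derivative (\<lambda>z. frechet_derivative f (at z) u) (at y) v" for y
  define g2 where "g2 y = frechet_derivative (\<lambda>z. frechet_derivative f (at z) v) (at y) u" for y
  obtain d where d: "d > 0" "ball x d \<subseteq> S" using S openE by blast
  have *: "\<exists>y z. norm (y - x) < e \<and> norm (z - x) < e \<and> g1 y = g2 z" if e: "e > 0" "e \<le> d" for e
  proof -
    \<comment> \<open>With sides scaled by \<open>h = e / K\<close> the whole parallelogram stays
      within distance \<open>e\<close> of \<open>x\<close>.\<close>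
    define K where "K = norm u + norm v + 1"
    have K: "K > 0" by (simp add: K_def add_nonneg_pos)
    define h where "h = e / K"
    have h: "h > 0" using e K by (simp add: h_def)
    have n: "norm (s *\<^sub>R u + t *\<^sub>R v) < e" if "0 \<le> s" "s \<le> h" "0 \<le> t" "t \<le> h" for s t
    proof -
      have "norm (s *\<^sub>R u + t *\<^sub>R v) \<le> s * norm u + t * norm v"
        using norm_triangle_ineq[of "s *\<^sub>R u" "t *\<^sub>R v"] that by simp
      also have "\<dots> \<le> h * norm u + h * norm v" using that by (intro add_mono mult_right_mono) auto
      also have "\<dots> < h * K" using h by (simp add: K_def algebra_simps)
      finally show ?thesis using K by (simp add: h_def)
    qed
    have inS: "x + s *\<^sub>R u + t *\<^sub>R v \<in> S" "x + s *\<^sub>R v + t *\<^sub>R u \<in> S" if "0 \<le> s" "s \<le> h" "0 \<le> t" "t \<le> h" for s t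
    proof -
      have "dist x (x + (s *\<^sub>R u + t *\<^sub>R v)) < d" "dist x (x + (s *\<^sub>R v + t *\<^sub>R u)) < d"
        using n[of s t] n[of t s] that e by (simp_all add: dist_norm norm_minus_commute add.commute)
      then show "x + s *\<^sub>R u + t *\<^sub>R v \<in> S" "x + s *\<^sub>R v + t *\<^sub>R u \<in> S" using d(2) by (auto simp: add.assoc)
    qed
    obtain s t where 1: "0 < s" "s < h" "0 < t" "t < h"
      "f (x + h *\<^sub>R u + h *\<^sub>R v) - f (x + h *\<^sub>R u) - f (x + h *\<^sub>R v) + f x = h * h * g1 (x + s *\<^sub>R u + t *\<^sub>R v)"
      unfolding g1_def by (rule mixed_difference[OF h inS(1) f fu]) auto
    obtain s' t' where 2: "0 < s'" "s' < h" "0 < t'" "t' < h"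
      "f (x + h *\<^sub>R v + h *\<^sub>R u) - f (x + h *\<^sub>R v) - f (x + h *\<^sub>R u) + f x = h * h * g2 (x + s' *\<^sub>R v + t' *\<^sub>R u)"
      unfolding g2_def by (rule mixed_difference[OF h inS(2) f fv]) auto
    have e: "x + h *\<^sub>R v + h *\<^sub>R u = x + h *\<^sub>R u + h *\<^sub>R v" by (simp add: ac_simps)
    have "h * h * g1 (x + s *\<^sub>R u + t *\<^sub>R v) = h * h * g2 (x + s' *\<^sub>R v + t' *\<^sub>R u)"
      using 1(5) 2(5)[unfolded e] by linarith
    then show ?thesis using n[of s t] n[of t' s'] 1 2 h
      by (intro exI[of _ "x + s *\<^sub>R u + t *\<^sub>R v"] exI[of _ "x + s' *\<^sub>R v + t' *\<^sub>R u"]) (simp add: add.assoc add.commute)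
  qed
  show ?thesis
  proof (rule ccontr)
    assume "\<not> ?thesis"
    then have p: "dist (g1 x) (g2 x) / 2 > 0" by (simp add: g1_def g2_def)
    obtain d1 where d1: "d1 > 0" "\<And>y. norm (y - x) < d1 \<Longrightarrow> dist (g1 y) (g1 x) < dist (g1 x) (g2 x) / 2"
      using c1 p unfolding continuous_at_eps_delta dist_norm g1_def[symmetric] by blast
    obtain d2 where d2: "d2 > 0" "\<And>y. norm (y - x) < d2 \<Longrightarrow> dist (g2 y) (g2 x) < dist (g1 x) (g2 x) / 2"
      using c2 p unfolding continuous_at_eps_delta dist_norm g2_def[symmetric] by blast
    obtain y z where "norm (y - x) < d1" "norm (z - x) < d2" "g1 y = g2 z"
      using *[of "min d (min d1 d2)"] d1(1) d2(1) d(1) by auto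
    then show False using d1(2)[of y] d2(2)[of z] by (simp add: dist_real_def abs_if split: if_splits)
  qed
qed

lemma pd_commute:
  assumes f: "smooth_fun f"
  shows "pd a (pd b f) x = pd b (pd a f) x"
proof -
  have p: "(\<lambda>z. frechet_derivative g (at z) (axis c 1)) = pd c g" for g c
    by (rule ext) (simp add: pd_def)
  show ?thesis
    unfolding pd_def[of a "pd b f"] pd_def[of b "pd a f"] p[symmetric]
    by (rule mixed_derivatives_commute[of UNIV])
      (auto simp: p pd_def[symmetric] f intro!: smooth_fun_differentiable smooth_fun_pd
         differentiable_imp_continuous_within)
qed

section \<open>Closed 1-forms on the torus\<close>

lemma poincare:
  fixes \<alpha> :: "'m::finite \<Rightarrow> real ^ 'm \<Rightarrow> real"
  assumes s: "\<And>a. smooth_fun (\<alpha> a)" and closed: "\<And>a b x. pd a (\<alpha> b) x = pd b (\<alpha> a) x"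
  obtains \<phi> where "smooth_fun \<phi>" "\<And>a. pd a \<phi> = \<alpha> a"
proof -
  \<comment> \<open>Cone construction: the potential at \<open>x\<close> is the integral of the form
    along the segment from the origin to \<open>x\<close>.\<close>
  define F where "F x t = (\<Sum>a\<in>UNIV. \<alpha> a (t *\<^sub>R x) * x $ a)" for x t
  define F' where "F' x t = (\<Sum>b\<in>UNIV. (\<alpha> b (t *\<^sub>R x) + t * (\<Sum>a\<in>UNIV. x $ a * pd a (\<alpha> b) (t *\<^sub>R x)))
       *\<^sub>R blinfun_inner_left (axis b (1::real)))" for x t
  have cont: "continuous_on S (\<lambda>z. g (fst z) (snd z))" if "continuous_on UNIV (\<lambda>z. g (fst z) (snd z))"
    for S and g :: "real^'m \<Rightarrow> real \<Rightarrow> 'q::topological_space"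
    using that continuous_on_subset by blast
  have cs: "continuous_on UNIV (\<lambda>z. g (snd z *\<^sub>R fst z))" if "smooth_fun g" for g :: "real^'m \<Rightarrow> real"
    by (rule continuous_on_compose2[OF smooth_fun_continuous_on[OF that, of UNIV]])
      (auto intro!: continuous_intros)
  have dF: "((\<lambda>x. F x t) has_derivative blinfun_apply (F' x t)) (at x within UNIV)" for x t
  proof -
    have 1: "((\<lambda>x. \<alpha> a (t *\<^sub>R x)) has_derivative (\<lambda>h. \<Sum>b\<in>UNIV. (t *\<^sub>R h) $ b * pd b (\<alpha> a) (t *\<^sub>R x))) (at x)" for a
      by (rule has_derivative_compose[of "\<lambda>x. t *\<^sub>R x", OF _ smooth_fun_has_derivative[OF s]])
        (auto intro!: derivative_eq_intros)
    have 2: "((\<lambda>x. x $ a) has_derivative (\<lambda>h. h $ a)) (at x)" for a and x :: "real^'m"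
      by (rule bounded_linear.has_derivative[OF bounded_linear_vec_nth has_derivative_ident])
    have "((\<lambda>x. F x t) has_derivative (\<lambda>h. \<Sum>a\<in>UNIV. \<alpha> a (t *\<^sub>R x) * h $ a +
        (\<Sum>b\<in>UNIV. (t *\<^sub>R h) $ b * pd b (\<alpha> a) (t *\<^sub>R x)) * x $ a)) (at x)"
      unfolding F_def by (intro has_derivative_sum has_derivative_mult 1 2)
    also have "(\<lambda>h. \<Sum>a\<in>UNIV. \<alpha> a (t *\<^sub>R x) * h $ a +
        (\<Sum>b\<in>UNIV. (t *\<^sub>R h) $ b * pd b (\<alpha> a) (t *\<^sub>R x)) * x $ a) = blinfun_apply (F' x t)"
    proof
      fix h :: "real ^ 'm"
      have "(\<Sum>a\<in>UNIV. (\<Sum>b\<in>UNIV. (t *\<^sub>R h) $ b * pd b (\<alpha> a) (t *\<^sub>R x)) * x $ a) =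
         (\<Sum>a\<in>UNIV. \<Sum>b\<in>UNIV. t * h $ b * x $ a * pd a (\<alpha> b) (t *\<^sub>R x))"
        by (simp add: sum_distrib_left sum_distrib_right closed[of _ "_"] ac_simps)
      also have "\<dots> = (\<Sum>b\<in>UNIV. \<Sum>a\<in>UNIV. t * h $ b * x $ a * pd a (\<alpha> b) (t *\<^sub>R x))"
        by (rule sum.swap)
      finally show "(\<Sum>a\<in>UNIV. \<alpha> a (t *\<^sub>R x) * h $ a +
        (\<Sum>b\<in>UNIV. (t *\<^sub>R h) $ b * pd b (\<alpha> a) (t *\<^sub>R x)) * x $ a) = blinfun_apply (F' x t) h"
        by (simp add: F'_def sum.distrib blinfun.sum_left blinfun.scaleR_left inner_axis
           distrib_left sum_distrib_left sum_distrib_right ac_simps)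
    qed
    finally show ?thesis by simp
  qed
  have cF: "continuous_on UNIV (\<lambda>z. F (fst z) (snd z))"
    unfolding F_def by (intro continuous_intros cs s)
  have cF': "continuous_on UNIV (\<lambda>z. F' (fst z) (snd z))"
    unfolding F'_def by (intro continuous_intros cs s smooth_intros)
  have intF: "F x integrable_on cbox 0 1" for x
    by (intro integrable_continuous continuous_on_compose2[OF cF, of _ "\<lambda>t. (x,t)", simplified])
      (auto intro!: continuous_intros)
  have L: "((\<lambda>x. integral (cbox 0 1) (F x)) has_derivative integral (cbox 0 1) (F' x)) (at x within UNIV)" for x
    by (rule leibniz_rule) (use dF intF cont[OF cF'] in \<open>auto simp: split_beta\<close>)
  define \<phi> where "\<phi> x = integral (cbox 0 1) (F x)" for x
  have pd\<phi>: "pd b \<phi> x = \<alpha> b x" for b x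
  proof -
    have iF': "F' x integrable_on cbox 0 1"
      by (intro integrable_continuous continuous_on_compose2[OF cF', of _ "\<lambda>t. (x,t)", simplified])
        (auto intro!: continuous_intros)
    have "pd b \<phi> x = blinfun_apply (integral (cbox 0 1) (F' x)) (axis b 1)"
      unfolding \<phi>_def using L by (intro has_derivative_pd) simp
    also have "\<dots> = integral (cbox 0 1) (\<lambda>t. blinfun_apply (F' x t) (axis b 1))"
      using blinfun_apply_integral[OF iF'] by simp
    also have "\<dots> = integral (cbox 0 1) (\<lambda>t. \<alpha> b (t *\<^sub>R x) + t * (\<Sum>a\<in>UNIV. x $ a * pd a (\<alpha> b) (t *\<^sub>R x)))"
      by (simp add: F'_def blinfun.sum_left blinfun.scaleR_left inner_axis_axis if_distrib cong: if_cong)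
    \<comment> \<open>The exchange of indices permitted by \<open>closed\<close> has turned the
      integrand into the derivative of \<open>t * \<alpha> b (t *\<^sub>R x)\<close> with respect to
      \<open>t\<close>.\<close>
    also have "\<dots> = 1 * \<alpha> b (1 *\<^sub>R x) - 0 * \<alpha> b (0 *\<^sub>R x)"
      unfolding cbox_interval
    proof (intro integral_unique fundamental_theorem_of_calculus)
      fix t :: real
      have "((\<lambda>t. \<alpha> b (t *\<^sub>R x)) has_derivative (\<lambda>u. \<Sum>a\<in>UNIV. (u *\<^sub>R x) $ a * pd a (\<alpha> b) (t *\<^sub>R x))) (at t within {0..1})"
        by (rule has_derivative_compose[of "\<lambda>t. t *\<^sub>R x", OF _ smooth_fun_has_derivative[OF s]])
          (auto intro!: derivative_eq_intros)
      then have "((\<lambda>t. \<alpha> b (t *\<^sub>R x)) has_vector_derivative (\<Sum>a\<in>UNIV. x $ a * pd a (\<alpha> b) (t *\<^sub>R x))) (at t within {0..1})"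
        by (simp add: has_vector_derivative_def sum_distrib_left mult.assoc)
      then show "((\<lambda>t. t * \<alpha> b (t *\<^sub>R x)) has_vector_derivative \<alpha> b (t *\<^sub>R x) +
          t * (\<Sum>a\<in>UNIV. x $ a * pd a (\<alpha> b) (t *\<^sub>R x))) (at t within {0..1})"
        by (auto intro!: derivative_eq_intros has_vector_derivative_mult)
    qed auto
    finally show ?thesis by simp
  qed
  then have "pd a \<phi> = \<alpha> a" for a by auto
  moreover have "smooth_fun \<phi>"
  proof (rule smooth_funI)
    show "\<phi> differentiable at x" for x
      using L[of x] unfolding \<phi>_def differentiable_def by auto
    show "smooth_fun (pd a \<phi>)" for a
      unfolding calculation by (rule s)
  qed
  ultimately show ?thesis by (rule that[rotated])
qed

lemma
  assumes f: "smooth_fun f"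
  shows smooth_fun_translate: "smooth_fun (\<lambda>x. f (x + k))"
    and pd_translate: "pd a (\<lambda>x. f (x + k)) = (\<lambda>x. pd a f (x + k))"
proof -
  have d: "((\<lambda>x. g (x + k)) has_derivative (\<lambda>h. \<Sum>a\<in>UNIV. h $ a * pd a g (x + k))) (at x)"
    if "smooth_fun g" for g x
    by (rule has_derivative_compose[of "\<lambda>x. x + k", OF _ smooth_fun_has_derivative[OF that]])
      (auto intro!: derivative_eq_intros)
  have p: "pd a (\<lambda>x. g (x + k)) = (\<lambda>x. pd a g (x + k))" if "smooth_fun g" for g a
    by (rule ext, rule trans[OF has_derivative_pd[OF d[OF that]]])
      (simp add: axis_def if_distrib if_distribR cong: if_cong)
  show "pd a (\<lambda>x. f (x + k)) = (\<lambda>x. pd a f (x + k))" by (rule p[OF f])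
  show "smooth_fun (\<lambda>x. f (x + k))"
    by (rule smooth_fun_coinduct[where P="\<lambda>h. \<exists>g. smooth_fun g \<and> h = (\<lambda>x. g (x + k))"])
      (use f d in \<open>auto simp: p differentiable_def intro: smooth_fun_pd\<close>)
qed

lemma torus_fun_smooth: "torus_fun f \<Longrightarrow> smooth_fun f"
  by (simp add: torus_fun_def)

lemma torus_fun_pd: "torus_fun f \<Longrightarrow> torus_fun (pd a f)"
proof -
  assume f: "torus_fun f"
  have "pd a f (x + k) = pd a f x" if "\<forall>i. k $ i \<in> \<int>" for x k
  proof -
    have "(\<lambda>x. f (x + k)) = f" using f that by (auto simp: torus_fun_def lattice_periodic_def)
    then show ?thesis using pd_translate[of f a k] f by (metis torus_fun_smooth)
  qed
  then show ?thesis using f by (auto simp: torus_fun_def lattice_periodic_def intro: smooth_fun_pd)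
qed

lemma torus_fun_const [simp]: "torus_fun (\<lambda>_. c)"
  by (simp add: torus_fun_def lattice_periodic_def)

lemma torus_fun_add: "torus_fun f \<Longrightarrow> torus_fun g \<Longrightarrow> torus_fun (\<lambda>x. f x + g x)"
  and torus_fun_mult: "torus_fun f \<Longrightarrow> torus_fun g \<Longrightarrow> torus_fun (\<lambda>x. f x * g x)"
  and torus_fun_diff: "torus_fun f \<Longrightarrow> torus_fun g \<Longrightarrow> torus_fun (\<lambda>x. f x - g x)"
  and torus_fun_uminus: "torus_fun f \<Longrightarrow> torus_fun (\<lambda>x. - f x)"
  by (auto simp: torus_fun_def lattice_periodic_def intro: smooth_intros)

lemma torus_fun_sum: "(\<And>i. i \<in> A \<Longrightarrow> torus_fun (f i)) \<Longrightarrow> torus_fun (\<lambda>x. \<Sum>i\<in>A. f i x)"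
  by (induction A rule: infinite_finite_induct) (auto intro: torus_fun_add)

lemmas torus_intros = torus_fun_add torus_fun_mult torus_fun_diff torus_fun_uminus torus_fun_sum
  torus_fun_pd torus_fun_const

lemma lattice_periodicI:
  fixes f :: "real ^ 'm::finite \<Rightarrow> 'b"
  assumes "\<And>x a. f (x + axis a 1) = f x"
  shows "lattice_periodic f"
  unfolding lattice_periodic_def
proof (intro allI impI)
  fix x k :: "real ^ 'm"
  assume k: "\<forall>i. k $ i \<in> \<int>"
  have "f (x + axis a (of_int z)) = f x" for x a z
  proof (induction z arbitrary: x rule: int_induct[where k=0])
    case base
    then show ?case by (simp add: axis_def vec_eq_iff zero_vec_def[symmetric])
  next
    case (step1 i)
    have "axis a (of_int (i + 1)) = axis a (of_int i) + axis a (1::real)" by (simp add: axis_def vec_eq_iff)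
    then show ?case using step1 assms[of "x + axis a (of_int i)" a] by (simp add: add.assoc)
  next
    case (step2 i)
    have "axis a (of_int i) = axis a (of_int (i - 1)) + axis a (1::real)" by (simp add: axis_def vec_eq_iff)
    then show ?case using step2 assms[of "x + axis a (of_int (i - 1))" a] by (simp add: add.assoc)
  qed
  then have *: "f (x + axis a (k $ a)) = f x" for x a
    using k by (metis Ints_cases)
  have "f (x + (\<Sum>a\<in>A. axis a (k $ a))) = f x" if "finite A" for A x
    using that by (induction A arbitrary: x) (auto simp: * add.assoc[symmetric])
  moreover have "(\<Sum>a\<in>UNIV. axis a (k $ a)) = k"
    by (simp add: vec_eq_iff axis_def)
  ultimately show "f (x + k) = f x" by (metis finite)
qed

lemma torus_fun_axis: "torus_fun f \<Longrightarrow> f (x + axis a 1) = f x"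
  by (simp add: torus_fun_def lattice_periodic_def axis_def)

text \<open>Along the closed loop in direction \<open>a\<close> the function gains \<open>c\<close>,
  and by periodicity it gains nothing.\<close>

lemma torus_fun_pd_const:
  assumes f: "torus_fun f" and c: "\<And>x. pd a f x = c"
  shows "c = 0"
proof -
  have "((\<lambda>s. f (s *\<^sub>R axis a 1)) has_derivative (\<lambda>u. \<Sum>b\<in>UNIV. (u *\<^sub>R axis a 1) $ b * pd b f (s *\<^sub>R axis a 1))) (at s)" for s
    by (rule has_derivative_compose[of "\<lambda>s. s *\<^sub>R axis a 1", OF _ smooth_fun_has_derivative])
      (use f in \<open>auto intro!: derivative_eq_intros simp: torus_fun_def\<close>)
  then have "((\<lambda>s. f (s *\<^sub>R axis a 1)) has_real_derivative c) (at s)" for s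
    by (simp add: has_field_derivative_def axis_def if_distrib if_distribR c mult_commute_abs cong: if_cong)
  then obtain z where "f (1 *\<^sub>R axis a 1) - f (0 *\<^sub>R axis a 1) = (1 - 0) * c"
    using MVT2[of 0 1 "\<lambda>s. f (s *\<^sub>R axis a 1)" "\<lambda>_. c"] by auto
  moreover have "f (0 + axis a 1) = f 0"
    by (rule torus_fun_axis[OF f])
  ultimately show ?thesis by simp
qed

text \<open>Translation by a lattice vector changes a potential by a constant, because the form is
  periodic. These periods are the coefficients \<open>c\<close>; subtracting the linear function
  with the same periods leaves a periodic potential.\<close>

lemma closed_torus_form:
  fixes \<alpha> :: "'m::finite \<Rightarrow> real ^ 'm \<Rightarrow> real"
  assumes s: "\<And>a. torus_fun (\<alpha> a)" and closed: "\<And>a b x. pd a (\<alpha> b) x = pd b (\<alpha> a) x"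
  obtains \<phi> c where "torus_fun \<phi>" "\<And>a x. \<alpha> a x = c a + pd a \<phi> x"
proof -
  obtain \<psi> where \<psi>: "smooth_fun \<psi>" "\<And>a. pd a \<psi> = \<alpha> a"
    using poincare[of \<alpha>] s closed torus_fun_smooth by metis
  define c where "c a = \<psi> (axis a 1) - \<psi> 0" for a
  have \<psi>c: "\<psi> (x + axis a 1) - \<psi> x = c a" for x a
  proof -
    have "\<psi> (x + axis a 1) - \<psi> x = \<psi> (0 + axis a 1) - \<psi> 0"
    proof (rule pd_zero_imp_const[where f="\<lambda>x. \<psi> (x + axis a 1) - \<psi> x"])
      show "smooth_fun (\<lambda>x. \<psi> (x + axis a 1) - \<psi> x)"
        by (intro smooth_intros smooth_fun_translate \<psi>)
      show "pd b (\<lambda>x. \<psi> (x + axis a 1) - \<psi> x) x = 0" for b x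
        using s[of b] by (simp add: pd_diff smooth_fun_translate pd_translate \<psi> torus_fun_def
            lattice_periodic_def axis_def)
    qed
    then show ?thesis by (simp add: c_def)
  qed
  define \<phi> where "\<phi> x = \<psi> x - (\<Sum>a\<in>UNIV. c a * x $ a)" for x
  have "\<phi> (x + axis a 1) = \<phi> x" for x a
  proof -
    have "(\<Sum>b\<in>UNIV. c b * (x + axis a 1) $ b) = (\<Sum>b\<in>UNIV. c b * x $ b) + c a"
      by (simp add: distrib_left sum.distrib) (simp add: axis_def if_distrib cong: if_cong)
    then show ?thesis using \<psi>c[of x a] by (simp add: \<phi>_def)
  qed
  then have "lattice_periodic \<phi>" by (rule lattice_periodicI)
  moreover have "smooth_fun \<phi>"
    unfolding \<phi>_def by (intro smooth_intros \<psi> smooth_fun_component)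
  moreover have "\<alpha> a x = c a + pd a \<phi> x" for a x
    unfolding \<phi>_def by (simp add: pd_diff pd_sum pd_cmult smooth_fun_sum smooth_fun_cmult \<psi>
       pd_component if_distrib cong: if_cong)
  ultimately show ?thesis by (intro that[of \<phi> c]) (auto simp: torus_fun_def)
qed

text \<open>A substitute for Stokes' theorem on coordinate 2-tori that avoids integration: a linear
  primitive of \<open>C\<close> is removed, and the second difference of a potential of the rest
  over a unit square is computed in both orders.\<close>

lemma exact_torus_form_const:
  fixes \<beta> :: "'m::finite \<Rightarrow> real ^ 'm \<Rightarrow> real"
  assumes s: "\<And>a. torus_fun (\<beta> a)" and C: "\<And>a b x. pd a (\<beta> b) x - pd b (\<beta> a) x = C a b"
  shows "C a b = 0"
proof -
  have anti: "C a b = - C b a" for a b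
    using C[of a b undefined] C[of b a undefined] by linarith
  \<comment> \<open>The factor one half appears because the exterior derivative meets each entry of
    the antisymmetric \<open>C\<close> twice. The form \<open>\<alpha>\<close> is closed but no
    longer periodic.\<close>
  define \<alpha> where "\<alpha> b x = \<beta> b x - (\<Sum>d\<in>UNIV. C d b / 2 * x $ d)" for b x
  have s': "smooth_fun (\<beta> a)" for a using s torus_fun_smooth by blast
  have sl: "smooth_fun (\<lambda>x. \<Sum>d\<in>UNIV. K d * x $ d)" for K :: "'m \<Rightarrow> real"
    by (intro smooth_intros smooth_fun_component)
  have pl: "pd a (\<lambda>x. \<Sum>d\<in>UNIV. K d * x $ d) = (\<lambda>_. K a)" for K :: "'m \<Rightarrow> real" and a
    by (simp add: pd_sum pd_cmult smooth_fun_cmult pd_component if_distrib cong: if_cong)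
  have p: "pd a (\<alpha> b) x = pd a (\<beta> b) x - C a b / 2" for a b x
    unfolding \<alpha>_def by (simp add: pd_diff s' sl pl del: times_divide_eq_left)
  have s\<alpha>: "smooth_fun (\<alpha> a)" for a
    unfolding \<alpha>_def by (intro smooth_intros s' smooth_fun_component)
  have "pd a (\<alpha> b) x = pd b (\<alpha> a) x" for a b x
    unfolding p using C[of a b x] anti[of a b] by linarith
  then obtain \<phi> where \<phi>: "smooth_fun \<phi>" "\<And>a. pd a \<phi> = \<alpha> a"
    using poincare[of \<alpha>] s\<alpha> by metis
  have *: "\<phi> (axis b 1 + axis a 1) - \<phi> (axis b 1) = \<phi> (axis a 1) - \<phi> 0 - C a b / 2" for a b
  proof -
    define \<psi> where "\<psi> x = \<phi> (x + axis a 1) - \<phi> x + (\<Sum>d\<in>UNIV. C a d / 2 * x $ d)" for x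
    have "\<psi> (axis b 1) = \<psi> 0"
    proof (rule pd_zero_imp_const)
      show "smooth_fun \<psi>" unfolding \<psi>_def by (intro smooth_fun_add[OF _ sl] smooth_intros smooth_fun_translate \<phi>)
      fix d x
      have "\<alpha> d (x + axis a 1) - \<alpha> d x = - (\<Sum>e\<in>UNIV. C e d / 2 * (axis a 1) $ e)"
        using s[of d] by (simp add: \<alpha>_def torus_fun_def lattice_periodic_def axis_def distrib_left sum.distrib)
      also have "\<dots> = - C a d / 2" by (simp add: axis_def if_distrib cong: if_cong)
      finally show "pd d \<psi> x = 0"
        unfolding \<psi>_def
        by (simp add: pd_add pd_diff smooth_fun_diff smooth_fun_translate pd_translate \<phi> sl pl
            del: times_divide_eq_left)
    qed
    then show ?thesis by (simp add: \<psi>_def axis_def if_distrib cong: if_cong)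
  qed
  \<comment> \<open>The second difference of \<open>\<phi>\<close> over the unit square is symmetric
    in \<open>a\<close> and \<open>b\<close>, while its value \<open>- C a b / 2\<close> is
    antisymmetric.\<close>
  show ?thesis using *[of a b] *[of b a] anti[of a b] by (simp add: add.commute)
qed

section \<open>Real analytic functions\<close>

abbreviation multi_indices :: "('a::euclidean_space \<Rightarrow> nat) set" where
  "multi_indices \<equiv> Basis \<rightarrow>\<^sub>E UNIV"

definition monomial :: "'a::euclidean_space \<Rightarrow> ('a \<Rightarrow> nat) \<Rightarrow> real" where
  "monomial y \<alpha> = (\<Prod>b\<in>Basis. (y \<bullet> b) ^ \<alpha> b)"

definition monomial_deriv :: "'a::euclidean_space \<Rightarrow> 'a \<Rightarrow> ('a \<Rightarrow> nat) \<Rightarrow> real" where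
  "monomial_deriv b y \<alpha> = real (\<alpha> b) * (y \<bullet> b) ^ (\<alpha> b - 1) * (\<Prod>b'\<in>Basis - {b}. (y \<bullet> b') ^ \<alpha> b')"

lemma has_derivative_monomial:
  "((\<lambda>x. monomial (x - p) \<alpha>) has_derivative (\<lambda>h. \<Sum>b\<in>Basis. (h \<bullet> b) * monomial_deriv b (x - p) \<alpha>)) (at x within S)"
proof -
  have "((\<lambda>x. ((x - p) \<bullet> b) ^ \<alpha> b) has_derivative (\<lambda>h. real (\<alpha> b) * (h \<bullet> b) * ((x - p) \<bullet> b) ^ (\<alpha> b - 1))) (at x within S)" for b
    by (auto intro!: derivative_eq_intros)
  then have "((\<lambda>x. monomial (x - p) \<alpha>) has_derivative (\<lambda>h. \<Sum>b\<in>Basis.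
      (real (\<alpha> b) * (h \<bullet> b) * ((x - p) \<bullet> b) ^ (\<alpha> b - 1)) * (\<Prod>b'\<in>Basis - {b}. ((x - p) \<bullet> b') ^ \<alpha> b'))) (at x within S)"
    unfolding monomial_def by (intro has_derivative_prod)
  then show ?thesis by (simp add: monomial_deriv_def ac_simps)
qed

text \<open>The factor \<open>\<alpha> b\<close> produced by differentiation is absorbed by
  \<open>2 ^ \<alpha> b\<close>, so doubling the radius gives a bound by a monomial with the same
  exponents.\<close>

lemma monomial_deriv_bound:
  assumes b: "b \<in> Basis" and y: "norm y \<le> \<sigma>" and \<sigma>: "\<sigma> > 0"
  shows "\<bar>monomial_deriv b y \<alpha>\<bar> \<le> (\<Prod>b\<in>Basis. (2 * \<sigma>) ^ \<alpha> b) / \<sigma>"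
proof (cases "\<alpha> b = 0")
  case True
  then show ?thesis using \<sigma> by (simp add: monomial_deriv_def prod_nonneg)
next
  case False
  have yb: "\<bar>y \<bullet> b'\<bar> \<le> \<sigma>" if "b' \<in> Basis" for b'
    using Basis_le_norm[OF that, of y] y by simp
  have "\<bar>monomial_deriv b y \<alpha>\<bar> = real (\<alpha> b) * \<bar>y \<bullet> b\<bar> ^ (\<alpha> b - 1) * (\<Prod>b'\<in>Basis - {b}. \<bar>y \<bullet> b'\<bar> ^ \<alpha> b')"
    by (simp add: monomial_deriv_def abs_mult power_abs abs_prod)
  also have "\<dots> \<le> 2 ^ \<alpha> b * \<sigma> ^ (\<alpha> b - 1) * (\<Prod>b'\<in>Basis - {b}. (2 * \<sigma>) ^ \<alpha> b')"
  proof (rule mult_mono)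
    show "real (\<alpha> b) * \<bar>y \<bullet> b\<bar> ^ (\<alpha> b - 1) \<le> 2 ^ \<alpha> b * \<sigma> ^ (\<alpha> b - 1)"
      by (intro mult_mono power_mono yb[OF b]) (simp_all add: of_nat_less_two_power less_imp_le)
    have "\<bar>y \<bullet> b'\<bar> ^ \<alpha> b' \<le> (2 * \<sigma>) ^ \<alpha> b'" if "b' \<in> Basis - {b}" for b'
      using yb[of b'] that \<sigma> by (intro power_mono) auto
    then show "(\<Prod>b'\<in>Basis - {b}. \<bar>y \<bullet> b'\<bar> ^ \<alpha> b') \<le> (\<Prod>b'\<in>Basis - {b}. (2 * \<sigma>) ^ \<alpha> b')"
      by (intro prod_mono) auto
  qed (use \<sigma> in \<open>auto intro!: prod_nonneg mult_nonneg_nonneg\<close>)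
  also have "2 ^ \<alpha> b * \<sigma> ^ (\<alpha> b - 1) = (2 * \<sigma>) ^ \<alpha> b / \<sigma>"
    using False \<sigma> by (cases "\<alpha> b") (simp_all add: power_mult_distrib)
  also have "(2 * \<sigma>) ^ \<alpha> b / \<sigma> * (\<Prod>b'\<in>Basis - {b}. (2 * \<sigma>) ^ \<alpha> b') = (\<Prod>b\<in>Basis. (2 * \<sigma>) ^ \<alpha> b) / \<sigma>"
    using b by (simp add: prod.remove)
  finally show ?thesis .
qed

lemma infinite_multi_indices: "infinite (multi_indices :: ('a::euclidean_space \<Rightarrow> nat) set)"
proof -
  obtain b :: 'a where b: "b \<in> Basis" using nonempty_Basis by blast
  have "inj (\<lambda>k. restrict (\<lambda>_::'a. k) Basis :: 'a \<Rightarrow> nat)"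
    by (rule injI) (metis b restrict_apply')
  then have "infinite (range (\<lambda>k. restrict (\<lambda>_::'a. k) Basis :: 'a \<Rightarrow> nat))"
    by (rule range_inj_infinite)
  moreover have "range (\<lambda>k. restrict (\<lambda>_::'a. k) Basis :: 'a \<Rightarrow> nat) \<subseteq> multi_indices" by auto
  ultimately show ?thesis by (rule infinite_super[rotated])
qed

lemma multi_power_series_derivative:
  fixes f :: "'a::euclidean_space \<Rightarrow> real"
  assumes r: "r > 0" and f: "\<And>x. x \<in> ball p r \<Longrightarrow> ((\<lambda>\<alpha>. c \<alpha> * monomial (x - p) \<alpha>) has_sum f x) multi_indices"
  obtains \<sigma> g where "\<sigma> > 0" "\<sigma> \<le> r"
    "\<And>x. x \<in> ball p \<sigma> \<Longrightarrow> (f has_derivative (\<lambda>h. \<Sum>b\<in>Basis. (h \<bullet> b) * g b x)) (at x)"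
    "\<And>x b. x \<in> ball p \<sigma> \<Longrightarrow> b \<in> Basis \<Longrightarrow> ((\<lambda>\<alpha>. c \<alpha> * monomial_deriv b (x - p) \<alpha>) has_sum g b x) multi_indices"
proof -
  \<comment> \<open>With this radius the point whose coordinates all equal
    \<open>2 * \<sigma>\<close> still lies within distance \<open>r\<close>; absolute convergence
    there yields the majorant \<open>M\<close>.\<close>
  define \<sigma> where "\<sigma> = r / (2 * (DIM('a) + 1))"
  have \<sigma>: "\<sigma> > 0" "\<sigma> \<le> r" using r by (simp_all add: \<sigma>_def field_simps)
  define M where "M \<alpha> = \<bar>c \<alpha>\<bar> * (\<Prod>b\<in>Basis. (2 * \<sigma>) ^ \<alpha> b) / \<sigma>" for \<alpha> :: "'a \<Rightarrow> nat"
  have M0: "M \<alpha> \<ge> 0" for \<alpha> using \<sigma> by (auto simp: M_def intro!: divide_nonneg_pos mult_nonneg_nonneg prod_nonneg)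
  have M: "M summable_on multi_indices"
  proof -
    define y :: 'a where "y = (\<Sum>b\<in>Basis. (2 * \<sigma>) *\<^sub>R b)"
    have "norm y \<le> (\<Sum>b\<in>(Basis::'a set). 2 * \<sigma>)"
      unfolding y_def by (rule order_trans[OF norm_sum]) (use \<sigma> in \<open>auto intro!: sum_mono\<close>)
    also have "\<dots> = DIM('a) * (2 * \<sigma>)" by simp
    also have "\<dots> < r" using r by (simp add: \<sigma>_def field_simps)
    finally have "((\<lambda>\<alpha>. c \<alpha> * monomial (p + y - p) \<alpha>) has_sum f (p + y)) multi_indices"
      by (intro f) (simp add: dist_norm)
    then have "(\<lambda>\<alpha>. norm (c \<alpha> * monomial y \<alpha>)) summable_on multi_indices"
      using summable_on_iff_abs_summable_on_real has_sum_imp_summable by fastforce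
    moreover have "monomial y \<alpha> = (\<Prod>b\<in>Basis. (2 * \<sigma>) ^ \<alpha> b)" for \<alpha>
      unfolding monomial_def y_def by (intro prod.cong refl) simp
    ultimately have "(\<lambda>\<alpha>. \<bar>c \<alpha>\<bar> * (\<Prod>b\<in>Basis. (2 * \<sigma>) ^ \<alpha> b)) summable_on multi_indices"
      using \<sigma> by (simp add: abs_mult abs_prod prod_nonneg)
    then show ?thesis unfolding M_def divide_inverse by (intro summable_on_cmult_left)
  qed
  \<comment> \<open>An enumeration of the multi-indices turns the unordered sum into a series to
    which \<open>has_derivative_series\<close> applies; the absolute bound \<open>M\<close> later
    allows the return to unordered sums.\<close>
  define e where "e = from_nat_into (multi_indices :: ('a \<Rightarrow> nat) set)"
  have e: "bij_betw e UNIV multi_indices"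
    unfolding e_def by (intro bij_betw_from_nat_into infinite_multi_indices countable_PiE finite_Basis) auto
  have Ms: "summable (\<lambda>i. M (e i))"
    using summable_on_reindex_bij_betw[OF e, of M] M by (intro summable_on_imp_summable) simp
  define T' where "T' b x i = c (e i) * monomial_deriv b (x - p) (e i)" for b x i
  define g where "g b x = (\<Sum>i. T' b x i)" for b x
  have T'M: "\<bar>c \<alpha> * monomial_deriv b (x - p) \<alpha>\<bar> \<le> M \<alpha>" if "x \<in> ball p \<sigma>" "b \<in> Basis" for x b \<alpha>
    using monomial_deriv_bound[OF that(2) _ \<sigma>(1), of "x - p" \<alpha>] that(1)
    by (auto simp: M_def abs_mult dist_norm norm_minus_commute intro!: mult_left_mono simp flip: times_divide_eq_right)
  have T's: "summable (T' b x)" if "x \<in> ball p \<sigma>" "b \<in> Basis" for x b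
    unfolding T'_def by (rule summable_comparison_test'[OF Ms, of 0]) (use T'M[OF that] in auto)
  have tail: "\<bar>(\<Sum>i<n. T' b x i) - g b x\<bar> \<le> (\<Sum>i. M (e (i + n)))" if "x \<in> ball p \<sigma>" "b \<in> Basis" for x b n
  proof -
    have "g b x - (\<Sum>i<n. T' b x i) = (\<Sum>i. T' b x (i + n))"
      unfolding g_def using suminf_split_initial_segment[OF T's[OF that], of n] by simp
    moreover have "\<bar>\<Sum>i. T' b x (i + n)\<bar> \<le> (\<Sum>i. M (e (i + n)))"
      using norm_suminf_le[of "\<lambda>i. T' b x (i + n)" "\<lambda>i. M (e (i + n))"] T'M[OF that]
        summable_ignore_initial_segment[OF Ms, of n]
      by (simp add: T'_def)
    ultimately show ?thesis by (simp add: abs_minus_commute)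
  qed
  have tend: "(\<lambda>n. \<Sum>i. M (e (i + n))) \<longlonglongrightarrow> 0"
    by (rule suminf_exist_split2[OF Ms])
  have fsums: "(\<lambda>i. c (e i) * monomial (x - p) (e i)) sums f x" if "x \<in> ball p r" for x
    using f[OF that] unfolding has_sum_reindex_bij_betw[OF e, of "\<lambda>\<alpha>. c \<alpha> * monomial (x - p) \<alpha>", symmetric] by (rule has_sum_imp_sums)
  have "\<exists>G. \<forall>x\<in>ball p \<sigma>. (\<lambda>i. c (e i) * monomial (x - p) (e i)) sums G x \<and>
    (G has_derivative (\<lambda>h. \<Sum>b\<in>Basis. (h \<bullet> b) * g b x)) (at x within ball p \<sigma>)"
  proof (rule has_derivative_series[where f'="\<lambda>i x h. \<Sum>b\<in>Basis. (h \<bullet> b) * T' b x i"])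
    show "convex (ball p \<sigma>)" by simp
    show "p \<in> ball p \<sigma>" using \<sigma> by simp
    show "(\<lambda>i. c (e i) * monomial (p - p) (e i)) sums f p" using r by (intro fsums) simp
    show "((\<lambda>x. c (e i) * monomial (x - p) (e i)) has_derivative (\<lambda>h. \<Sum>b\<in>Basis. (h \<bullet> b) * T' b x i)) (at x within ball p \<sigma>)" for i x
      unfolding T'_def using has_derivative_mult_right[OF has_derivative_monomial, of "c (e i)"]
      by (simp add: sum_distrib_left ac_simps)
    fix \<epsilon> :: real assume \<epsilon>: "\<epsilon> > 0"
    have "\<forall>\<^sub>F n in sequentially. (\<Sum>i. M (e (i + n))) < \<epsilon> / DIM('a)"
      using tend \<epsilon> by (intro order_tendstoD(2)) auto
    then show "\<forall>\<^sub>F n in sequentially. \<forall>x\<in>ball p \<sigma>. \<forall>h. norm ((\<Sum>i<n. \<Sum>b\<in>Basis. (h \<bullet> b) * T' b x i) - (\<Sum>b\<in>Basis. (h \<bullet> b) * g b x)) \<le> \<epsilon> * norm h"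
    proof eventually_elim
      case (elim n)
      show ?case
      proof (intro ballI allI)
        fix x h assume x: "x \<in> ball p \<sigma>"
        have "(\<Sum>i<n. \<Sum>b\<in>Basis. (h \<bullet> b) * T' b x i) - (\<Sum>b\<in>Basis. (h \<bullet> b) * g b x)
          = (\<Sum>b\<in>Basis. (h \<bullet> b) * ((\<Sum>i<n. T' b x i) - g b x))"
          by (subst sum.swap) (simp add: sum_distrib_left right_diff_distrib sum_subtractf)
        also have "norm \<dots> \<le> (\<Sum>b\<in>(Basis :: 'a set). norm h * (\<epsilon> / DIM('a)))"
        proof (intro order_trans[OF norm_sum] sum_mono)
          fix b :: 'a assume b: "b \<in> Basis"
          have "\<bar>(\<Sum>i<n. T' b x i) - g b x\<bar> \<le> \<epsilon> / DIM('a)"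
            using tail[OF x b] elim by (meson less_imp_le order_trans)
          then have "\<bar>h \<bullet> b\<bar> * \<bar>(\<Sum>i<n. T' b x i) - g b x\<bar> \<le> norm h * (\<epsilon> / DIM('a))"
            by (intro mult_mono Basis_le_norm b) auto
          then show "norm ((h \<bullet> b) * ((\<Sum>i<n. T' b x i) - g b x)) \<le> norm h * (\<epsilon> / DIM('a))"
            by (simp only: real_norm_def abs_mult)
        qed
        also have "\<dots> = \<epsilon> * norm h" by simp
        finally show "norm ((\<Sum>i<n. \<Sum>b\<in>Basis. (h \<bullet> b) * T' b x i) - (\<Sum>b\<in>Basis. (h \<bullet> b) * g b x)) \<le> \<epsilon> * norm h" .
      qed
    qed
  qed
  then obtain G where G: "\<And>x. x \<in> ball p \<sigma> \<Longrightarrow> (\<lambda>i. c (e i) * monomial (x - p) (e i)) sums G x"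
    "\<And>x. x \<in> ball p \<sigma> \<Longrightarrow> (G has_derivative (\<lambda>h. \<Sum>b\<in>Basis. (h \<bullet> b) * g b x)) (at x within ball p \<sigma>)" by blast
  have Gf: "G x = f x" if "x \<in> ball p \<sigma>" for x
    using sums_unique2[OF G(1)[OF that] fsums] that \<sigma> by auto
  show ?thesis
  proof (rule that[OF \<sigma>])
    fix x assume x: "x \<in> ball p \<sigma>"
    then have "(f has_derivative (\<lambda>h. \<Sum>b\<in>Basis. (h \<bullet> b) * g b x)) (at x within ball p \<sigma>)"
      by (intro has_derivative_transform[OF _ _ G(2)]) (auto simp: Gf)
    then show "(f has_derivative (\<lambda>h. \<Sum>b\<in>Basis. (h \<bullet> b) * g b x)) (at x)"
      using x at_within_open[of x "ball p \<sigma>"] by simp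
    fix b :: 'a assume b: "b \<in> Basis"
    have "(\<lambda>\<alpha>. c \<alpha> * monomial_deriv b (x - p) \<alpha>) summable_on multi_indices"
      by (rule abs_summable_summable, rule Infinite_Sum.abs_summable_on_comparison_test'[OF M]) (use T'M[OF x b] in simp)
    then obtain l where l: "((\<lambda>\<alpha>. c \<alpha> * monomial_deriv b (x - p) \<alpha>) has_sum l) multi_indices"
      by (auto simp: summable_on_def)
    then have "T' b x sums l"
      unfolding T'_def has_sum_reindex_bij_betw[OF e, of "\<lambda>\<alpha>. c \<alpha> * monomial_deriv b (x - p) \<alpha>", symmetric] by (rule has_sum_imp_sums)
    then have "l = g b x" by (simp add: g_def sums_iff)
    then show "((\<lambda>\<alpha>. c \<alpha> * monomial_deriv b (x - p) \<alpha>) has_sum g b x) multi_indices" using l by simp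
  qed
qed

text \<open>Terms with \<open>\<alpha> b = 0\<close> vanish and the others are reindexed by lowering
  that exponent. This brings the differentiated series back to the shape required by
  \<open>real_analytic_on\<close>.\<close>

lemma monomial_deriv_shift:
  assumes b: "b \<in> Basis"
  shows "((\<lambda>\<alpha>. c \<alpha> * monomial_deriv b y \<alpha>) has_sum l) multi_indices \<longleftrightarrow>
    ((\<lambda>\<alpha>. (c (\<alpha>(b := Suc (\<alpha> b))) * Suc (\<alpha> b)) * monomial y \<alpha>) has_sum l) multi_indices"
proof -
  let ?S = "{\<alpha> \<in> multi_indices. \<alpha> b > 0}"
  have "((\<lambda>\<alpha>. c \<alpha> * monomial_deriv b y \<alpha>) has_sum l) multi_indices \<longleftrightarrow> ((\<lambda>\<alpha>. c \<alpha> * monomial_deriv b y \<alpha>) has_sum l) ?S"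
    by (rule has_sum_cong_neutral) (auto simp: monomial_deriv_def)
  also have "\<dots> \<longleftrightarrow> ((\<lambda>\<alpha>. (c (\<alpha>(b := Suc (\<alpha> b))) * Suc (\<alpha> b)) * monomial y \<alpha>) has_sum l) multi_indices"
  proof (rule has_sum_reindex_bij_witness[where i="\<lambda>\<alpha>. \<alpha>(b := Suc (\<alpha> b))" and j="\<lambda>\<alpha>. \<alpha>(b := \<alpha> b - 1)"])
    fix \<alpha> assume \<alpha>: "\<alpha> \<in> ?S"
    have "monomial y (\<alpha>(b := \<alpha> b - 1)) = (y \<bullet> b) ^ (\<alpha> b - 1) * (\<Prod>b'\<in>Basis - {b}. (y \<bullet> b') ^ \<alpha> b')"
      unfolding monomial_def using b by (subst prod.remove[of _ b]) (auto intro!: prod.cong)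
    then show "c ((\<alpha>(b := \<alpha> b - 1))(b := Suc ((\<alpha>(b := \<alpha> b - 1)) b))) * real (Suc ((\<alpha>(b := \<alpha> b - 1)) b)) * monomial y (\<alpha>(b := \<alpha> b - 1)) =
       c \<alpha> * monomial_deriv b y \<alpha>"
      using \<alpha> by (simp add: monomial_deriv_def)
  qed (use b in \<open>auto simp: PiE_def extensional_def\<close>)
  finally show ?thesis .
qed

lemma real_analytic_on_monomial:
  "real_analytic_on f S \<longleftrightarrow> (\<forall>p\<in>S. \<exists>r>0. \<exists>c. \<forall>x\<in>ball p r. ((\<lambda>\<alpha>. c \<alpha> * monomial (x - p) \<alpha>) has_sum f x) multi_indices)"
  by (simp add: real_analytic_on_def monomial_def)

lemma
  assumes "real_analytic_on f S"
  shows real_analytic_on_differentiable: "p \<in> S \<Longrightarrow> f differentiable (at p)"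
    and real_analytic_on_derivative: "b \<in> Basis \<Longrightarrow> real_analytic_on (\<lambda>x. frechet_derivative f (at x) b) S"
proof -
  have *: "\<exists>\<sigma>>0. f differentiable (at p) \<and> (\<forall>b\<in>Basis. \<exists>c. \<forall>x\<in>ball p \<sigma>. ((\<lambda>\<alpha>. c \<alpha> * monomial (x - p) \<alpha>) has_sum frechet_derivative f (at x) b) multi_indices)"
    if p: "p \<in> S" for p
  proof -
    obtain r c where r: "r > 0" and f: "\<And>x. x \<in> ball p r \<Longrightarrow> ((\<lambda>\<alpha>. c \<alpha> * monomial (x - p) \<alpha>) has_sum f x) multi_indices"
      using assms p unfolding real_analytic_on_monomial by blast
    obtain \<sigma> g where \<sigma>: "\<sigma> > 0" "\<sigma> \<le> r" and d: "\<And>x. x \<in> ball p \<sigma> \<Longrightarrow> (f has_derivative (\<lambda>h. \<Sum>b\<in>Basis. (h \<bullet> b) * g b x)) (at x)"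
      and s: "\<And>x b. x \<in> ball p \<sigma> \<Longrightarrow> b \<in> Basis \<Longrightarrow> ((\<lambda>\<alpha>. c \<alpha> * monomial_deriv b (x - p) \<alpha>) has_sum g b x) multi_indices"
      by (rule multi_power_series_derivative[OF r f]) (assumption | blast)+
    have "frechet_derivative f (at x) b = g b x" if "x \<in> ball p \<sigma>" "b \<in> Basis" for x b
      using frechet_derivative_at[OF d[OF that(1)], symmetric] that(2)
      by (simp add: inner_Basis if_distrib if_distribR cong: if_cong)
    then have h: "((\<lambda>\<alpha>. (c (\<alpha>(b := Suc (\<alpha> b))) * Suc (\<alpha> b)) * monomial (x - p) \<alpha>) has_sum frechet_derivative f (at x) b) multi_indices"
      if "x \<in> ball p \<sigma>" "b \<in> Basis" for x b
      using s[OF that] that monomial_deriv_shift[OF that(2)] by simp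
    have "f differentiable (at p)" using d[of p] \<sigma> by (auto simp: differentiable_def)
    moreover have "\<exists>c. \<forall>x\<in>ball p \<sigma>. ((\<lambda>\<alpha>. c \<alpha> * monomial (x - p) \<alpha>) has_sum frechet_derivative f (at x) b) multi_indices"
      if "b \<in> Basis" for b
      by (rule exI[of _ "\<lambda>\<alpha>. c (\<alpha>(b := Suc (\<alpha> b))) * Suc (\<alpha> b)"]) (use h that in simp)
    ultimately show ?thesis using \<sigma>(1) by (intro exI[of _ \<sigma>] conjI ballI)
  qed
  show "f differentiable (at p)" if "p \<in> S" using *[OF that] by blast
  show "real_analytic_on (\<lambda>x. frechet_derivative f (at x) b) S" if "b \<in> Basis"
    unfolding real_analytic_on_monomial
  proof
    fix p assume "p \<in> S"
    from *[OF this] obtain \<sigma> where "\<sigma> > 0" and "\<forall>b\<in>Basis. \<exists>c. \<forall>x\<in>ball p \<sigma>.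
      ((\<lambda>\<alpha>. c \<alpha> * monomial (x - p) \<alpha>) has_sum frechet_derivative f (at x) b) multi_indices"
      by (elim exE conjE) rule
    from this(1) bspec[OF this(2) that] show "\<exists>r>0. \<exists>c. \<forall>x\<in>ball p r.
      ((\<lambda>\<alpha>. c \<alpha> * monomial (x - p) \<alpha>) has_sum frechet_derivative f (at x) b) multi_indices"
      by (intro exI[of _ \<sigma>] conjI)
  qed
qed

section \<open>Identity theorem in one real variable\<close>

lemma fps_expansion_isolated_zero:
  fixes f :: "real \<Rightarrow> real"
  assumes "f has_fps_expansion F" "F \<noteq> 0"
  shows "\<forall>\<^sub>F s in at 0. f s \<noteq> 0"
proof -
  have ev: "\<forall>\<^sub>F s in at 0. eval_fps F s = f s" and R: "fps_conv_radius F > 0"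
    using assms(1) unfolding has_fps_expansion_def by (auto simp: eventually_at_filter elim: eventually_mono)
  have "\<forall>\<^sub>F s in at 0. eval_fps F s \<noteq> 0"
  \<comment> \<open>The result on isolated zeros, \<open>powser_0_nonzero\<close>, concerns series
    that vanish at the center; otherwise continuity suffices.\<close>
  proof (cases "fps_nth F 0 = 0")
    case False
    have "continuous (at 0) (eval_fps F)"
      using R by (intro continuous_eval_fps) (auto simp: zero_ereal_def)
    then have "(eval_fps F \<longlongrightarrow> fps_nth F 0) (at 0)" by (simp add: isCont_def eval_fps_at_0)
    then show ?thesis using False tendsto_imp_eventually_ne by blast
  next
    case True
    obtain m where m: "fps_nth F m \<noteq> 0" using assms(2) by (auto simp: fps_eq_iff)
    then have m0: "m > 0" using True by (cases m) auto
    obtain r where r: "r > 0" "ereal r < fps_conv_radius F"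
      using R ereal_dense2[of 0 "fps_conv_radius F"] by auto
    have "(\<lambda>n. fps_nth F n * (x - 0) ^ n) sums eval_fps F x" if "norm (x - 0) < r" for x
    proof -
      have "ereal (norm x) < ereal r" using that by simp
      then have "ereal (norm x) < fps_conv_radius F" using r(2) by (rule less_trans)
      then show ?thesis using sums_eval_fps[of x F] by simp
    qed
    then obtain s where "s > 0" "\<And>z. z \<in> cball 0 s - {0} \<Longrightarrow> eval_fps F z \<noteq> 0"
      using powser_0_nonzero[OF r(1), of 0 "fps_nth F" "eval_fps F" m] True m m0 by (auto simp: eval_fps_at_0)
    then show ?thesis
      unfolding eventually_at by (intro exI[of _ s]) (auto simp: dist_norm)
  qed
  then show ?thesis using ev by eventually_elim simp
qed

lemma fps_expansion_unique:
  fixes f :: "real \<Rightarrow> real"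
  assumes "f has_fps_expansion F" "f has_fps_expansion G"
  shows "F = G"
proof (rule ccontr)
  assume "F \<noteq> G"
  then have "\<forall>\<^sub>F s in at 0. f s - f s \<noteq> 0"
    by (intro fps_expansion_isolated_zero[OF has_fps_expansion_diff[OF assms]]) simp
  then show False by simp
qed

lemma fps_expansion_cong:
  "f has_fps_expansion F \<Longrightarrow> \<forall>\<^sub>F s in nhds 0. f s = g s \<Longrightarrow> g has_fps_expansion F"
  unfolding has_fps_expansion_def by (auto elim: eventually_elim2)

text \<open>At each point of \<open>I\<close> the expansion is zero, and then \<open>g\<close>
  vanishes nearby, or it is nonzero, and then \<open>g\<close> has no other zero nearby. So the set
  of points around which \<open>g\<close> vanishes is open and closed in the interval.\<close>

lemma identity_theorem:
  fixes g :: "real \<Rightarrow> real"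
  assumes I: "open I" "is_interval I" "0 \<in> I" "t \<in> I"
    and g: "\<And>s. s \<in> I \<Longrightarrow> \<exists>F. (\<lambda>h. g (s + h)) has_fps_expansion F"
    and g0: "g has_fps_expansion 0"
  shows "g t = 0"
proof -
  have trans: "(\<forall>x. Q x \<longrightarrow> P (s + x)) \<longleftrightarrow> (\<forall>x. Q (x - s) \<longrightarrow> P x)" for P Q and s :: real
  proof safe
    fix x assume "\<forall>x. Q x \<longrightarrow> P (s + x)" "Q (x - s)"
    then show "P x" by (metis add.commute diff_add_cancel)
  next
    fix x assume "\<forall>x. Q (x - s) \<longrightarrow> P x" "Q x"
    then show "P (s + x)" by (metis add_diff_cancel_left')
  qed
  have sh: "(\<forall>\<^sub>F h in at 0. P (s + h)) \<longleftrightarrow> (\<forall>\<^sub>F x in at s. P x)" for P and s :: real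
  proof -
    have "(\<forall>x\<in>UNIV. x \<noteq> 0 \<and> dist x 0 < d \<longrightarrow> P (s + x)) \<longleftrightarrow> (\<forall>x\<in>UNIV. x \<noteq> s \<and> dist x s < d \<longrightarrow> P x)" for d
      using trans[of "\<lambda>x. x \<noteq> 0 \<and> dist x 0 < d" P s] by (simp add: dist_norm)
    then show ?thesis unfolding eventually_at by simp
  qed
  have shn: "(\<forall>\<^sub>F h in nhds 0. P (s + h)) \<longleftrightarrow> (\<forall>\<^sub>F x in nhds s. P x)" for P and s :: real
  proof -
    have "(\<forall>x. dist x 0 < d \<longrightarrow> P (s + x)) \<longleftrightarrow> (\<forall>x. dist x s < d \<longrightarrow> P x)" for d
      using trans[of "\<lambda>x. dist x 0 < d" P s] by (simp add: dist_norm)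
    then show ?thesis unfolding eventually_nhds_metric by simp
  qed
  have "\<forall>\<^sub>F x in nhds t. g x = 0"
  proof (rule connected_induction_simple[of I 0 t "\<lambda>s. \<forall>\<^sub>F x in nhds s. g x = 0"])
    show "connected I" using I by (simp add: is_interval_connected)
    show "\<forall>\<^sub>F x in nhds 0. g x = 0" using g0 by (auto simp: has_fps_expansion_def)
    fix s assume s: "s \<in> I"
    obtain F where F: "(\<lambda>h. g (s + h)) has_fps_expansion F" using g[OF s] by blast
    show "\<exists>T. openin (top_of_set I) T \<and> s \<in> T \<and> (\<forall>x\<in>T. \<forall>y\<in>T. (\<forall>\<^sub>F x in nhds x. g x = 0) \<longrightarrow> (\<forall>\<^sub>F x in nhds y. g x = 0))"
    proof (cases "F = 0")
      case True
      then have "\<forall>\<^sub>F x in nhds s. g x = 0"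
        using F shn[of "\<lambda>x. g x = 0" s] by (auto simp: has_fps_expansion_def elim: eventually_mono)
      then obtain U where "open U" "s \<in> U" "\<forall>x\<in>U. g x = 0" unfolding eventually_nhds by blast
      then show ?thesis
        using I s by (intro exI[of _ "U \<inter> I"]) (auto simp: eventually_nhds openin_open intro!: exI[of _ U])
    next
      case False
      then have "\<forall>\<^sub>F x in at s. g x \<noteq> 0"
        using fps_expansion_isolated_zero[OF F] sh[of "\<lambda>x. g x \<noteq> 0"] by simp
      then obtain U where U: "open U" "s \<in> U" "\<forall>x\<in>U. x \<noteq> s \<longrightarrow> g x \<noteq> 0" unfolding eventually_at_topological by blast
      have "\<not> (\<forall>\<^sub>F x in nhds x. g x = 0)" if "x \<in> U" for x
      proof
        assume "\<forall>\<^sub>F x in nhds x. g x = 0"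
        then have "\<forall>\<^sub>F y in at x. g y = 0" by (auto simp: eventually_at_filter elim: eventually_mono)
        moreover have "\<forall>\<^sub>F y in at x. y \<in> U" using U that by (simp add: eventually_at_in_open')
        moreover have "\<forall>\<^sub>F y in at x. y \<noteq> s"
        proof (cases "x = s")
          case False
          then have "\<forall>\<^sub>F y in nhds x. y \<in> - {s}" by (intro eventually_nhds_in_open) auto
          then show ?thesis by (auto simp: eventually_at_filter elim: eventually_mono)
        qed (auto simp: eventually_at_filter)
        ultimately have "\<forall>\<^sub>F y in at x. False"
          by eventually_elim (use U in auto)
        then show False by simp
      qed
      then show ?thesis using U I s by (intro exI[of _ "U \<inter> I"]) (auto simp: openin_open)
    qed
  qed (use I in auto)
  then show ?thesis by (rule eventually_nhds_x_imp_x)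
qed

section \<open>Functions analytic in time and position, and their Taylor series in time\<close>

lemma Basis_time_space: "(1, 0) \<in> (Basis :: (real \<times> (real ^ 'm::finite)) set)"
  "(0, axis a 1) \<in> (Basis :: (real \<times> (real ^ 'm::finite)) set)"
  by (auto simp: Basis_prod_def Basis_vec_def)

definition dt :: "(real \<times> (real ^ 'm::finite) \<Rightarrow> real) \<Rightarrow> real \<times> (real ^ 'm) \<Rightarrow> real" where
  "dt f z = frechet_derivative f (at z) (1, 0)"

definition dx :: "'m \<Rightarrow> (real \<times> (real ^ 'm::finite) \<Rightarrow> real) \<Rightarrow> real \<times> (real ^ 'm) \<Rightarrow> real" where
  "dx a f z = frechet_derivative f (at z) (0, axis a 1)"

lemma real_analytic_on_dt: "real_analytic_on f S \<Longrightarrow> real_analytic_on (dt f) S"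
  and real_analytic_on_dx: "real_analytic_on f S \<Longrightarrow> real_analytic_on (dx a f) S"
  unfolding dt_def[abs_def] dx_def[abs_def] by (intro real_analytic_on_derivative Basis_time_space; assumption)+

lemma has_derivative_slice:
  assumes "f differentiable (at (t, x))"
  shows "((\<lambda>x. f (t, x)) has_derivative (\<lambda>h. frechet_derivative f (at (t, x)) (0, h))) (at x)"
  by (rule has_derivative_compose[of "\<lambda>x. (t, x)"])
    (use assms in \<open>auto intro!: derivative_eq_intros simp: frechet_derivative_works[symmetric]\<close>)

lemma pd_slice: "f differentiable (at (t, x)) \<Longrightarrow> pd a (\<lambda>x. f (t, x)) x = dx a f (t, x)"
  unfolding dx_def by (rule has_derivative_pd[OF has_derivative_slice])

lemma has_real_derivative_slice:
  assumes "f differentiable (at (t, x))"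
  shows "((\<lambda>t. f (t, x)) has_real_derivative dt f (t, x)) (at t)"
proof -
  have "((\<lambda>s. f ((0, x) + s *\<^sub>R (1, 0))) has_real_derivative frechet_derivative f (at ((0, x) + t *\<^sub>R (1, 0))) (1, 0)) (at t)"
    by (rule has_real_derivative_along) (use assms in simp)
  then show ?thesis by (simp add: dt_def)
qed

context
  fixes I :: "real set"
  assumes I: "open I"
begin

abbreviation analytic :: "(real \<times> (real ^ 'm::finite) \<Rightarrow> real) \<Rightarrow> bool" where
  "analytic f \<equiv> real_analytic_on f (I \<times> UNIV)"

lemma analytic_differentiable: "analytic f \<Longrightarrow> t \<in> I \<Longrightarrow> f differentiable (at (t, x))"
  by (rule real_analytic_on_differentiable) auto

lemma smooth_fun_slice:
  assumes "analytic f" "t \<in> I"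
  shows "smooth_fun (\<lambda>x. f (t, x))"
proof (rule smooth_fun_coinduct[where P="\<lambda>g. \<exists>f. analytic f \<and> g = (\<lambda>x. f (t, x))"])
  show "\<exists>f'. analytic f' \<and> (\<lambda>x. f (t, x)) = (\<lambda>x. f' (t, x))" using assms by blast
next
  fix g :: "real ^ 'a \<Rightarrow> real" and x
  assume "\<exists>f. analytic f \<and> g = (\<lambda>x. f (t, x))"
  then show "g differentiable (at x)"
    using analytic_differentiable[OF _ assms(2)] has_derivative_slice unfolding differentiable_def by blast
next
  fix g :: "real ^ 'a \<Rightarrow> real" and a
  assume "\<exists>f. analytic f \<and> g = (\<lambda>x. f (t, x))"
  then obtain f where f: "analytic f" "g = (\<lambda>x. f (t, x))" by blast
  have "pd a g = (\<lambda>x. dx a f (t, x))"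
    unfolding f(2) by (rule ext) (rule pd_slice[OF analytic_differentiable[OF f(1) assms(2)]])
  then show "\<exists>f. analytic f \<and> pd a g = (\<lambda>x. f (t, x))"
    using real_analytic_on_dx[OF f(1)] by blast
qed

lemma dx_dt_commute:
  assumes f: "analytic f" and t: "t \<in> I"
  shows "dx a (dt f) (t, x) = dt (dx a f) (t, x)"
  unfolding dt_def[of "dx a f"] dx_def[of a "dt f"]
  unfolding dt_def[abs_def] dx_def[abs_def]
proof (rule mixed_derivatives_commute[of "I \<times> UNIV"])
  show "open (I \<times> UNIV)" using I by (simp add: open_Times)
  show "(t, x) \<in> I \<times> UNIV" using t by simp
  show "f differentiable at y" if "y \<in> I \<times> UNIV" for y
    by (rule real_analytic_on_differentiable[OF f that])
  show "(\<lambda>z. frechet_derivative f (at z) (1, 0)) differentiable at y" if "y \<in> I \<times> UNIV" for y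
    by (intro real_analytic_on_differentiable[OF _ that] real_analytic_on_derivative f Basis_time_space)
  show "(\<lambda>z. frechet_derivative f (at z) (0, axis a 1)) differentiable at y" if "y \<in> I \<times> UNIV" for y
    by (intro real_analytic_on_differentiable[OF _ that] real_analytic_on_derivative f Basis_time_space)
  show "isCont (\<lambda>y. frechet_derivative (\<lambda>z. frechet_derivative f (at z) (1, 0)) (at y) (0, axis a 1)) (t, x)"
    by (intro differentiable_imp_continuous_within real_analytic_on_differentiable[of _ "I \<times> UNIV"] real_analytic_on_derivative f Basis_time_space)
      (use t in auto)
  show "isCont (\<lambda>y. frechet_derivative (\<lambda>z. frechet_derivative f (at z) (0, axis a 1)) (at y) (1, 0)) (t, x)"
    by (intro differentiable_imp_continuous_within real_analytic_on_differentiable[of _ "I \<times> UNIV"] real_analytic_on_derivative f Basis_time_space)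
      (use t in auto)
qed

text \<open>At constant position only the multi-indices concentrated on the time direction
  contribute; \<open>\<iota>\<close> enumerates them.\<close>

lemma has_fps_expansion_slice:
  assumes f: "analytic f" and t: "t \<in> I"
  shows "\<exists>F. (\<lambda>s. f (t + s, x)) has_fps_expansion F"
proof -
  have "(t, x) \<in> I \<times> UNIV" using t by simp
  then obtain r c where r: "r > 0" and c: "\<forall>z\<in>ball (t, x) r. ((\<lambda>\<alpha>. c \<alpha> * monomial (z - (t, x)) \<alpha>) has_sum f z) multi_indices"
    using f unfolding real_analytic_on_monomial by meson
  let ?e = "(1, 0) :: real \<times> (real ^ 'a)"
  define \<iota> where "\<iota> k = (\<lambda>b\<in>Basis. if b = ?e then k else 0)" for k :: nat
  have inj: "inj \<iota>"
  proof (rule injI)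
    fix k l assume "\<iota> k = \<iota> l"
    then have "\<iota> k ?e = \<iota> l ?e" by (rule fun_cong)
    then show "k = l" by (simp add: \<iota>_def Basis_time_space)
  qed
  have "(\<lambda>k. c (\<iota> k) * s ^ k) sums f (t + s, x)" if "\<bar>s\<bar> < r" for s
  proof -
    have m: "monomial ((s, 0) :: real \<times> (real ^ 'a)) \<alpha> = s ^ \<alpha> ?e * (\<Prod>b\<in>Basis - {?e}. 0 ^ \<alpha> b)" for \<alpha>
    proof -
      have "(s, 0) \<bullet> b = 0" if "b \<in> Basis - {?e}" for b :: "real \<times> (real ^ 'a)"
        using that by (auto simp: Basis_prod_def inner_prod_def)
      then have "(\<Prod>b\<in>Basis - {?e}. ((s, 0 :: real ^ 'a) \<bullet> b) ^ \<alpha> b) = (\<Prod>b\<in>Basis - {?e}. 0 ^ \<alpha> b)"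
        by (intro prod.cong) auto
      then show ?thesis
        unfolding monomial_def by (subst prod.remove[of _ ?e]) (auto simp: inner_prod_def Basis_time_space)
    qed
    have "(t + s, x) \<in> ball (t, x) r" using that by (simp add: dist_Pair_Pair dist_norm)
    from bspec[OF c this] have "((\<lambda>\<alpha>. c \<alpha> * monomial (s, 0) \<alpha>) has_sum f (t + s, x)) multi_indices" by simp
    also have "?this \<longleftrightarrow> ((\<lambda>\<alpha>. c \<alpha> * monomial (s, 0) \<alpha>) has_sum f (t + s, x)) (range \<iota>)"
    proof (rule has_sum_cong_neutral)
      fix \<alpha> assume \<alpha>: "\<alpha> \<in> multi_indices - range \<iota>"
      have "\<exists>b\<in>Basis - {?e}. \<alpha> b \<noteq> 0"
      proof (rule ccontr)
        assume "\<not> ?thesis"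
        then have "\<alpha> = \<iota> (\<alpha> ?e)"
          using \<alpha> by (auto simp: \<iota>_def fun_eq_iff restrict_def PiE_def extensional_def)
        then show False using \<alpha> by blast
      qed
      then have "(\<Prod>b\<in>Basis - {?e}. (0::real) ^ \<alpha> b) = 0"
        by (intro prod_zero) (auto simp: power_0_left)
      then show "c \<alpha> * monomial (s, 0) \<alpha> = 0" unfolding m by simp
    qed (auto simp: \<iota>_def)
    also have "\<dots> \<longleftrightarrow> (((\<lambda>\<alpha>. c \<alpha> * monomial (s, 0) \<alpha>) \<circ> \<iota>) has_sum f (t + s, x)) UNIV"
      by (rule has_sum_reindex[OF inj])
    also have "(\<lambda>\<alpha>. c \<alpha> * monomial (s, 0) \<alpha>) \<circ> \<iota> = (\<lambda>k. c (\<iota> k) * s ^ k)"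
    proof
      fix k
      have "(\<Prod>b\<in>Basis - {?e}. (0::real) ^ \<iota> k b) = 1" by (intro prod.neutral) (auto simp: \<iota>_def)
      then show "((\<lambda>\<alpha>. c \<alpha> * monomial (s, 0) \<alpha>) \<circ> \<iota>) k = c (\<iota> k) * s ^ k"
        by (simp add: m) (simp add: \<iota>_def Basis_time_space)
    qed
    finally show ?thesis by (rule has_sum_imp_sums)
  qed
  then have "(\<lambda>s. f (t + s, x)) has_fps_expansion Abs_fps (\<lambda>k. c (\<iota> k))"
    using r by (intro has_fps_expansionI) (auto simp: eventually_nhds_metric dist_norm)
  then show ?thesis by blast
qed

text \<open>The coefficients are written as iterated time derivatives at time 0, instead of being
  taken from an expansion chosen at each point, so that their smoothness and periodicity in
  \<open>x\<close> can be proved.\<close>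

definition tser :: "(real \<times> (real ^ 'm::finite) \<Rightarrow> real) \<Rightarrow> real ^ 'm \<Rightarrow> real fps" where
  "tser f x = Abs_fps (\<lambda>k. (dt ^^ k) f (0, x) / fact k)"

lemma analytic_dt_iter: "analytic f \<Longrightarrow> analytic ((dt ^^ k) f)"
  by (induction k) (auto intro: real_analytic_on_dt)

lemma has_fps_expansion_tser:
  assumes f: "analytic f" and 0: "0 \<in> I"
  shows "(\<lambda>s. f (s, x)) has_fps_expansion tser f x"
proof -
  obtain F where F: "(\<lambda>s. f (s, x)) has_fps_expansion F"
    using has_fps_expansion_slice[OF f 0, of x] by auto
  have k: "(\<lambda>s. (dt ^^ k) f (s, x)) has_fps_expansion fps_nth_deriv k F" for k
  proof (induction k)
    case (Suc k)
    have "\<forall>\<^sub>F s in nhds 0. s \<in> I" using I 0 by (rule eventually_nhds_in_open)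
    then have "\<forall>\<^sub>F s in nhds 0. deriv (\<lambda>s. (dt ^^ k) f (s, x)) s = (dt ^^ Suc k) f (s, x)"
      by eventually_elim
        (simp add: DERIV_imp_deriv[OF has_real_derivative_slice[OF analytic_differentiable[OF analytic_dt_iter[OF f]]]])
    then show ?case
      unfolding fps_nth_deriv_commute by (rule fps_expansion_cong[OF has_fps_expansion_deriv[OF Suc]])
  qed (use F in simp)
  have "fps_nth F k = (dt ^^ k) f (0, x) / fact k" for k
  proof -
    have "\<forall>\<^sub>F s in nhds 0. eval_fps (fps_nth_deriv k F) s = (dt ^^ k) f (s, x)"
      using k[of k] by (simp add: has_fps_expansion_def)
    from eventually_nhds_x_imp_x[OF this] have "(dt ^^ k) f (0, x) = fact k * fps_nth F k"
      by (simp add: eval_fps_at_0 fps_deriv_maclauren_0)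
    then show ?thesis by simp
  qed
  then have "F = tser f x" by (simp add: tser_def fps_eq_iff)
  then show ?thesis using F by simp
qed

lemma smooth_fun_tser:
  assumes f: "analytic f" and 0: "0 \<in> I"
  shows "smooth_fun (\<lambda>x. fps_nth (tser f x) k)"
proof -
  have "smooth_fun (\<lambda>x. (1 / fact k) * (dt ^^ k) f (0, x))"
    by (intro smooth_fun_cmult smooth_fun_slice analytic_dt_iter f 0)
  then show ?thesis by (simp add: tser_def)
qed

text \<open>Lets \<open>dt\<close> be iterated on equations that are known only for times in
  \<open>I\<close>, such as the commutation of \<open>dx\<close> with \<open>dt\<close>.\<close>

lemma dt_cong:
  assumes "\<And>t x. t \<in> I \<Longrightarrow> f (t, x) = g (t, x)" "analytic f" "t \<in> I"
  shows "dt f (t, x) = dt g (t, x)"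
proof -
  have "(f has_derivative frechet_derivative f (at (t, x))) (at (t, x))"
    using analytic_differentiable[OF assms(2,3)] frechet_derivative_works by blast
  then have "(g has_derivative frechet_derivative f (at (t, x))) (at (t, x))"
    by (rule has_derivative_transform_within_open[of _ _ _ _ "I \<times> UNIV"])
      (use assms I in \<open>auto intro: open_Times\<close>)
  then show ?thesis unfolding dt_def by (metis frechet_derivative_at)
qed

lemma pd_tser:
  assumes f: "analytic f" and 0: "0 \<in> I"
  shows "pd a (\<lambda>x. fps_nth (tser f x) k) x = fps_nth (tser (dx a f) x) k"
proof -
  have c: "dx a ((dt ^^ k) f) (t, x) = (dt ^^ k) (dx a f) (t, x)" if "t \<in> I" for t x k
    using that
  proof (induction k arbitrary: t x)
    case (Suc k)
    have "dx a ((dt ^^ Suc k) f) (t, x) = dt (dx a ((dt ^^ k) f)) (t, x)"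
      using dx_dt_commute[OF analytic_dt_iter[OF f] Suc.prems] by simp
    also have "\<dots> = dt ((dt ^^ k) (dx a f)) (t, x)"
      by (rule dt_cong) (auto intro: Suc real_analytic_on_dx analytic_dt_iter f)
    finally show ?case by simp
  qed simp
  have "pd a (\<lambda>x. (1 / fact k) * (dt ^^ k) f (0, x)) x = (1 / fact k) * pd a (\<lambda>x. (dt ^^ k) f (0, x)) x"
    by (simp add: pd_cmult smooth_fun_slice[OF analytic_dt_iter[OF f] 0] del: times_divide_eq_left)
  also have "pd a (\<lambda>x. (dt ^^ k) f (0, x)) x = (dt ^^ k) (dx a f) (0, x)"
    unfolding c[OF 0, symmetric] by (rule pd_slice[OF analytic_differentiable[OF analytic_dt_iter[OF f] 0]])
  finally show ?thesis by (simp add: tser_def)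
qed

text \<open>Periodicity passes from the functions to their coefficients by uniqueness of the
  expansion in time.\<close>

lemma torus_fun_tser:
  assumes f: "analytic f" and 0: "0 \<in> I" and p: "\<And>t. t \<in> I \<Longrightarrow> lattice_periodic (\<lambda>x. f (t, x))"
  shows "torus_fun (\<lambda>x. fps_nth (tser f x) k)"
proof -
  have "tser f (x + l) = tser f x" if "\<forall>i. l $ i \<in> \<int>" for x l
  proof (rule fps_expansion_unique[OF has_fps_expansion_tser[OF f 0]])
    have "\<forall>\<^sub>F s in nhds 0. s \<in> I" using I 0 by (rule eventually_nhds_in_open)
    then have "\<forall>\<^sub>F s in nhds 0. f (s, x) = f (s, x + l)"
      by eventually_elim (use p that in \<open>auto simp: lattice_periodic_def\<close>)
    then show "(\<lambda>s. f (s, x + l)) has_fps_expansion tser f x"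
      by (rule fps_expansion_cong[OF has_fps_expansion_tser[OF f 0]])
  qed
  then show ?thesis by (simp add: torus_fun_def lattice_periodic_def smooth_fun_tser[OF f 0])
qed

end

section \<open>Symplectic representations of the Heisenberg relations\<close>

definition bform :: "'a::comm_ring_1 ^ 'm ^ 'm \<Rightarrow> 'a ^ 'm \<Rightarrow> 'a ^ 'm \<Rightarrow> 'a" where
  "bform W X Y = (\<Sum>a\<in>UNIV. X $ a * (W *v Y) $ a)"

lemma bform_add_left: "bform W (X + X') Y = bform W X Y + bform W X' Y"
  and bform_add_right: "bform W X (Y + Y') = bform W X Y + bform W X Y'"
  and bform_diff_left: "bform W (X - X') Y = bform W X Y - bform W X' Y"
  and bform_diff_right: "bform W X (Y - Y') = bform W X Y - bform W X Y'"
  and bform_minus_left: "bform W (- X) Y = - bform W X Y"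
  and bform_minus_right: "bform W X (- Y) = - bform W X Y"
  and bform_scale_left: "bform W (c *s X) Y = c * bform W X Y"
  and bform_scale_right: "bform W X (c *s Y) = c * bform W X Y"
  and bform_zero_left: "bform W 0 Y = 0"
  and bform_zero_right: "bform W X 0 = 0"
  by (simp_all add: bform_def matrix_vector_mult_def algebra_simps sum.distrib sum_distrib_left sum_subtractf sum_negf)

lemmas bform_simps = bform_add_left bform_add_right bform_diff_left bform_diff_right bform_minus_left
  bform_minus_right bform_scale_left bform_scale_right bform_zero_left bform_zero_right

lemma matrix_vector_minus: "A *v (- x) = - ((A::'a::comm_ring_1^'n^'m) *v x)"
  and minus_matrix_vector: "(- A) *v x = - ((A::'a::comm_ring_1^'n^'m) *v x)"
  by (simp_all add: matrix_vector_mult_def vec_eq_iff sum_negf)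

lemma matrix_vector_scale: "(A::'a::comm_ring_1^'n^'m) *v (c *s x) = c *s (A *v x)"
  by (simp add: matrix_vector_mult_def vec_eq_iff sum_distrib_left ac_simps)

lemmas mv_simps = matrix_vector_right_distrib matrix_vector_mult_diff_distrib matrix_vector_scale
  matrix_vector_minus minus_matrix_vector matrix_vector_mult_add_rdistrib matrix_vector_mult_diff_rdistrib
  matrix_vector_mul_assoc[symmetric]

lemma bform_axis: "bform W (axis a 1) (axis b 1) = W $ a $ b"
  by (simp add: bform_def axis_def matrix_vector_mult_def if_distrib if_distribR cong: if_cong)

lemma basis_sum: "X = (\<Sum>c\<in>UNIV. X $ c *s axis c (1::'a::comm_ring_1))"
  by (simp add: vec_eq_iff axis_def if_distrib cong: if_cong)

lemma bform_axis_left: "bform W (axis a 1) Y = (W *v Y) $ a"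
  by (simp add: bform_def axis_def if_distrib if_distribR cong: if_cong)

definition linear_map :: "('a::comm_ring_1 ^ 'm \<Rightarrow> 'a ^ 'n) \<Rightarrow> bool" where
  "linear_map f \<longleftrightarrow> (\<forall>x y. f (x + y) = f x + f y) \<and> (\<forall>c x. f (c *s x) = c *s f x)"

lemma linear_map_sum: "linear_map f \<Longrightarrow> f (\<Sum>i\<in>A. g i) = (\<Sum>i\<in>A. f (g i))"
proof (induction A rule: infinite_finite_induct)
  case empty
  then have "f (0 *s 0) = 0 *s f 0" unfolding linear_map_def by blast
  then show ?case by simp
next
  case (infinite A)
  then have "f (0 *s 0) = 0 *s f 0" unfolding linear_map_def by blast
  then show ?case using infinite by simp
qed (auto simp: linear_map_def)

lemma linear_map_basis: "linear_map f \<Longrightarrow> f X = (\<Sum>c\<in>UNIV. X $ c *s f (axis c 1))"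
proof -
  assume f: "linear_map f"
  have "f X = f (\<Sum>c\<in>UNIV. X $ c *s axis c 1)" by (rule arg_cong[OF basis_sum])
  also have "\<dots> = (\<Sum>c\<in>UNIV. X $ c *s f (axis c 1))"
    unfolding linear_map_sum[OF f] using f by (simp add: linear_map_def)
  finally show ?thesis .
qed

lemma linear_map_eqI:
  assumes "linear_map f" "linear_map g" "\<And>c. f (axis c 1) = g (axis c 1)"
  shows "f X = g X"
  by (simp only: linear_map_basis[OF assms(1), of X] linear_map_basis[OF assms(2), of X] assms(3))

lemma basis_contract_vec: "(\<Sum>k\<in>UNIV. v $ k *s (A *v axis k 1)) = (A::'a::comm_ring_1^'n^'m) *v v"
  using linear_map_basis[of "\<lambda>v. A *v v" v] by (simp add: linear_map_def mv_simps)

lemma bform_sum_right: "bform W X (\<Sum>i\<in>A. f i) = (\<Sum>i\<in>A. bform W X (f i))"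
  by (induction A rule: infinite_finite_induct) (auto simp: bform_simps)

lemma bform_sum_left: "bform W (\<Sum>i\<in>A. f i) X = (\<Sum>i\<in>A. bform W (f i) X)"
  by (induction A rule: infinite_finite_induct) (auto simp: bform_simps)

lemma basis_contract_right: "(\<Sum>k\<in>UNIV. bform W X (A *v axis k 1) * v $ k) = bform W X (A *v v)"
  by (simp add: basis_contract_vec[of v A, symmetric] bform_sum_right bform_simps mult.commute)

lemma basis_contract_left: "(\<Sum>k\<in>UNIV. bform W (A *v axis k 1) X * v $ k) = bform W (A *v v) X"
  by (simp add: basis_contract_vec[of v A, symmetric] bform_sum_left bform_simps mult.commute)

lemma trace_basis: "(\<Sum>k\<in>UNIV. ((A::'a::comm_ring_1^'n^'n) *v axis k 1) $ k) = trace A"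
  by (simp add: trace_def matrix_vector_mult_def axis_def if_distrib if_distribR cong: if_cong)

lemma bform_antisym:
  assumes "transpose W = - W"
  shows "bform W X Y = - bform W Y X"
proof -
  have anti: "W $ a $ b = - W $ b $ a" for a b
    using arg_cong[OF assms, of "\<lambda>M. M $ b $ a"] by (simp add: transpose_def)
  have "bform W X Y = (\<Sum>a\<in>UNIV. \<Sum>b\<in>UNIV. X $ a * (W $ a $ b * Y $ b))"
    by (simp add: bform_def matrix_vector_mult_def sum_distrib_left)
  also have "\<dots> = (\<Sum>a\<in>UNIV. \<Sum>b\<in>UNIV. - (Y $ b * (W $ b $ a * X $ a)))"
    by (intro sum.cong refl, subst anti) (simp add: ac_simps)
  also have "\<dots> = (\<Sum>b\<in>UNIV. \<Sum>a\<in>UNIV. - (Y $ b * (W $ b $ a * X $ a)))" by (rule sum.swap)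
  also have "\<dots> = - bform W Y X" by (simp add: bform_def matrix_vector_mult_def sum_distrib_left sum_negf)
  finally show ?thesis .
qed

text \<open>Interpreted over the reals, over formal power series and over Laurent series, hence the
  weak assumptions on \<open>'a\<close>.\<close>

locale symplectic_space =
  fixes W Wi :: "'a::{idom,ring_char_0} ^ 'm ^ 'm"
  assumes inverse: "W ** Wi = mat 1" "Wi ** W = mat 1"
    and antisym: "transpose W = - W"
begin

abbreviation w where "w \<equiv> bform W"

lemmas w_antisym = bform_antisym[OF antisym]

lemma w_self: "w X X = 0"
proof -
  have "2 * w X X = 0" using w_antisym[of X X] by (simp add: algebra_simps)
  then show ?thesis by simp
qed

lemma nondegenerate: assumes "\<And>X. w X Y = 0" shows "Y = 0"
proof -
  have "W *v Y = 0" using assms[of "axis _ 1"] by (simp add: bform_axis_left vec_eq_iff)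
  then have "Wi *v (W *v Y) = 0" by simp
  then show ?thesis by (simp add: matrix_vector_mul_assoc inverse)
qed

definition sp :: "'a ^ 'm ^ 'm \<Rightarrow> bool" where
  "sp A \<longleftrightarrow> (\<forall>X Y. w (A *v X) Y + w X (A *v Y) = 0)"

lemma sp_swap: "sp A \<Longrightarrow> w (A *v X) Y = w (A *v Y) X"
  unfolding sp_def using w_antisym[of X "A *v Y"] by (metis add_eq_0_iff minus_minus)

lemma sp_right: "sp A \<Longrightarrow> w X (A *v Y) = w Y (A *v X)"
  using sp_swap[of A X Y] w_antisym by metis

lemma sp_move: "sp A \<Longrightarrow> w (A *v X) Y = - w X (A *v Y)"
  unfolding sp_def by (simp add: add_eq_0_iff)

lemma mm_neg: "(- A) ** B = - (A ** B)" "A ** (- B) = - (A ** B)" for A B :: "'b::comm_ring_1^'n^'n"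
  by (simp_all add: matrix_matrix_mult_def vec_eq_iff sum_negf)

lemma sp_transpose: assumes "sp A" shows "transpose A = - (W ** A ** Wi)"
proof -
  have b: "bform W (A *v axis a 1) (axis b 1) = (transpose A ** W) $ a $ b" for a b
    by (simp add: bform_def matrix_vector_mult_def axis_def if_distrib if_distribR
      transpose_def matrix_matrix_mult_def cong: if_cong)
  have c: "bform W (axis a 1) (A *v axis b 1) = (W ** A) $ a $ b" for a b
    by (simp add: bform_axis_left matrix_vector_mul_assoc)
      (simp add: matrix_vector_mult_def axis_def if_distrib if_distribR cong: if_cong)
  have "transpose A ** W = - (W ** A)"
    using assms unfolding sp_def by (simp add: vec_eq_iff b[symmetric] c[symmetric] add_eq_0_iff2)
  then have "transpose A ** (W ** Wi) = - (W ** A) ** Wi" by (simp only: matrix_mul_assoc)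
  then show ?thesis by (simp add: inverse mm_neg)
qed

lemma trace_neg: "trace (- A) = - trace (A::'b::comm_ring_1^'n^'n)"
  by (simp add: trace_def sum_negf)

lemma trace_transpose: "trace (transpose A) = trace (A::'b::comm_ring_1^'n^'n)"
  by (simp add: trace_def transpose_def)

lemma trace_conj: "trace (W ** A ** Wi) = trace A"
  by (metis inverse(2) matrix_mul_assoc matrix_mul_lid trace_mul_sym)

lemma sp_trace: assumes "sp A" shows "trace A = 0"
proof -
  have "trace A = - trace A"
    using sp_transpose[OF assms] by (metis trace_conj trace_neg trace_transpose)
  then show ?thesis by simp
qed

text \<open>Transposition reverses the product and contributes one sign per factor; the reversed
  product agrees with \<open>B ** A ** C\<close> up to cyclic rotation.\<close>

lemma sp_trace3:
  assumes "sp A" "sp B" "sp C"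
  shows "trace (A ** B ** C) = - trace (B ** A ** C)"
proof -
  have "trace (A ** B ** C) = trace (transpose C ** (transpose B ** transpose A))"
    by (metis matrix_transpose_mul trace_transpose)
  also have "\<dots> = trace (- (W ** C ** (Wi ** W) ** B ** (Wi ** W) ** A ** Wi))"
    by (simp add: sp_transpose assms mm_neg matrix_mul_assoc)
  also have "\<dots> = - trace (W ** (C ** B ** A) ** Wi)"
    by (simp add: inverse trace_neg matrix_mul_assoc)
  also have "\<dots> = - trace (C ** (B ** A))" unfolding trace_conj by (simp only: matrix_mul_assoc)
  also have "\<dots> = - trace (B ** A ** C)" by (rule arg_cong[OF trace_mul_sym])
  finally show ?thesis .
qed

end

section \<open>Flatness of Ricci type connections with constant coefficients\<close>

locale ricci_type_algebra = symplectic_space +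
  fixes \<Gamma> :: "'b \<Rightarrow> 'a ^ 'b ^ 'b" and \<sigma> :: "'a ^ 'b ^ 'b" and n :: nat
  assumes n: "n \<ge> 2" "CARD('b) = 2 * n"
    and comm: "\<And>c d. \<Gamma> c *v axis d 1 = \<Gamma> d *v axis c 1"
    and sp_\<Gamma>: "\<And>c. sp (\<Gamma> c)"
    and sp_\<sigma>: "sp \<sigma>"
    and curv: "\<And>c d Z. 2 *s (\<Gamma> c *v (\<Gamma> d *v Z) - \<Gamma> d *v (\<Gamma> c *v Z)) =
      (2 * w (axis c 1) (axis d 1)) *s (\<sigma> *v Z) - w (axis d 1) Z *s (\<sigma> *v axis c 1)
      + w (axis c 1) Z *s (\<sigma> *v axis d 1) - w Z (\<sigma> *v axis d 1) *s axis c 1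
      + w Z (\<sigma> *v axis c 1) *s axis d 1"
begin

definition L :: "'a ^ 'b \<Rightarrow> 'a ^ 'b ^ 'b" where "L X = (\<chi> i j. \<Sum>c\<in>UNIV. X $ c * \<Gamma> c $ i $ j)"

definition P where "P X Y = L X *v Y"

lemma P_sum: "P X Y = (\<Sum>c\<in>UNIV. X $ c *s (\<Gamma> c *v Y))"
proof -
  have "(\<Sum>j\<in>UNIV. (\<Sum>c\<in>UNIV. X $ c * \<Gamma> c $ i $ j) * Y $ j) = (\<Sum>c\<in>UNIV. X $ c * (\<Sum>j\<in>UNIV. \<Gamma> c $ i $ j * Y $ j))" for i
    by (simp add: sum_distrib_left sum_distrib_right mult.assoc) (rule sum.swap)
  then show ?thesis by (simp add: P_def L_def vec_eq_iff matrix_vector_mult_def)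
qed

lemma P_axis: "P (axis c 1) Y = \<Gamma> c *v Y"
proof -
  have "axis c 1 $ d *s (\<Gamma> d *v Y) = (if d = c then \<Gamma> c *v Y else 0)" for d
    by (simp add: axis_def)
  then show ?thesis by (simp add: P_sum)
qed

lemma P_simps:
  "P (X + X') Y = P X Y + P X' Y" "P X (Y + Y') = P X Y + P X Y'"
  "P (c *s X) Y = c *s P X Y" "P X (c *s Y) = c *s P X Y" "P X 0 = 0"
  by (simp_all add: P_def mv_simps L_def matrix_vector_mult_def vec_eq_iff algebra_simps sum.distrib
      sum_distrib_left)

lemma P_comm: "P X Y = P Y X"
proof -
  have "P (axis c 1) Y = P Y (axis c 1)" for c
    by (rule linear_map_eqI[of "P (axis c 1)" "\<lambda>Y. P Y (axis c 1)"])
       (simp_all add: linear_map_def P_simps, simp_all add: P_axis comm)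
  then show ?thesis
    by (rule_tac linear_map_eqI[of "\<lambda>X. P X Y" "P Y"]) (simp_all add: linear_map_def P_simps)
qed

lemma w_P: "w (P X Y) Z + w Y (P X Z) = 0"
proof -
  have "w (\<Gamma> c *v Y) Z = - w Y (\<Gamma> c *v Z)" for c
    using sp_move[OF sp_\<Gamma>] .
  then show ?thesis by (simp add: P_sum bform_sum_left bform_sum_right bform_simps sum_negf)
qed

lemma sp_L: "sp (L X)"
  using w_P unfolding sp_def P_def by blast

abbreviation S where "S X Y Z \<equiv> w (P X Y) Z"

lemma S_sym: "S X Y Z = S Y X Z" "S X Y Z = S X Z Y"
  by (simp_all add: P_comm) (simp add: P_def sp_swap[OF sp_L])

text \<open>Ricci type curvature with \<open>\<sigma>\<close> proportional to the Ricci
  endomorphism. The commutator in \<open>curvature_eq\<close> is doubled because \<open>'a\<close>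
  need not contain one half.\<close>

definition R where "R X Y Z = (2 * w X Y) *s (\<sigma> *v Z) - w Y Z *s (\<sigma> *v X) + w X Z *s (\<sigma> *v Y)
  - w Z (\<sigma> *v Y) *s X + w Z (\<sigma> *v X) *s Y"

lemma R_simps:
  "R (X + X') Y Z = R X Y Z + R X' Y Z" "R X (Y + Y') Z = R X Y Z + R X Y' Z"
  "R (c *s X) Y Z = c *s R X Y Z" "R X (c *s Y) Z = c *s R X Y Z"
  by (simp_all add: R_def mv_simps bform_simps vec_eq_iff algebra_simps)

lemma curvature_eq: "2 *s (P X (P Y Z) - P Y (P X Z)) = R X Y Z"
proof -
  have 1: "2 *s (P (axis c 1) (P (axis d 1) Z) - P (axis d 1) (P (axis c 1) Z)) = R (axis c 1) (axis d 1) Z" for c d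
    using curv[of c d Z] by (simp add: P_axis R_def)
  have 2: "2 *s (P (axis c 1) (P Y Z) - P Y (P (axis c 1) Z)) = R (axis c 1) Y Z" for c
    by (rule linear_map_eqI[of "\<lambda>Y. 2 *s (P (axis c 1) (P Y Z) - P Y (P (axis c 1) Z))" "\<lambda>Y. R (axis c 1) Y Z", OF _ _ 1])
      (auto simp: linear_map_def P_simps R_simps vec_eq_iff algebra_simps)
  show ?thesis
    by (rule linear_map_eqI[of "\<lambda>X. 2 *s (P X (P Y Z) - P Y (P X Z))" "\<lambda>X. R X Y Z", OF _ _ 2])
      (auto simp: linear_map_def P_simps R_simps vec_eq_iff algebra_simps)
qed

text \<open>By commutativity \<open>P X (P Z Y)\<close> is \<open>P X (P Y Z)\<close>, and moving
  \<open>Y\<close> outside costs the curvature. Now \<open>Y\<close> appears in the last slot on the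
  left, so tracing over \<open>Y\<close> evaluates traces of products of the matrices
  \<open>L\<close>.\<close>

lemma P_P: "2 *s P X (P Z Y) = 2 *s P (P X Z) Y + R X Y Z"
  using curvature_eq[of X Y Z] by (simp add: P_comm[of Z Y] P_comm[of Y "P X Z"] algebra_simps)

definition ric where "ric X Z = (\<Sum>k\<in>UNIV. R X (axis k 1) Z $ k)"

lemma ric_eq: "ric X Z = of_nat (2 * n + 2) * w X (\<sigma> *v Z)"
proof -
  have 1: "(\<Sum>k\<in>UNIV. w X (axis k 1) * v $ k) = w X v" "(\<Sum>k\<in>UNIV. w (axis k 1) X * v $ k) = w v X" for X v
    using basis_contract_right[of W X "mat 1" v] basis_contract_left[of W "mat 1" X v] by simp_all
  have 2: "(\<Sum>k\<in>UNIV. axis k (1::'a) $ (k::'b)) = of_nat (2 * n)"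
    using n by (simp add: axis_def)
  have "ric X Z = 2 * (\<Sum>k\<in>UNIV. w X (axis k 1) * (\<sigma> *v Z) $ k) - (\<Sum>k\<in>UNIV. w (axis k 1) Z * (\<sigma> *v X) $ k)
     + w X Z * (\<Sum>k\<in>UNIV. (\<sigma> *v axis k 1) $ k) - (\<Sum>k\<in>UNIV. w Z (\<sigma> *v axis k 1) * X $ k)
     + w Z (\<sigma> *v X) * (\<Sum>k\<in>UNIV. axis k (1::'a) $ (k::'b))"
    by (simp only: ric_def R_def sum.distrib sum_subtractf sum_distrib_left mult.assoc
         vector_add_component vector_minus_component vector_smult_component)
  also have "\<dots> = 2 * w X (\<sigma> *v Z) - w (\<sigma> *v X) Z + w X Z * trace \<sigma> - w Z (\<sigma> *v X) + w Z (\<sigma> *v X) * of_nat (2 * n)"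
    unfolding 1 2 basis_contract_right trace_basis ..
  also have "\<dots> = of_nat (2 * n + 2) * w X (\<sigma> *v Z)"
    using sp_trace[OF sp_\<sigma>] sp_move[OF sp_\<sigma>, of X Z] sp_right[OF sp_\<sigma>, of X Z] by (simp add: algebra_simps)
  finally show ?thesis .
qed

text \<open>Trace of \<open>P_P\<close> over \<open>Y\<close>; the term with \<open>P X Z\<close> is
  the trace of a symplectic matrix and drops out.\<close>

lemma trace2: "2 * trace (L X ** L Z) = ric X Z"
proof -
  have "2 * trace (L X ** L Z) = (\<Sum>k\<in>UNIV. (2 *s P X (P Z (axis k 1))) $ k)"
    by (simp add: trace_basis[symmetric] P_def matrix_vector_mul_assoc sum_distrib_left)
  also have "\<dots> = 2 * (\<Sum>k\<in>UNIV. P (P X Z) (axis k 1) $ k) + ric X Z"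
    unfolding P_P[of X Z] by (simp add: sum.distrib sum_distrib_left ric_def)
  also have "(\<Sum>k\<in>UNIV. P (P X Z) (axis k 1) $ k) = 0"
    using sp_trace[OF sp_L, of "P X Z"] by (simp add: P_def trace_basis)
  finally show ?thesis by simp
qed

definition \<Lambda> where "\<Lambda> U = trace (\<sigma> ** L U)"

text \<open>The trace of \<open>P_P\<close> with \<open>Y\<close> replaced by \<open>P U Y\<close>.
  It prepares the comparison of the two orders of \<open>L X\<close> and \<open>L Z\<close> in a
  triple product.\<close>

lemma trace3: "2 * trace (L X ** L Z ** L U) =
   ric (P X Z) U + 2 * w X (P U (\<sigma> *v Z)) - w (P U (\<sigma> *v X)) Z + w X Z * \<Lambda> U - w Z (\<sigma> *v P U X)"
proof -
  have "2 * trace (L X ** L Z ** L U) = (\<Sum>k\<in>UNIV. (2 *s P X (P Z (P U (axis k 1)))) $ k)"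
    by (simp add: trace_basis[symmetric] P_def matrix_vector_mul_assoc sum_distrib_left matrix_mul_assoc)
  also have "\<dots> = 2 * trace (L (P X Z) ** L U) + (\<Sum>k\<in>UNIV. R X (P U (axis k 1)) Z $ k)"
    unfolding P_P[of X Z] by (simp add: sum.distrib sum_distrib_left trace_basis[symmetric] P_def matrix_vector_mul_assoc)
  also have "(\<Sum>k\<in>UNIV. R X (P U (axis k 1)) Z $ k) =
     2 * (\<Sum>k\<in>UNIV. w X (L U *v axis k 1) * (\<sigma> *v Z) $ k) - (\<Sum>k\<in>UNIV. w (L U *v axis k 1) Z * (\<sigma> *v X) $ k)
     + w X Z * (\<Sum>k\<in>UNIV. ((\<sigma> ** L U) *v axis k 1) $ k) - (\<Sum>k\<in>UNIV. w Z ((\<sigma> ** L U) *v axis k 1) * X $ k)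
     + w Z (\<sigma> *v X) * (\<Sum>k\<in>UNIV. (L U *v axis k 1) $ k)"
    by (simp add: R_def sum.distrib sum_subtractf sum_distrib_left mult.assoc P_def matrix_vector_mul_assoc)
  also have "\<dots> = 2 * w X (P U (\<sigma> *v Z)) - w (P U (\<sigma> *v X)) Z + w X Z * \<Lambda> U - w Z (\<sigma> *v P U X)"
    unfolding basis_contract_right basis_contract_left trace_basis sp_trace[OF sp_L] \<Lambda>_def[symmetric]
    by (simp add: P_def matrix_vector_mul_assoc)
  finally show ?thesis unfolding trace2 by simp
qed

text \<open>By \<open>sp_trace3\<close> a triple trace changes sign when its first two factors are
  exchanged, so the part of \<open>trace3\<close> symmetric in \<open>X\<close> and \<open>Z\<close>
  vanishes. This makes \<open>n + 1\<close> times one value of \<open>T\<close> the sum of the two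
  values obtained by cyclic rotation; the cyclic sum is then zero since \<open>n + 1\<close> exceeds
  2, and finally \<open>n + 2\<close> times \<open>T\<close> is zero.\<close>

lemma T_zero: "S (\<sigma> *v X) Y Z = 0"
proof -
  define T where "T X Y Z = S (\<sigma> *v X) Y Z" for X Y Z
  have sym: "T X Y Z = T X Z Y" for X Y Z unfolding T_def by (rule S_sym)
  have e: "2 * trace (L X ** L Z ** L U) = of_nat (2 * n + 2) * T U X Z - 3 * T Z X U - T X U Z + w X Z * \<Lambda> U" for X Z U
  proof -
    have 1: "w X (P U (\<sigma> *v Z)) = - T Z X U"
      unfolding T_def using w_antisym[of X "P U (\<sigma> *v Z)"] S_sym[of U "\<sigma> *v Z" X] S_sym(2)[of "\<sigma> *v Z" U X] by simp
    have 2: "w (P U (\<sigma> *v X)) Z = T X U Z"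
      unfolding T_def by (rule S_sym)
    have 3: "w Z (\<sigma> *v P U X) = T Z X U"
      unfolding T_def using sp_right[OF sp_\<sigma>, of Z "P U X"] S_sym[of U X "\<sigma> *v Z"] S_sym(2)[of X U "\<sigma> *v Z"]
         S_sym(1)[of X "\<sigma> *v Z" U] by simp
    have 4: "w (P X Z) (\<sigma> *v U) = T U X Z"
      unfolding T_def using S_sym[of X Z "\<sigma> *v U"] S_sym(1)[of X "\<sigma> *v U" Z] by simp
    show ?thesis unfolding trace3 ric_eq 1 2 3 4 by (simp add: algebra_simps)
  qed
  have rel: "of_nat (n + 1) * T U X Z = T Z X U + T X U Z" for X Z U
  proof -
    have "2 * trace (L X ** L Z ** L U) + 2 * trace (L Z ** L X ** L U) = 0"
      using sp_trace3[OF sp_L sp_L sp_L, of X Z U] by simp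
    then have "4 * (of_nat (n + 1) * T U X Z - (T Z X U + T X U Z)) = 0"
      unfolding e using w_antisym[of X Z] sym by (simp add: algebra_simps)
    then show ?thesis unfolding mult_eq_0_iff by auto
  qed
  define \<Sigma> where "\<Sigma> = T X Y Z + T Y Z X + T Z X Y"
  have "of_nat (n + 1) * \<Sigma> = 2 * \<Sigma>"
    unfolding \<Sigma>_def using rel[of X Y Z] rel[of Y Z X] rel[of Z X Y] sym by (simp add: algebra_simps)
  then have "(of_nat (n - 1) :: 'a) * \<Sigma> = 0"
    using n by (simp add: of_nat_diff algebra_simps)
  then have "\<Sigma> = 0" using n by (simp del: of_nat_diff)
  then have "of_nat (n + 2) * T X Y Z = 0"
    using rel[of X Y Z] sym unfolding \<Sigma>_def by (simp add: algebra_simps add_eq_0_iff)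
  then show ?thesis unfolding T_def mult_eq_0_iff of_nat_eq_0_iff by simp
qed

text \<open>Since multiplication by \<open>\<sigma> *v X\<close> is zero, so are the Ricci form of
  that vector and the curvature \<open>R X (\<sigma> *v X) X\<close>. Pairing the latter with
  \<open>X\<close> gives a multiple of the square of \<open>w X (\<sigma> *v X)\<close>, and the
  vanishing quadratic form is polarised.\<close>

lemma \<sigma>_zero: "\<sigma> = 0"
proof -
  have P0: "P (\<sigma> *v X) Y = 0" for X Y
  proof (rule nondegenerate)
    show "w Z (P (\<sigma> *v X) Y) = 0" for Z
      using T_zero[of X Y Z] w_antisym[of Z] by simp
  qed
  have \<sigma>\<sigma>: "w (\<sigma> *v X) (\<sigma> *v Y) = 0" for X Y
  proof -
    have "L (\<sigma> *v X) ** L Y = 0"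
    proof -
      have "(L (\<sigma> *v X) ** L Y) *v Z = 0" for Z
        using P0 by (simp add: matrix_vector_mul_assoc[symmetric] P_def[symmetric])
      then show ?thesis by (simp add: matrix_eq)
    qed
    then have "ric (\<sigma> *v X) Y = 0" unfolding trace2[symmetric] by (simp add: trace_def)
    then show ?thesis unfolding ric_eq mult_eq_0_iff of_nat_eq_0_iff by simp
  qed
  have q: "w X (\<sigma> *v X) = 0" for X
  proof -
    have "R X (\<sigma> *v X) X = 0"
      unfolding curvature_eq[symmetric] by (simp add: P0 P_simps)
    then have "w X (R X (\<sigma> *v X) X) = 0" by (simp add: bform_simps)
    then have "4 * (w X (\<sigma> *v X) * w X (\<sigma> *v X)) = 0"
      using \<sigma>\<sigma>[of X X] \<sigma>\<sigma>[of X "\<sigma> *v X"] sp_move[OF sp_\<sigma>, of X "\<sigma> *v X"] w_antisym[of "\<sigma> *v X" X] w_self[of X]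
      by (simp add: R_def bform_simps algebra_simps)
    then show ?thesis by simp
  qed
  have "w X (\<sigma> *v Y) = 0" for X Y
  proof -
    have "2 * w X (\<sigma> *v Y) = 0"
      using q[of "X + Y"] q[of X] q[of Y] sp_right[OF sp_\<sigma>, of X Y] by (simp add: bform_simps mv_simps)
    then show ?thesis by simp
  qed
  then have "\<sigma> *v Y = 0" for Y using nondegenerate by blast
  then show ?thesis by (simp add: matrix_eq)
qed

end

lemma sum_option2:
  "(\<Sum>i\<in>UNIV. f i) = f None + f (Some None) + (\<Sum>a\<in>UNIV. f (Some (Some (a::'m::finite))))"
proof -
  have "(\<Sum>i\<in>(UNIV::'m option option set). f i) = f None + (\<Sum>i\<in>UNIV. f (Some i))"
    unfolding UNIV_option_conv[where 'a="'m option"] by (simp add: sum.reindex)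
  also have "(\<Sum>i\<in>UNIV. f (Some i)) = f (Some None) + (\<Sum>a\<in>UNIV. f (Some (Some a)))"
    unfolding UNIV_option_conv[where 'a='m] by (simp add: sum.reindex)
  finally show ?thesis by (simp add: add.assoc)
qed

lemma all_option2: "(\<forall>i. P i) \<longleftrightarrow> P None \<and> P (Some None) \<and> (\<forall>a. P (Some (Some a)))"
  by (metis option.exhaust)

lemma matrix_vector_axis: "(A *v axis c 1) $ i = (A $ i $ c :: 'a::comm_ring_1)"
  by (simp add: matrix_vector_mult_def axis_def if_distrib cong: if_cong)

lemma axis_sum: "(\<Sum>k\<in>UNIV. axis b 1 $ k * g k) = (g b :: 'a::comm_ring_1)"
  by (simp add: axis_def if_distrib if_distribR cong: if_cong)

context symplectic_space
begin

lemma Wi_antisym: "transpose Wi = - Wi"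
proof -
  have "transpose (W ** Wi) = mat 1" by (simp add: inverse)
  then have "(- transpose Wi) ** W = mat 1" by (simp add: matrix_transpose_mul antisym mm_neg)
  then have "(- transpose Wi) ** (W ** Wi) = Wi" by (simp add: matrix_mul_assoc)
  then show ?thesis by (simp add: inverse) (metis minus_minus)
qed

lemma W_swap: "W $ a $ b = - W $ b $ a" and Wi_swap: "Wi $ a $ b = - Wi $ b $ a"
  using arg_cong[OF antisym, of "\<lambda>M. M $ b $ a"] arg_cong[OF Wi_antisym, of "\<lambda>M. M $ b $ a"]
  by (simp_all add: transpose_def)

lemma W_diag [simp]: "W $ a $ a = 0"
  using w_self[of "axis a 1"] by (simp add: bform_axis)

lemma W_Wi: "(\<Sum>k\<in>UNIV. W $ a $ k * Wi $ k $ b) = (if a = b then 1 else 0)"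
  and Wi_W: "(\<Sum>k\<in>UNIV. Wi $ a $ k * W $ k $ b) = (if a = b then 1 else 0)"
  using arg_cong[OF inverse(1), of "\<lambda>M. M $ a $ b"] arg_cong[OF inverse(2), of "\<lambda>M. M $ a $ b"]
  by (simp_all add: matrix_matrix_mult_def mat_def)

text \<open>Contracting the indices \<open>c\<close> and \<open>d\<close> with \<open>Wi\<close>
  multiplies \<open>y\<close> by the dimension minus 2. In terms of forms, the wedge product with
  omega is injective on 1-forms.\<close>

lemma wedge_omega_zero:
  assumes n: "CARD('m) > 2"
    and y: "\<And>c d e. W $ c $ d * y e + W $ d $ e * y c + W $ e $ c * y d = 0"
  shows "y e = 0"
proof -
  have 1: "(\<Sum>c\<in>UNIV. \<Sum>d\<in>UNIV. Wi $ d $ c * (W $ c $ d * y e)) = of_nat CARD('m) * y e"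
  proof -
    have "(\<Sum>c\<in>UNIV. \<Sum>d\<in>UNIV. Wi $ d $ c * (W $ c $ d * y e))
      = (\<Sum>c\<in>UNIV. (\<Sum>d\<in>UNIV. W $ c $ d * Wi $ d $ c) * y e)"
      by (simp add: sum_distrib_right sum_distrib_left ac_simps)
    then show ?thesis by (simp add: W_Wi)
  qed
  have 2: "(\<Sum>c\<in>UNIV. \<Sum>d\<in>UNIV. Wi $ d $ c * (W $ d $ e * y c)) = - y e"
  proof -
    have "Wi $ d $ c * (W $ d $ e * y c) = - (W $ e $ d * Wi $ d $ c * y c)" for c d
      by (subst W_swap) (simp add: ac_simps)
    then have "(\<Sum>c\<in>UNIV. \<Sum>d\<in>UNIV. Wi $ d $ c * (W $ d $ e * y c))
      = - (\<Sum>c\<in>UNIV. (\<Sum>d\<in>UNIV. W $ e $ d * Wi $ d $ c) * y c)"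
      by (simp add: sum_distrib_right sum_negf)
    then show ?thesis by (simp add: W_Wi if_distrib if_distribR cong: if_cong)
  qed
  have 3: "(\<Sum>c\<in>UNIV. \<Sum>d\<in>UNIV. Wi $ d $ c * (W $ e $ c * y d)) = - y e"
  proof -
    have "Wi $ d $ c * (W $ e $ c * y d) = - (W $ e $ c * Wi $ c $ d * y d)" for c d
      by (subst Wi_swap) (simp add: ac_simps)
    then have "(\<Sum>c\<in>UNIV. \<Sum>d\<in>UNIV. Wi $ d $ c * (W $ e $ c * y d))
      = - (\<Sum>c\<in>UNIV. \<Sum>d\<in>UNIV. W $ e $ c * Wi $ c $ d * y d)"
      by (simp add: sum_negf)
    also have "\<dots> = - (\<Sum>d\<in>UNIV. \<Sum>c\<in>UNIV. W $ e $ c * Wi $ c $ d * y d)"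
      by (subst sum.swap) simp
    also have "\<dots> = - (\<Sum>d\<in>UNIV. (\<Sum>c\<in>UNIV. W $ e $ c * Wi $ c $ d) * y d)"
      by (simp add: sum_distrib_right)
    finally show ?thesis by (simp add: W_Wi if_distrib if_distribR cong: if_cong)
  qed
  have "0 = (\<Sum>c\<in>UNIV. \<Sum>d\<in>UNIV. Wi $ d $ c * (W $ c $ d * y e + W $ d $ e * y c + W $ e $ c * y d))"
    by (simp add: y)
  also have "\<dots> = of_nat CARD('m) * y e - y e - y e"
    unfolding distrib_left sum.distrib 1 2 3 by simp
  also have "\<dots> = of_nat (CARD('m) - 2) * y e"
    using n by (simp add: of_nat_diff algebra_simps)
  finally have "of_nat (CARD('m) - 2) * y e = 0" ..
  moreover have "of_nat (CARD('m) - 2) \<noteq> (0::'a)" using n unfolding of_nat_eq_0_iff by simp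
  ultimately show ?thesis by (metis mult_eq_0_iff)
qed

end

section \<open>The central element of a symplectic Heisenberg representation\<close>

locale heisenberg_rep = symplectic_space W Wi
  for W Wi :: "'a::field_char_0 ^ 'm ^ 'm" +
  fixes \<Omega> Z :: "'a ^ 'm option option ^ 'm option option" and a :: "'m \<Rightarrow> 'a ^ 'm option option ^ 'm option option"
    and f :: "'a ^ 'm option option" and n :: nat
  assumes n: "n \<ge> 2" "CARD('m) = 2 * n"
    and \<Omega>_antisym: "transpose \<Omega> = - \<Omega>"
    and sp_a: "\<And>c x y. bform \<Omega> (a c *v x) y + bform \<Omega> x (a c *v y) = 0"
    and heis: "\<And>c d x. a c *v (a d *v x) - a d *v (a c *v x) = W $ c $ d *s (Z *v x)"
    and cyclic: "bform \<Omega> f (Z *v f) \<noteq> 0"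
begin

abbreviation br where "br \<equiv> bform \<Omega>"

lemmas br_antisym = bform_antisym[OF \<Omega>_antisym]

lemma br_self: "br x x = 0"
  using br_antisym[of x x] by (simp add: eq_neg_iff_add_eq_0)

lemma W_nonzero: obtains c d where "W $ c $ d \<noteq> 0"
proof -
  have "\<exists>c d. W $ c $ d \<noteq> 0"
  proof (rule ccontr)
    assume "\<nexists>c d. W $ c $ d \<noteq> 0"
    then have "W = 0" by (simp add: vec_eq_iff)
    then have "mat 1 = (0 :: 'a ^ 'm ^ 'm)" using inverse(1) by simp
    then have "mat 1 $ i $ i = (0 :: 'a ^ 'm ^ 'm) $ i $ i" for i by simp
    then show False by (simp add: mat_def)
  qed
  then show ?thesis using that by blast
qed

lemma a_move: "br (a c *v x) y = - br x (a c *v y)"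
  using sp_a[of c x y] by (simp add: add_eq_0_iff)

lemma Z_move: "br (Z *v x) y = - br x (Z *v y)"
proof -
  obtain c d where cd: "W $ c $ d \<noteq> 0" by (rule W_nonzero)
  have "W $ c $ d * br (Z *v x) y = br (a c *v (a d *v x)) y - br (a d *v (a c *v x)) y"
    "W $ c $ d * br x (Z *v y) = br x (a c *v (a d *v y)) - br x (a d *v (a c *v y))"
    by (simp only: bform_scale_left[symmetric] heis[symmetric] bform_diff_left)
      (simp only: bform_scale_right[symmetric] heis[symmetric] bform_diff_right)
  then have "W $ c $ d * (br (Z *v x) y + br x (Z *v y)) = 0"
    by (simp add: distrib_left a_move)
  then show ?thesis using cd by (simp add: add_eq_0_iff)
qed

text \<open>By the Jacobi identity the 1-form with components the commutators of \<open>a e\<close>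
  with \<open>Z\<close> has zero wedge product with omega.\<close>

lemma central: "a e *v (Z *v x) = Z *v (a e *v x)"
proof -
  have "(a e *v (Z *v x) - Z *v (a e *v x)) $ i = 0" for i
  proof (rule wedge_omega_zero[where y="\<lambda>e. (a e *v (Z *v x) - Z *v (a e *v x)) $ i"])
    show "CARD('m) > 2" using n by simp
    fix c d e
    have s: "W $ c $ d *s (a e *v (Z *v x) - Z *v (a e *v x))
      = a e *v (a c *v (a d *v x) - a d *v (a c *v x)) - (a c *v (a d *v (a e *v x)) - a d *v (a c *v (a e *v x)))" for c d e
      by (simp only: heis matrix_vector_scale vector_ssub_ldistrib)
    have "W $ c $ d *s (a e *v (Z *v x) - Z *v (a e *v x)) + W $ d $ e *s (a c *v (Z *v x) - Z *v (a c *v x))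
      + W $ e $ c *s (a d *v (Z *v x) - Z *v (a d *v x)) = 0"
      unfolding s by (simp only: mv_simps) (simp add: vec_eq_iff)
    from arg_cong[OF this, of "\<lambda>v. v $ i"] show "W $ c $ d * (a e *v (Z *v x) - Z *v (a e *v x)) $ i + W $ d $ e * (a c *v (Z *v x) - Z *v (a c *v x)) $ i
      + W $ e $ c * (a d *v (Z *v x) - Z *v (a d *v x)) $ i = 0"
      by (simp only: vector_add_component vector_smult_component zero_index)
  qed
  then show ?thesis by (simp add: vec_eq_iff)
qed

definition \<kappa> where "\<kappa> = br f (Z *v f)"
definition e where "e = Z *v f"
text \<open>Subtracting multiples of the central \<open>Z\<close> preserves the Heisenberg relations
  and arranges that \<open>h c f\<close> is orthogonal to \<open>f\<close>.\<close>

definition h where "h c x = a c *v x - (br f (a c *v f) / \<kappa>) *s (Z *v x)"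

lemma \<kappa>: "\<kappa> \<noteq> 0" and br_f_e: "br f e = \<kappa>" and br_e_f: "br e f = - \<kappa>"
  using cyclic br_antisym[of e f] by (simp_all add: \<kappa>_def e_def)

lemma h_linear: "h c (x + y) = h c x + h c y" "h c (k *s x) = k *s h c x" "h c 0 = 0" "h c (x - y) = h c x - h c y"
  by (simp_all add: h_def mv_simps vec_eq_iff algebra_simps)

lemma h_move: "br (h c x) y = - br x (h c y)"
  by (simp add: h_def bform_simps a_move Z_move)

lemma h_heis: "h c (h d x) - h d (h c x) = W $ c $ d *s (Z *v x)"
  unfolding heis[symmetric] by (simp add: h_def mv_simps central vec_eq_iff algebra_simps)

lemma h_central: "h c (Z *v x) = Z *v h c x"
  by (simp add: h_def mv_simps central)

lemma f_h_f: "br f (h c f) = 0"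
  using \<kappa> br_f_e by (simp add: h_def bform_simps e_def)

text \<open>\<open>Z\<close> and \<open>h c\<close> are skew for \<open>br\<close> and commute, so
  \<open>br x (Z *v h c y)\<close> is again antisymmetric in \<open>x\<close> and \<open>y\<close>
  and vanishes for \<open>x = y = f\<close>.\<close>

lemma e_h_f: "br e (h c f) = 0"
proof -
  have "br e (h c f) = - br f (h c e)" by (simp add: e_def Z_move h_central)
  also have "\<dots> = br (h c f) e" by (simp add: h_move)
  finally have "br e (h c f) = - br e (h c f)" using br_antisym[of e "h c f"] by simp
  then show ?thesis by (simp add: eq_neg_iff_add_eq_0)
qed

lemma hf_hf: "br (h c f) (h d f) = - (\<kappa> / 2) * W $ c $ d"
proof -
  have "2 * br (h c f) (h d f) = br (h c f) (h d f) - br (h d f) (h c f)"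
    using br_antisym[of "h d f" "h c f"] by simp
  also have "\<dots> = - br f (h c (h d f) - h d (h c f))" by (simp add: h_move bform_simps)
  also have "\<dots> = - \<kappa> * W $ c $ d" unfolding h_heis by (simp add: bform_simps \<kappa>_def)
  finally show ?thesis by (simp add: field_simps)
qed

definition Hf :: "'a ^ 'm \<Rightarrow> 'a ^ 'm option option" where "Hf X = (\<Sum>c\<in>UNIV. X $ c *s h c f)"

definition vp :: "'a ^ 'm option option \<Rightarrow> 'a ^ 'm" where
  "vp y = (- 2 / \<kappa>) *s (Wi *v (\<chi> d. br (h d f) y))"

lemma Hf_linear: "Hf (X + Y) = Hf X + Hf Y" "Hf (k *s X) = k *s Hf X" "Hf 0 = 0" "Hf (X - Y) = Hf X - Hf Y"
  by (simp_all add: Hf_def sum.distrib sum_subtractf vec_eq_iff sum_distrib_left algebra_simps)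

lemma Hf_axis: "Hf (axis c 1) = h c f"
proof -
  have "axis c 1 $ d *s h d f = (if d = c then h c f else 0)" for d by (simp add: axis_def)
  then show ?thesis by (simp add: Hf_def)
qed

lemma br_Hf_Hf: "br (Hf X) (Hf Y) = - (\<kappa> / 2) * w X Y"
proof -
  have "br (Hf X) (Hf Y) = (\<Sum>d\<in>UNIV. \<Sum>c\<in>UNIV. Y $ d * (X $ c * (- (\<kappa> / 2) * W $ c $ d)))"
    by (simp only: Hf_def bform_sum_left bform_sum_right bform_simps hf_hf sum_distrib_left)
  also have "\<dots> = (\<Sum>c\<in>UNIV. \<Sum>d\<in>UNIV. Y $ d * (X $ c * (- (\<kappa> / 2) * W $ c $ d)))"
    by (rule sum.swap)
  finally have "br (Hf X) (Hf Y) = \<dots>" .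
  then show ?thesis
    by (simp only: bform_def[of W] matrix_vector_mult_def vec_lambda_beta sum_distrib_left) (simp add: ac_simps)
qed

lemma br_f_Hf: "br f (Hf X) = 0" "br (Hf X) f = 0" and br_e_Hf: "br e (Hf X) = 0" "br (Hf X) e = 0"
proof -
  show 1: "br f (Hf X) = 0" "br e (Hf X) = 0"
    by (simp_all add: Hf_def bform_sum_right bform_simps f_h_f e_h_f)
  show "br (Hf X) f = 0" "br (Hf X) e = 0"
    using 1 br_antisym[of "Hf X"] by simp_all
qed

lemma vp_linear: "vp (x + y) = vp x + vp y" "vp (k *s x) = k *s vp x" "vp (x - y) = vp x - vp y"
  by (simp_all add: vp_def bform_simps matrix_vector_mult_def vec_eq_iff algebra_simps sum.distrib sum_subtractf sum_distrib_left)

lemma vp_f: "vp f = 0" and vp_e: "vp e = 0"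
  using f_h_f e_h_f br_antisym[of "h _ f"] by (simp_all add: vp_def matrix_vector_mult_def vec_eq_iff)

lemma vp_Hf: "vp (Hf X) = X"
proof -
  have "(\<chi> d. br (h d f) (Hf X)) = (- \<kappa> / 2) *s (W *v X)"
    by (simp add: Hf_axis[symmetric] br_Hf_Hf bform_axis_left vec_eq_iff)
  then have "vp (Hf X) = (- 2 / \<kappa> * (- \<kappa> / 2)) *s (Wi *v (W *v X))"
    by (simp only: vp_def matrix_vector_scale vector_smult_assoc)
  then show ?thesis using \<kappa> by (simp add: matrix_vector_mul_assoc inverse)
qed

text \<open>The pairings computed above make the Gram matrix \<open>M\<close> of \<open>e\<close>,
  \<open>f\<close> and the vectors \<open>h c f\<close> invertible with inverse \<open>J\<close>.
  Their number is the dimension of the space, so they form a basis, and pairing with them gives the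
  coefficients.\<close>

lemma decomposition: "y = (br y e / \<kappa>) *s f + Hf (vp y) + (br f y / \<kappa>) *s e"
proof -
  define col where "col i = (case i of None \<Rightarrow> e | Some None \<Rightarrow> f | Some (Some c) \<Rightarrow> h c f)" for i :: "'m option option"
  define B where "B = (\<chi> i j. col j $ i)"
  define J :: "'a ^ 'm option option ^ 'm option option" where "J = (\<chi> i j. case i of
      None \<Rightarrow> if j = Some None then 1 / \<kappa> else 0
    | Some None \<Rightarrow> if j = None then - 1 / \<kappa> else 0
    | Some (Some c) \<Rightarrow> (case j of Some (Some d) \<Rightarrow> - 2 / \<kappa> * Wi $ c $ d | _ \<Rightarrow> 0))"
  define M where "M = (\<chi> i j. br (col i) (col j))"
  have M: "transpose B ** \<Omega> ** B = M"
    unfolding matrix_mul_assoc[symmetric]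
    by (simp add: vec_eq_iff M_def B_def matrix_matrix_mult_def transpose_def bform_def matrix_vector_mult_def)
  have hf: "br (h c f) f = 0" "br (h c f) e = 0" for c
    using f_h_f e_h_f br_antisym[of "h c f"] by simp_all
  have Mv: "M $ None $ None = 0" "M $ None $ Some None = - \<kappa>" "M $ None $ Some (Some c) = 0"
    "M $ Some None $ None = \<kappa>" "M $ Some None $ Some None = 0" "M $ Some None $ Some (Some c) = 0"
    "M $ Some (Some c) $ None = 0" "M $ Some (Some c) $ Some None = 0"
    "M $ Some (Some c) $ Some (Some d) = - (\<kappa> / 2) * W $ c $ d" for c d
    by (simp_all add: M_def col_def br_self br_f_e br_e_f f_h_f e_h_f hf_hf hf)
  have WWi: "(\<Sum>k\<in>UNIV. - (\<kappa> / 2) * W $ c $ k * (- 2 / \<kappa> * Wi $ k $ d)) = (if c = d then 1 else 0)" for c d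
  proof -
    have "- (\<kappa> / 2) * W $ c $ k * (- 2 / \<kappa> * Wi $ k $ d) = W $ c $ k * Wi $ k $ d" for k
      using \<kappa> by (simp add: field_simps)
    then show ?thesis by (simp only: W_Wi)
  qed
  have MJ: "M ** J = mat 1"
    unfolding vec_eq_iff all_option2 matrix_matrix_mult_def mat_def vec_lambda_beta sum_option2 Mv J_def option.case WWi
    using \<kappa> by simp
  have "(transpose B ** \<Omega>) ** (B ** J) = mat 1"
    using M MJ by (simp add: matrix_mul_assoc)
  then have "(B ** J) ** (transpose B ** \<Omega>) = mat 1"
    by (simp add: matrix_left_right_inverse)
  then have "y = B *v (J *v ((transpose B ** \<Omega>) *v y))"
    by (simp only: matrix_vector_mul_assoc matrix_mul_assoc matrix_vector_mul_lid)
  also have "(transpose B ** \<Omega>) *v y = (\<chi> i. br (col i) y)"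
    unfolding matrix_vector_mul_assoc[symmetric]
    by (simp only: vec_eq_iff matrix_vector_mult_def transpose_def bform_def B_def vec_lambda_beta) simp
  also have "B *v (J *v (\<chi> i. br (col i) y)) = (\<Sum>i\<in>UNIV. (J *v (\<chi> i. br (col i) y)) $ i *s col i)"
    by (simp add: matrix_vector_mult_def B_def vec_eq_iff mult.commute)
  also have "\<dots> = (br y e / \<kappa>) *s f + Hf (vp y) + (br f y / \<kappa>) *s e"
    using br_antisym[of e y]
    by (simp add: sum_option2 col_def Hf_def vp_def matrix_vector_mult_def J_def sum_distrib_left mult.assoc add_ac sum_negf)
  finally show ?thesis .
qed

text \<open>In the frame \<open>f\<close>, \<open>Hf\<close>, \<open>e\<close> the operators
  \<open>h c\<close> have the block shape of a tractor connection. These are its blocks into the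
  tangent part: constant Christoffel symbols and a multiple of the Ricci endomorphism.\<close>

definition \<Gamma> where "\<Gamma> c = (\<chi> i j. vp (h c (h j f)) $ i)"
definition \<sigma> where "\<sigma> = (\<chi> i j. vp (h j e) $ i)"
definition lam where "lam c = br (h c e) e / \<kappa>"

lemma vp_h_Hf: "vp (h c (Hf Y)) = \<Gamma> c *v Y"
proof (rule linear_map_eqI[of "\<lambda>Y. vp (h c (Hf Y))" "\<lambda>Y. \<Gamma> c *v Y"])
  show "linear_map (\<lambda>Y. vp (h c (Hf Y)))" by (simp add: linear_map_def vp_linear h_linear Hf_linear)
  show "linear_map (\<lambda>Y. \<Gamma> c *v Y)" by (simp add: linear_map_def mv_simps)
  show "vp (h c (Hf (axis d 1))) = \<Gamma> c *v axis d 1" for d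
    by (simp add: Hf_axis vec_eq_iff matrix_vector_axis \<Gamma>_def)
qed

lemma vp_h_e: "vp (h c e) = \<sigma> *v axis c 1"
  by (simp add: vec_eq_iff matrix_vector_axis \<sigma>_def)

lemma h_e: "h c e = lam c *s f + Hf (\<sigma> *v axis c 1)"
proof -
  have "br f (h c e) = 0"
    using h_move[of c f e] e_h_f[of c] br_antisym[of e "h c f"] by simp
  then show ?thesis using decomposition[of "h c e"] by (simp add: vp_h_e lam_def)
qed

text \<open>The coefficients of \<open>f\<close> and \<open>e\<close> are forced by skewness of
  \<open>h c\<close> together with the known values of \<open>h c e\<close> and
  \<open>h c f\<close>.\<close>

lemma h_Hf: "h c (Hf Y) = (w Y (\<sigma> *v axis c 1) / 2) *s f + Hf (\<Gamma> c *v Y) + (w (axis c 1) Y / 2) *s e"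
proof -
  have "br (h c (Hf Y)) e / \<kappa> = w Y (\<sigma> *v axis c 1) / 2"
    using \<kappa> by (simp add: h_move h_e bform_simps br_f_Hf br_Hf_Hf)
  moreover have "br f (h c (Hf Y)) = \<kappa> / 2 * w (axis c 1) Y"
    using h_move[of c f "Hf Y"] by (simp add: Hf_axis[symmetric] br_Hf_Hf)
  then have "br f (h c (Hf Y)) / \<kappa> = w (axis c 1) Y / 2"
    using \<kappa> by simp
  ultimately show ?thesis by (subst decomposition[of "h c (Hf Y)"]) (simp only: vp_h_Hf)
qed

lemma Z_Hf: "Z *v Hf X = (\<Sum>c\<in>UNIV. X $ c * lam c) *s f + Hf (\<sigma> *v X)"
proof (rule linear_map_eqI[of "\<lambda>X. Z *v Hf X" "\<lambda>X. (\<Sum>c\<in>UNIV. X $ c * lam c) *s f + Hf (\<sigma> *v X)"])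
  show "linear_map (\<lambda>X. Z *v Hf X)" by (simp add: linear_map_def Hf_linear mv_simps)
  show "linear_map (\<lambda>X. (\<Sum>c\<in>UNIV. X $ c * lam c) *s f + Hf (\<sigma> *v X))"
    by (simp add: linear_map_def Hf_linear mv_simps vec_eq_iff algebra_simps sum.distrib sum_distrib_left)
  show "Z *v Hf (axis c 1) = (\<Sum>d\<in>UNIV. axis c 1 $ d * lam d) *s f + Hf (\<sigma> *v axis c 1)" for c
    using h_e[of c] by (simp add: Hf_axis h_central[symmetric] e_def[symmetric] axis_sum)
qed

lemma h_h_Hf: "h c (h d (Hf Y)) = (w Y (\<sigma> *v axis d 1) / 2) *s Hf (axis c 1)
   + ((w (\<Gamma> d *v Y) (\<sigma> *v axis c 1) / 2) *s f + Hf (\<Gamma> c *v (\<Gamma> d *v Y)) + (w (axis c 1) (\<Gamma> d *v Y) / 2) *s e)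
   + (w (axis d 1) Y / 2) *s (lam c *s f + Hf (\<sigma> *v axis c 1))"
  by (simp only: h_Hf[of d] h_linear h_Hf[of c] h_e Hf_axis)

text \<open>Tangent component of the Heisenberg relation on \<open>Hf Y\<close>, doubled to clear
  the halves of \<open>h_Hf\<close>. It is the Ricci type condition for constant
  \<open>\<Gamma>\<close>.\<close>

lemma curvature_\<Gamma>: "2 *s (\<Gamma> c *v (\<Gamma> d *v Y) - \<Gamma> d *v (\<Gamma> c *v Y)) =
      (2 * w (axis c 1) (axis d 1)) *s (\<sigma> *v Y) - w (axis d 1) Y *s (\<sigma> *v axis c 1)
      + w (axis c 1) Y *s (\<sigma> *v axis d 1) - w Y (\<sigma> *v axis d 1) *s axis c 1
      + w Y (\<sigma> *v axis c 1) *s axis d 1"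
proof -
  have vh: "2 *s (\<Gamma> c *v (\<Gamma> d *v Y)) = 2 *s vp (h c (h d (Hf Y))) - w Y (\<sigma> *v axis d 1) *s axis c 1
     - w (axis d 1) Y *s (\<sigma> *v axis c 1)" for c d
    unfolding h_h_Hf by (simp add: vp_linear vp_f vp_e vp_Hf vec_eq_iff field_simps)
  have "vp (h c (h d (Hf Y))) - vp (h d (h c (Hf Y))) = W $ c $ d *s (\<sigma> *v Y)"
    unfolding vp_linear(3)[symmetric] h_heis Z_Hf by (simp add: vp_linear vp_f vp_Hf)
  then have "vp (h c (h d (Hf Y))) = vp (h d (h c (Hf Y))) + W $ c $ d *s (\<sigma> *v Y)"
    by (simp add: algebra_simps)
  then show ?thesis
    unfolding vector_ssub_ldistrib vh bform_axis by (simp add: vec_eq_iff algebra_simps)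
qed

interpretation alg: ricci_type_algebra W Wi \<Gamma> \<sigma> n
proof
  show "2 \<le> n" "CARD('m) = 2 * n" by (rule n)+
  show "\<Gamma> c *v axis d 1 = \<Gamma> d *v axis c 1" for c d
  proof -
    have "h c (h d f) = h d (h c f) + W $ c $ d *s e"
      using h_heis[of c d f] by (simp add: e_def algebra_simps)
    then show ?thesis
      by (simp add: vp_h_Hf[symmetric] Hf_axis vp_linear vp_e)
  qed
  show "sp (\<Gamma> c)" for c
    unfolding sp_def
  proof (intro allI)
    fix X Y
    have "- (\<kappa> / 2) * (w (\<Gamma> c *v X) Y + w X (\<Gamma> c *v Y))
      = br (h c (Hf X)) (Hf Y) + br (Hf X) (h c (Hf Y))"
      unfolding h_Hf by (simp add: bform_simps br_f_Hf br_e_Hf br_Hf_Hf) (simp add: field_simps)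
    then have "- (\<kappa> / 2) * (w (\<Gamma> c *v X) Y + w X (\<Gamma> c *v Y)) = 0"
      by (simp only: h_move add.commute[of "- _"] right_minus)
    then show "w (\<Gamma> c *v X) Y + w X (\<Gamma> c *v Y) = 0" using \<kappa> by simp
  qed
  show "sp \<sigma>"
    unfolding sp_def
  proof (intro allI)
    fix X Y
    have "- (\<kappa> / 2) * (w (\<sigma> *v X) Y + w X (\<sigma> *v Y))
      = br (Z *v Hf X) (Hf Y) + br (Hf X) (Z *v Hf Y)"
      unfolding Z_Hf by (simp add: bform_simps br_f_Hf br_Hf_Hf) (simp add: field_simps)
    then have "- (\<kappa> / 2) * (w (\<sigma> *v X) Y + w X (\<sigma> *v Y)) = 0"
      by (simp only: Z_move add.commute[of "- _"] right_minus)
    then show "w (\<sigma> *v X) Y + w X (\<sigma> *v Y) = 0" using \<kappa> by simp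
  qed
qed (rule curvature_\<Gamma>)

text \<open>Pairing the Heisenberg relation on \<open>Hf Y\<close> with \<open>e\<close> extracts
  the coefficient of \<open>f\<close>. For \<open>Y = axis b 1\<close> and \<open>d = b\<close> it
  reads \<open>- (x / 2) = x\<close>, where \<open>x\<close> is a nonzero multiple of
  \<open>lam b\<close> once \<open>W $ c $ b\<close> is nonzero.\<close>

lemma lam_zero: "lam b = 0"
proof -
  have L: "br (h c (h d (Hf Y))) e = \<kappa> * (w (axis d 1) Y / 2 * lam c)" for c d Y
    unfolding h_h_Hf by (simp add: bform_simps br_f_e br_e_Hf br_self alg.\<sigma>_zero field_simps)
  have R: "br (Z *v Hf Y) e = \<kappa> * (\<Sum>c\<in>UNIV. Y $ c * lam c)" for Y
    unfolding Z_Hf by (simp add: bform_simps br_f_e br_e_Hf alg.\<sigma>_zero)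
  have "\<kappa> * (w (axis d 1) (axis b 1) / 2 * lam c) - \<kappa> * (w (axis c 1) (axis b 1) / 2 * lam d)
      = W $ c $ d * (\<kappa> * (\<Sum>k\<in>UNIV. axis b 1 $ k * lam k))" for c d b
    unfolding L[symmetric] R[symmetric] bform_diff_left[symmetric] h_heis by (simp add: bform_simps)
  note * = this
  have "(\<Sum>k\<in>UNIV. axis b 1 $ k * lam k) = lam b" for b
    by (rule axis_sum)
  with *[of b b] have q: "- (\<kappa> * (W $ c $ b * lam b) / 2) = \<kappa> * (W $ c $ b * lam b)" for c
    by (simp add: bform_axis mult.left_commute)
  have "x = 0" if "- (x / 2) = x" for x :: 'a
  proof -
    have "x * 3 = 2 * (x - - (x / 2))" by simp
    then show ?thesis using that by simp
  qed
  from this[OF q] have "\<kappa> * (W $ c $ b * lam b) = 0" for c .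
  then have "W $ c $ b * lam b = 0" for c using \<kappa> by simp
  moreover obtain c where "W $ c $ b \<noteq> 0"
    using Wi_W[of b b] by (metis (no_types, lifting) mult_zero_right sum.neutral zero_neq_one)
  ultimately show ?thesis by (metis mult_eq_0_iff)
qed

text \<open>With \<open>\<sigma>\<close> and \<open>lam\<close> zero every \<open>h c\<close>
  annihilates \<open>e\<close>. Hence \<open>Z\<close> annihilates \<open>e\<close> and all of
  \<open>Hf\<close>, and its image is spanned by \<open>e = Z *v f\<close>.\<close>

theorem rank_one: "br f (Z *v f) *s (Z *v y) = br y (Z *v f) *s (Z *v f)"
proof -
  have h0: "h c e = 0" for c
    using h_e[of c] by (simp add: lam_zero alg.\<sigma>_zero Hf_linear)
  obtain c d where cd: "W $ c $ d \<noteq> 0" by (rule W_nonzero)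
  have "W $ c $ d *s (Z *v e) = 0"
    unfolding h_heis[symmetric] by (simp add: h0 h_linear)
  then have Ze: "Z *v e = 0" using cd by (simp add: vec_eq_iff)
  have "Z *v y = (br y e / \<kappa>) *s e"
    by (subst decomposition[of y]) (simp add: mv_simps Z_Hf lam_zero alg.\<sigma>_zero Hf_linear Ze e_def[symmetric])
  then show ?thesis using \<kappa> by (simp add: br_f_e e_def[symmetric])
qed

end

section \<open>Formal connections on the torus\<close>

definition torus_fps :: "(real ^ 'm::finite \<Rightarrow> real fps) \<Rightarrow> bool" where
  "torus_fps F \<longleftrightarrow> (\<forall>k. torus_fun (\<lambda>x. fps_nth (F x) k))"

definition fd :: "'m::finite \<Rightarrow> (real ^ 'm \<Rightarrow> real fps) \<Rightarrow> real ^ 'm \<Rightarrow> real fps" where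
  "fd c F x = Abs_fps (\<lambda>k. pd c (\<lambda>y. fps_nth (F y) k) x)"

lemma fd_nth [simp]: "fps_nth (fd c F x) k = pd c (\<lambda>y. fps_nth (F y) k) x"
  by (simp add: fd_def)

lemma torus_fps_nth: "torus_fps F \<Longrightarrow> torus_fun (\<lambda>x. fps_nth (F x) k)"
  by (simp add: torus_fps_def)

lemma torus_fps_const [simp]: "torus_fps (\<lambda>_. c)"
  by (simp add: torus_fps_def)

lemma torus_fps_add: "torus_fps F \<Longrightarrow> torus_fps G \<Longrightarrow> torus_fps (\<lambda>x. F x + G x)"
  and torus_fps_diff: "torus_fps F \<Longrightarrow> torus_fps G \<Longrightarrow> torus_fps (\<lambda>x. F x - G x)"
  and torus_fps_uminus: "torus_fps F \<Longrightarrow> torus_fps (\<lambda>x. - F x)"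
  and torus_fps_mult: "torus_fps F \<Longrightarrow> torus_fps G \<Longrightarrow> torus_fps (\<lambda>x. F x * G x)"
  and torus_fps_fd: "torus_fps F \<Longrightarrow> torus_fps (\<lambda>x. fd c F x)"
  by (auto simp: torus_fps_def fps_mult_nth intro!: torus_intros)

lemma torus_fps_sum: "(\<And>i. i \<in> A \<Longrightarrow> torus_fps (F i)) \<Longrightarrow> torus_fps (\<lambda>x. \<Sum>i\<in>A. F i x)"
  by (induction A rule: infinite_finite_induct) (auto intro: torus_fps_add)

lemmas torus_fps_intros = torus_fps_const torus_fps_add torus_fps_diff torus_fps_uminus torus_fps_mult
  torus_fps_fd torus_fps_sum

lemma torus_fps_smooth: "torus_fps F \<Longrightarrow> smooth_fun (\<lambda>x. fps_nth (F x) k)"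
  by (simp add: torus_fps_def torus_fun_def)

lemma fd_const [simp]: "fd c (\<lambda>_. K) x = 0"
  by (simp add: fps_eq_iff)

lemma fd_add: "torus_fps F \<Longrightarrow> torus_fps G \<Longrightarrow> fd c (\<lambda>y. F y + G y) x = fd c F x + fd c G x"
  and fd_diff: "torus_fps F \<Longrightarrow> torus_fps G \<Longrightarrow> fd c (\<lambda>y. F y - G y) x = fd c F x - fd c G x"
  and fd_uminus: "torus_fps F \<Longrightarrow> fd c (\<lambda>y. - F y) x = - fd c F x"
  by (simp_all add: fps_eq_iff pd_add pd_diff pd_uminus torus_fps_smooth)

lemma fd_mult:
  assumes "torus_fps F" "torus_fps G"
  shows "fd c (\<lambda>y. F y * G y) x = fd c F x * G x + F x * fd c G x"
  using assms by (simp add: fps_eq_iff fps_mult_nth pd_sum pd_mult smooth_fun_mult torus_fps_smooth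
      sum.distrib add.commute)

lemma fd_sum: "(\<And>i. i \<in> A \<Longrightarrow> torus_fps (F i)) \<Longrightarrow> fd c (\<lambda>y. \<Sum>i\<in>A. F i y) x = (\<Sum>i\<in>A. fd c (F i) x)"
  by (induction A rule: infinite_finite_induct) (auto simp: fd_add torus_fps_sum)

lemma fd_cmult: "torus_fps F \<Longrightarrow> fd c (\<lambda>y. K * F y) x = K * fd c F x"
  by (simp add: fd_mult)

lemma fd_commute: "torus_fps F \<Longrightarrow> fd c (fd d F) x = fd d (fd c F) x"
  by (simp add: fps_eq_iff pd_commute torus_fps_smooth)

section \<open>Matrices of formal power series with periodic coefficients\<close>

definition torus_mat :: "(real ^ 'm::finite \<Rightarrow> real fps ^ 'q ^ 'p) \<Rightarrow> bool" where
  "torus_mat G \<longleftrightarrow> (\<forall>i j. torus_fps (\<lambda>x. G x $ i $ j))"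

definition md :: "'m::finite \<Rightarrow> (real ^ 'm \<Rightarrow> real fps ^ 'q ^ 'p) \<Rightarrow> real ^ 'm \<Rightarrow> real fps ^ 'q ^ 'p" where
  "md c G x = (\<chi> i j. fd c (\<lambda>y. G y $ i $ j) x)"

lemma md_nth [simp]: "md c G x $ i $ j = fd c (\<lambda>y. G y $ i $ j) x"
  by (simp add: md_def)

lemma torus_matD: "torus_mat G \<Longrightarrow> torus_fps (\<lambda>x. G x $ i $ j)"
  by (simp add: torus_mat_def)

lemma torus_mat_const [simp]: "torus_mat (\<lambda>_. A)"
  by (simp add: torus_mat_def)

lemma torus_mat_add: "torus_mat A \<Longrightarrow> torus_mat B \<Longrightarrow> torus_mat (\<lambda>x. A x + B x)"
  and torus_mat_diff: "torus_mat A \<Longrightarrow> torus_mat B \<Longrightarrow> torus_mat (\<lambda>x. A x - B x)"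
  and torus_mat_mult: "torus_mat A \<Longrightarrow> torus_mat C \<Longrightarrow> torus_mat (\<lambda>x. A x ** C x)"
  and torus_mat_md: "torus_mat A \<Longrightarrow> torus_mat (md c A)"
  and torus_mat_transpose: "torus_mat A \<Longrightarrow> torus_mat (\<lambda>x. transpose (A x))"
  by (auto simp: torus_mat_def matrix_matrix_mult_def transpose_def intro!: torus_fps_intros)

lemmas torus_mat_intros = torus_mat_const torus_mat_add torus_mat_diff torus_mat_mult torus_mat_md torus_mat_transpose

lemma md_const [simp]: "md c (\<lambda>_. A) x = 0"
  by (simp add: vec_eq_iff)

lemma md_add: "torus_mat A \<Longrightarrow> torus_mat B \<Longrightarrow> md c (\<lambda>y. A y + B y) x = md c A x + md c B x"
  and md_diff: "torus_mat A \<Longrightarrow> torus_mat B \<Longrightarrow> md c (\<lambda>y. A y - B y) x = md c A x - md c B x"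
  and md_transpose: "md c (\<lambda>y. transpose (A y)) x = transpose (md c A x)"
  by (simp_all add: vec_eq_iff fd_add fd_diff torus_matD transpose_def)

lemma md_mult:
  assumes "torus_mat A" "torus_mat B"
  shows "md c (\<lambda>y. A y ** B y) x = md c A x ** B x + A x ** md c B x"
  using assms by (simp add: vec_eq_iff matrix_matrix_mult_def fd_sum fd_mult torus_fps_mult torus_matD sum.distrib)

lemma md_commute: "torus_mat A \<Longrightarrow> md c (md d A) x = md d (md c A) x"
  by (simp add: vec_eq_iff md_def fd_commute[unfolded torus_mat_def] torus_matD)

definition smat :: "'a::times \<Rightarrow> 'a ^ 'q ^ 'p \<Rightarrow> 'a ^ 'q ^ 'p" where
  "smat k A = (\<chi> i j. k * A $ i $ j)"

lemma smat_nth [simp]: "smat k A $ i $ j = k * A $ i $ j"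
  by (simp add: smat_def)

lemma smat_mult_left: "smat k A ** B = smat k (A ** B)"
  and smat_mult_right: "A ** smat k B = smat k (A ** B)" for k :: "'a::comm_semiring_1"
  by (simp_all add: vec_eq_iff matrix_matrix_mult_def sum_distrib_left ac_simps)

lemma smat_vec: "smat k A *v x = k *s (A *v x)" for k :: "'a::comm_ring_1"
  by (simp add: vec_eq_iff matrix_vector_mult_def sum_distrib_left ac_simps)

definition coeffs_agree :: "nat \<Rightarrow> 'a fps ^ 'q ^ 'p \<Rightarrow> 'a fps ^ 'q ^ 'p \<Rightarrow> bool" where
  "coeffs_agree m A B \<longleftrightarrow> (\<forall>k\<le>m. \<forall>i j. fps_nth (A $ i $ j) k = fps_nth (B $ i $ j) k)"

lemma coeffs_agree_mult:
  "coeffs_agree m A A' \<Longrightarrow> coeffs_agree m B B' \<Longrightarrow> coeffs_agree m (A ** B) (A' ** B')"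
  for A :: "'a::comm_ring_1 fps ^ 'q ^ 'p"
  by (auto simp: coeffs_agree_def matrix_matrix_mult_def fps_sum_nth fps_mult_nth intro!: sum.cong)

lemma coeffs_agree_add: "coeffs_agree m A A' \<Longrightarrow> coeffs_agree m B B' \<Longrightarrow> coeffs_agree m (A + B) (A' + B')"
  and coeffs_agree_diff: "coeffs_agree m A A' \<Longrightarrow> coeffs_agree m B B' \<Longrightarrow> coeffs_agree m (A - B) (A' - B')"
  for A :: "'a::comm_ring_1 fps ^ 'q ^ 'p"
  by (auto simp: coeffs_agree_def)

text \<open>Vanishing up to index \<open>m\<close> means order at least \<open>m + 1\<close>, so the
  product has order at least \<open>m + l + 2\<close>. With \<open>l = 0\<close> one index is
  gained, which hides the error terms of a gauge step at the order being corrected.\<close>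

lemma coeffs_agree_0_mult:
  fixes A :: "'a::comm_ring_1 fps ^ 'q ^ 'p"
  assumes "coeffs_agree m A 0" "coeffs_agree l B 0"
  shows "coeffs_agree (Suc (m + l)) (A ** B) 0"
proof -
  have "fps_nth (A $ i $ r) s * fps_nth (B $ r $ j) (k - s) = 0" if "k \<le> Suc (m + l)" "s \<le> k" for k s i j r
  proof (cases "s \<le> m")
    case True then show ?thesis using assms by (simp add: coeffs_agree_def)
  next
    case False
    then have "k - s \<le> l" using that by simp
    then show ?thesis using assms by (simp add: coeffs_agree_def)
  qed
  then show ?thesis
    by (simp add: coeffs_agree_def matrix_matrix_mult_def fps_sum_nth fps_mult_nth)
qed

lemma coeffs_agree_mono: "coeffs_agree m A B \<Longrightarrow> l \<le> m \<Longrightarrow> coeffs_agree l A B"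
  by (simp add: coeffs_agree_def)

lemma coeffs_agree_trans: "coeffs_agree m A B \<Longrightarrow> coeffs_agree m B C \<Longrightarrow> coeffs_agree m A C"
  by (simp add: coeffs_agree_def)

lemma coeffs_agree_refl [simp]: "coeffs_agree m A A"
  by (simp add: coeffs_agree_def)

definition mcoeff :: "nat \<Rightarrow> 'a fps ^ 'q ^ 'p \<Rightarrow> 'a ^ 'q ^ 'p" where
  "mcoeff k A = (\<chi> i j. fps_nth (A $ i $ j) k)"

lemma mcoeff_nth [simp]: "mcoeff k A $ i $ j = fps_nth (A $ i $ j) k"
  by (simp add: mcoeff_def)

lemma mcoeff_mult_top:
  fixes A :: "'a::comm_ring_1 fps ^ 'q ^ 'p"
  assumes "\<And>k. k < m \<Longrightarrow> mcoeff k B = 0"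
  shows "mcoeff m (A ** B) = mcoeff 0 A ** mcoeff m B"
proof -
  have B: "fps_nth (B $ i $ j) k = 0" if "k < m" for i j k
    using assms[OF that] by (simp add: vec_eq_iff)
  have "(\<Sum>s=0..m. fps_nth (A $ i $ r) s * fps_nth (B $ r $ j) (m - s))
      = (\<Sum>s\<in>{0}. fps_nth (A $ i $ r) s * fps_nth (B $ r $ j) (m - s))" for i j r
    by (rule sum.mono_neutral_right) (auto simp: B)
  then show ?thesis
    by (simp add: vec_eq_iff matrix_matrix_mult_def fps_sum_nth fps_mult_nth)
qed

lemma unipotent_mult_zero:
  fixes A :: "'a::comm_ring_1 fps ^ 'p ^ 'p"
  assumes "mcoeff 0 A = mat 1" "\<And>k. k \<le> m \<Longrightarrow> mcoeff k (A ** B) = 0" "k \<le> m"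
  shows "mcoeff k B = 0"
  using assms(3)
proof (induction k rule: less_induct)
  case (less k)
  then have "mcoeff k (A ** B) = mcoeff 0 A ** mcoeff k B"
    by (intro mcoeff_mult_top) simp
  then show ?case using assms less by simp
qed

lemma matrix_sub_ldistrib: "A ** (B - C) = A ** B - A ** C"
  and matrix_sub_rdistrib: "(B' - C') ** A = B' ** A - C' ** A"
  and matrix_add_rdistrib: "(B' + C') ** A = B' ** A + C' ** A" for A :: "'a::comm_ring_1 ^ 'q ^ 'p"
  by (simp_all add: vec_eq_iff matrix_matrix_mult_def algebra_simps sum_subtractf sum.distrib)

section \<open>Gauge normalisation of connections with curvature proportional to omega\<close>

locale symplectic_torus = symplectic_space W Wi for W Wi :: "real ^ 'm ^ 'm" +
  assumes dim: "CARD('m) > 2"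
begin

lemma W_nonzero: obtains c d where "W $ c $ d \<noteq> 0"
proof -
  have "\<exists>c d. W $ c $ d \<noteq> 0"
  proof (rule ccontr)
    assume "\<nexists>c d. W $ c $ d \<noteq> 0"
    then have "W = 0" by (simp add: vec_eq_iff)
    then have "mat 1 = (0 :: real ^ 'm ^ 'm)" using inverse(1) by simp
    then have "mat 1 $ i $ i = (0 :: real ^ 'm ^ 'm) $ i $ i" for i by simp
    then show False by (simp add: mat_def)
  qed
  then show ?thesis using that by blast
qed

text \<open>Differentiating \<open>M\<close> shows that the differential of \<open>y\<close> has
  zero wedge product with omega, so \<open>y\<close> is constant. Then the periodic form
  \<open>E\<close> has a constant exterior derivative, which must be zero.\<close>

lemma exact_multiple_of_omega:
  assumes E: "\<And>c. torus_fun (E c)"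
    and M: "\<And>c d x. pd c (E d) x - pd d (E c) x = N c d + W $ c $ d * y x"
  shows "pd c (E d) x = pd d (E c) x"
proof -
  obtain p q where pq: "W $ p $ q \<noteq> 0" by (rule W_nonzero)
  have s: "smooth_fun (E c)" for c using E torus_fun_smooth by blast
  \<comment> \<open>Solving \<open>M\<close> for \<open>y\<close> at one entry with
    \<open>W $ p $ q\<close> nonzero supplies the smoothness of \<open>y\<close>.\<close>
  define y' where "y' x = (pd p (E q) x - pd q (E p) x) / W $ p $ q - N p q / W $ p $ q" for x
  have y': "y x = y' x" for x
    using M[of p q x] pq by (simp add: y'_def field_simps)
  then have yy: "y = y'" by auto
  have sy: "smooth_fun y"
    unfolding yy y'_def[abs_def] divide_inverse by (intro smooth_intros smooth_fun_const s)
  have "pd e y x = 0" for e x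
  proof (rule wedge_omega_zero[where y="\<lambda>e. pd e y x"])
    show "CARD('m) > 2" by (rule dim)
    fix c d e
    have "W $ c $ d * pd e y x = pd e (pd c (E d)) x - pd e (pd d (E c)) x" for c d e
    proof -
      have "pd e (\<lambda>x. pd c (E d) x - pd d (E c) x) x = pd e (\<lambda>x. N c d + W $ c $ d * y x) x"
        unfolding M ..
      then show ?thesis
        by (simp add: pd_diff pd_add pd_cmult s smooth_fun_pd smooth_fun_cmult sy)
    qed
    then show "W $ c $ d * pd e y x + W $ d $ e * pd c y x + W $ e $ c * pd d y x = 0"
      using pd_commute[OF s] by simp
  qed
  then have "y x = y 0" for x by (rule pd_zero_imp_const[OF sy])
  then have "N c d + W $ c $ d * y 0 = 0"
    using exact_torus_form_const[of E "\<lambda>c d. N c d + W $ c $ d * y 0"] E M by metis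
  then show ?thesis using M[of c d x] \<open>\<And>x. y x = y 0\<close> by (metis eq_iff_diff_eq_0)
qed

end

locale formal_central_connection = symplectic_torus W Wi for W Wi :: "real ^ 'm ^ 'm" +
  fixes h :: "'m \<Rightarrow> real ^ 'm \<Rightarrow> real fps ^ 'p ^ 'p" and A :: "real ^ 'm \<Rightarrow> real fps ^ 'p ^ 'p"
  assumes torus_h: "\<And>c. torus_mat (h c)"
    and h_0: "\<And>c x. mcoeff 0 (h c x) = 0"
    and curvature: "\<And>c d x. md c (h d) x - md d (h c) x + h c x ** h d x - h d x ** h c x
       = smat (fps_const (W $ c $ d)) (A x)"
begin

text \<open>Vanishes exactly when \<open>G\<close> transforms the connection with form
  \<open>h\<close> into the one with constant form \<open>a\<close>.\<close>

definition defect where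
  "defect G a c x = G x ** a c - h c x ** G x - md c G x"

definition gauge_upto :: "nat \<Rightarrow> (real ^ 'm \<Rightarrow> real fps ^ 'p ^ 'p) \<Rightarrow> ('m \<Rightarrow> real fps ^ 'p ^ 'p) \<Rightarrow> bool" where
  "gauge_upto m G a \<longleftrightarrow> torus_mat G \<and> (\<forall>x. mcoeff 0 (G x) = mat 1) \<and> (\<forall>c. mcoeff 0 (a c) = 0) \<and>
     (\<forall>c x k. k \<le> m \<longrightarrow> mcoeff k (defect G a c x) = 0)"

lemma torus_defect: "torus_mat G \<Longrightarrow> torus_mat (defect G a c)"
  unfolding defect_def[abs_def] by (intro torus_mat_intros torus_h)

lemma agree_0: "(\<And>k. k \<le> m \<Longrightarrow> mcoeff k B = 0) \<Longrightarrow> coeffs_agree m B 0"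
  by (simp add: coeffs_agree_def vec_eq_iff)

text \<open>Up to the last group of terms, the exterior derivative of the defect is the difference
  of the curvatures of \<open>a\<close> and \<open>h\<close>, compared through \<open>G\<close>.
  Each term of that group contains both a defect and a connection form, so it has higher
  order.\<close>

lemma md_defect:
  assumes G: "torus_mat G"
  shows "md c (defect G a d) x - md d (defect G a c) x =
    G x ** (a c ** a d - a d ** a c) - smat (fps_const (W $ c $ d)) (A x ** G x)
    + (defect G a d x ** a c - defect G a c x ** a d + h d x ** defect G a c x - h c x ** defect G a d x)"
proof -
  have 1: "md c (defect G a d) x = md c G x ** a d - (md c (h d) x ** G x + h d x ** md c G x) - md c (md d G) x" for c d
    unfolding defect_def[abs_def]
    by (simp add: md_diff md_mult torus_mat_intros torus_h G)
  have 2: "md c G x = G x ** a c - h c x ** G x - defect G a c x" for c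
    by (simp add: defect_def)
  have 3: "md c (h d) x = md d (h c) x - h c x ** h d x + h d x ** h c x + smat (fps_const (W $ c $ d)) (A x)"
    using curvature[of c d x] by (simp add: algebra_simps)
  show ?thesis
    unfolding 1 md_commute[OF G, of c d] 3 2[of c] 2[of d]
    by (simp add: matrix_sub_ldistrib matrix_sub_rdistrib matrix_add_ldistrib matrix_add_rdistrib
       smat_mult_left matrix_mul_assoc)
qed

text \<open>The first nonvanishing coefficient of the defect turns out to be a closed periodic
  1-form in each entry. Its constant part is absorbed into \<open>a\<close> and its exact part into
  \<open>G\<close>.\<close>

lemma gauge_step:
  assumes "gauge_upto m G a"
  obtains G' a' where "gauge_upto (Suc m) G' a'" "\<And>x. coeffs_agree m (G x) (G' x)" "\<And>c. coeffs_agree m (a c) (a' c)"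
proof -
  have G: "torus_mat G" and G0: "mcoeff 0 (G x) = mat 1" and a0: "mcoeff 0 (a c) = 0"
    and D: "k \<le> m \<Longrightarrow> mcoeff k (defect G a c x) = 0" for c x k
    using assms unfolding gauge_upto_def by blast+
  have D': "coeffs_agree m (defect G a c x) 0" for c x by (rule agree_0) (rule D)
  have h0: "coeffs_agree 0 (h c x) 0" for c x by (rule agree_0) (simp add: h_0)
  have a0': "coeffs_agree 0 (a c) 0" for c by (rule agree_0) (simp add: a0)
  define M where "M c d x = G x ** (a c ** a d - a d ** a c) - smat (fps_const (W $ c $ d)) (A x ** G x)" for c d x
  have M: "mcoeff k (M c d x) = (\<chi> i j. pd c (\<lambda>x. fps_nth (defect G a d x $ i $ j) k) x
       - pd d (\<lambda>x. fps_nth (defect G a c x $ i $ j) k) x)" if "k \<le> Suc m" for c d x k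
  proof -
    let ?J = "defect G a d x ** a c - defect G a c x ** a d + h d x ** defect G a c x - h c x ** defect G a d x"
    have "coeffs_agree (Suc m) ?J (0 - 0 + 0 - 0)"
      by (intro coeffs_agree_diff coeffs_agree_add)
        (use coeffs_agree_0_mult[OF D' a0'] coeffs_agree_0_mult[OF h0 D'] in auto)
    then have "mcoeff k ?J = 0" using that by (simp add: coeffs_agree_def vec_eq_iff)
    then have "mcoeff k (M c d x) = mcoeff k (md c (defect G a d) x - md d (defect G a c) x)"
      unfolding md_defect[OF G] M_def by (simp add: vec_eq_iff)
    then show ?thesis by (simp add: vec_eq_iff)
  qed
  obtain p q where pq: "W $ p $ q \<noteq> 0" by (rule W_nonzero)
  \<comment> \<open>This combination eliminates \<open>A\<close> from the comparison of curvatures;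
    what is left is built from \<open>a\<close> and does not depend on \<open>x\<close>.\<close>
  define N where "N c d = smat (fps_const (W $ p $ q)) (a c ** a d - a d ** a c)
      - smat (fps_const (W $ c $ d)) (a p ** a q - a q ** a p)" for c d
  have GN: "G x ** N c d = smat (fps_const (W $ p $ q)) (M c d x) - smat (fps_const (W $ c $ d)) (M p q x)" for c d x
    unfolding N_def M_def by (simp add: matrix_sub_ldistrib smat_mult_right) (simp add: vec_eq_iff algebra_simps)
  have GN_0: "mcoeff k (G x ** N c d) = 0" if "k \<le> m" for c d x k
  proof -
    have "mcoeff k (M c d x) = 0" for c d
      using M[of k c d x] D[OF that] that by (simp add: vec_eq_iff)
    then show ?thesis unfolding GN by (simp add: vec_eq_iff fps_mult_left_const_nth)
  qed
  have N_0: "mcoeff k (N c d) = 0" if "k \<le> m" for c d k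
    using unipotent_mult_zero[OF G0[of 0] GN_0 that] by simp
  \<comment> \<open>\<open>N\<close> begins at order \<open>m + 1\<close>, where multiplication by
    the unipotent \<open>G\<close> leaves its coefficient unchanged; so the coefficient of the
    product is independent of \<open>x\<close> as well.\<close>
  have GN_top: "mcoeff (Suc m) (G x ** N c d) = mcoeff (Suc m) (N c d)" for x c d
    using mcoeff_mult_top[of "Suc m" "N c d" "G x"] N_0 G0[of x] by simp
  have "\<exists>\<phi> K. torus_fun \<phi> \<and> (\<forall>c x. fps_nth (defect G a c x $ i $ j) (Suc m) = K c + pd c \<phi> x)" for i j
  proof -
    define E where "E c x = fps_nth (defect G a c x $ i $ j) (Suc m)" for c x
    have E: "torus_fun (E c)" for c
      unfolding E_def[abs_def] by (intro torus_fps_nth torus_matD torus_defect G)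
    have "pd c (E d) x = pd d (E c) x" for c d x
    proof (rule exact_multiple_of_omega[OF E])
      fix c d x
      have "fps_nth (M c d x $ i $ j) (Suc m) = pd c (E d) x - pd d (E c) x" for c d
        using M[of "Suc m" c d x] by (simp add: vec_eq_iff E_def[abs_def])
      moreover have "W $ p $ q * fps_nth (M c d x $ i $ j) (Suc m) - W $ c $ d * fps_nth (M p q x $ i $ j) (Suc m)
         = fps_nth (N c d $ i $ j) (Suc m)"
        using arg_cong[OF GN_top[of x c d], of "\<lambda>B. B $ i $ j"] unfolding GN by (simp add: fps_mult_left_const_nth)
      moreover have "u = v / r + k * (b / r)" if "r * u - k * b = v" "r \<noteq> 0" for u v r b k :: real
      proof -
        have "r * u = v + k * b" using that(1) by simp
        then show ?thesis using that(2) by (simp add: nonzero_eq_divide_eq add_divide_distrib[symmetric] mult.commute)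
      qed
      ultimately show "pd c (E d) x - pd d (E c) x = fps_nth (N c d $ i $ j) (Suc m) / W $ p $ q +
         W $ c $ d * (fps_nth (M p q x $ i $ j) (Suc m) / W $ p $ q)"
        using pq by metis
    qed
    then show ?thesis using closed_torus_form[of E] E unfolding E_def by metis
  qed
  then obtain \<phi> K where \<phi>: "\<And>i j. torus_fun (\<phi> i j)" and
    K: "\<And>i j c x. fps_nth (defect G a c x $ i $ j) (Suc m) = K i j c + pd c (\<phi> i j) x"
    by metis
  define P :: "real ^ 'm \<Rightarrow> real fps ^ 'p ^ 'p" where "P x = (\<chi> i j. fps_const (\<phi> i j x) * fps_X ^ Suc m)" for x
  define Q :: "'m \<Rightarrow> real fps ^ 'p ^ 'p" where "Q c = (\<chi> i j. fps_const (K i j c) * fps_X ^ Suc m)" for c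
  define G' where "G' x = G x + P x" for x
  define a' where "a' c = a c - Q c" for c
  have nth_P: "fps_nth (P x $ i $ j) k = (if k = Suc m then \<phi> i j x else 0)" for x i j k
    by (simp add: P_def fps_X_power_nth fps_mult_left_const_nth del: power_Suc)
  have nth_Q: "fps_nth (Q c $ i $ j) k = (if k = Suc m then K i j c else 0)" for c i j k
    by (simp add: Q_def fps_X_power_nth fps_mult_left_const_nth del: power_Suc)
  have P0: "coeffs_agree m (P x) 0" for x by (simp add: coeffs_agree_def nth_P)
  have Q0: "coeffs_agree m (Q c) 0" for c by (simp add: coeffs_agree_def nth_Q)
  have tP: "torus_mat P"
    unfolding torus_mat_def torus_fps_def nth_P
    by (intro allI, rename_tac i j k, case_tac "k = Suc m") (simp_all add: \<phi>)
  have d': "defect G' a' c x = defect G a c x - G x ** Q c - md c P x + (P x ** a c - h c x ** P x - P x ** Q c)" for c x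
    unfolding defect_def G'_def[abs_def] a'_def
    by (simp add: md_add G tP matrix_sub_ldistrib matrix_sub_rdistrib matrix_add_ldistrib matrix_add_rdistrib)
  have "gauge_upto (Suc m) G' a'"
    unfolding gauge_upto_def
  proof (intro conjI allI impI)
    show "torus_mat G'" unfolding G'_def[abs_def] by (intro torus_mat_intros G tP)
    show "mcoeff 0 (G' x) = mat 1" for x
      using G0[of x] by (simp add: vec_eq_iff G'_def nth_P)
    show "mcoeff 0 (a' c) = 0" for c
      using a0[of c] by (simp add: vec_eq_iff a'_def nth_Q)
    fix c x k assume k: "k \<le> Suc m"
    let ?J = "P x ** a c - h c x ** P x - P x ** Q c"
    have "coeffs_agree (Suc m) ?J (0 - 0 - 0)"
      by (intro coeffs_agree_diff)
        (use coeffs_agree_0_mult[OF P0 a0'] coeffs_agree_0_mult[OF h0 P0] coeffs_agree_0_mult[OF P0 coeffs_agree_mono[OF Q0 le0]] in auto)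
    then have J: "mcoeff k ?J = 0" using k by (simp add: coeffs_agree_def vec_eq_iff)
    have GQ: "mcoeff k (G x ** Q c) = mcoeff 0 (G x) ** mcoeff k (Q c)"
      using k by (intro mcoeff_mult_top) (simp add: vec_eq_iff nth_Q)
    have mP: "fps_nth (md c P x $ i $ j) k = (if k = Suc m then pd c (\<phi> i j) x else 0)" for i j
      by (simp add: nth_P)
    have "mcoeff k (defect G' a' c x) = mcoeff k (defect G a c x) - mcoeff k (Q c) - mcoeff k (md c P x)"
      using J GQ G0[of x] unfolding d' by (simp add: vec_eq_iff)
    also have "\<dots> = 0"
    proof (cases "k = Suc m")
      case True
      then show ?thesis by (simp add: vec_eq_iff K nth_Q nth_P)
    next
      case False
      then show ?thesis using k D[of k c x] by (simp add: vec_eq_iff nth_Q nth_P)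
    qed
    finally show "mcoeff k (defect G' a' c x) = 0" .
  qed
  then show ?thesis
    by (rule that) (auto simp: coeffs_agree_def G'_def a'_def nth_P nth_Q)
qed

lemma gauge_0: "gauge_upto 0 (\<lambda>_. mat 1) (\<lambda>_. 0)"
proof -
  have "mcoeff 0 (defect (\<lambda>_. mat 1) (\<lambda>_. 0) c x) = 0" for c x
    using h_0[of c x] by (simp add: defect_def vec_eq_iff)
  then show ?thesis
    by (simp add: gauge_upto_def) (simp add: vec_eq_iff mat_def)
qed

text \<open>Passing from stage \<open>m\<close> to the next keeps all coefficients up to index
  \<open>m\<close>, so the stages converge; the limit takes its coefficient of index
  \<open>k\<close> from stage \<open>k\<close>.\<close>

theorem constant_gauge:
  obtains G a where "torus_mat G" "\<And>x. mcoeff 0 (G x) = mat 1" "\<And>c. mcoeff 0 (a c) = 0"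
    "\<And>c x. md c G x = G x ** a c - h c x ** G x"
proof -
  obtain F where F: "\<And>m. gauge_upto m (fst (F m)) (snd (F m))"
    and S: "\<And>m. (\<forall>x. coeffs_agree m (fst (F m) x) (fst (F (Suc m)) x)) \<and> (\<forall>c. coeffs_agree m (snd (F m) c) (snd (F (Suc m)) c))"
  proof -
    have "\<exists>F. \<forall>m. gauge_upto m (fst (F m)) (snd (F m)) \<and>
      ((\<forall>x. coeffs_agree m (fst (F m) x) (fst (F (Suc m)) x)) \<and> (\<forall>c. coeffs_agree m (snd (F m) c) (snd (F (Suc m)) c)))"
    proof (rule dependent_nat_choice)
      show "\<exists>y. gauge_upto 0 (fst y) (snd y)" using gauge_0 by (metis fst_conv snd_conv)
      fix y m assume "gauge_upto m (fst y) (snd y)"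
      then obtain G' a' where "gauge_upto (Suc m) G' a'" "\<And>x. coeffs_agree m (fst y x) (G' x)" "\<And>c. coeffs_agree m (snd y c) (a' c)"
        by (rule gauge_step) blast
      then show "\<exists>z. gauge_upto (Suc m) (fst z) (snd z) \<and> (\<forall>x. coeffs_agree m (fst y x) (fst z x)) \<and> (\<forall>c. coeffs_agree m (snd y c) (snd z c))"
        by (intro exI[of _ "(G', a')"]) simp
    qed
    then show ?thesis using that by blast
  qed
  have S': "coeffs_agree m (fst (F m) x) (fst (F (m + l)) x)" "coeffs_agree m (snd (F m) c) (snd (F (m + l)) c)" for m l x c
  proof -
    have "coeffs_agree m (fst (F (m + l)) x) (fst (F (Suc (m + l))) x)"
      "coeffs_agree m (snd (F (m + l)) c) (snd (F (Suc (m + l))) c)" for m l x c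
      using S[of "m + l"] by (auto intro: coeffs_agree_mono)
    then show "coeffs_agree m (fst (F m) x) (fst (F (m + l)) x)" "coeffs_agree m (snd (F m) c) (snd (F (m + l)) c)"
      by (induction l) (auto intro: coeffs_agree_trans)
  qed
  define G where "G x = (\<chi> i j. Abs_fps (\<lambda>k. fps_nth (fst (F k) x $ i $ j) k))" for x
  define a where "a c = (\<chi> i j. Abs_fps (\<lambda>k. fps_nth (snd (F k) c $ i $ j) k))" for c
  have aG: "coeffs_agree m (G x) (fst (F m) x)" and aa: "coeffs_agree m (a c) (snd (F m) c)" for m x c
    using S'[of _ _ "m - _"] by (auto simp: coeffs_agree_def G_def a_def)
      (metis S' coeffs_agree_def le_add_diff_inverse order_refl)+
  have tG: "torus_mat G"
    using F unfolding torus_mat_def torus_fps_def G_def gauge_upto_def by simp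
  have "mcoeff k (defect G a c x) = 0" for k c x
  proof -
    have "coeffs_agree k (md c G x) (md c (fst (F k)) x)"
      using aG[of k] unfolding coeffs_agree_def by simp
    then have "coeffs_agree k (defect G a c x) (defect (fst (F k)) (snd (F k)) c x)"
      unfolding defect_def by (intro coeffs_agree_diff coeffs_agree_mult aG aa coeffs_agree_refl)
    then show ?thesis using F[of k] by (simp add: coeffs_agree_def gauge_upto_def vec_eq_iff)
  qed
  then have "defect G a c x = 0" for c x by (simp add: vec_eq_iff fps_eq_iff)
  then have "md c G x = G x ** a c - h c x ** G x" for c x by (simp add: defect_def)
  moreover have "mcoeff 0 (G x) = mat 1" "mcoeff 0 (a c) = 0" for x c
    using F[of 0] by (simp_all add: G_def a_def gauge_upto_def vec_eq_iff)
  ultimately show ?thesis using tG that by blast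
qed

end

instance fps :: (ring_char_0) ring_char_0 ..

section \<open>Cancellation of unipotent factors and passage to Laurent series\<close>

lemma mcoeff_mult_top':
  fixes A :: "'a::comm_ring_1 fps ^ 'q ^ 'p"
  assumes "\<And>k. k < m \<Longrightarrow> mcoeff k A = 0"
  shows "mcoeff m (A ** B) = mcoeff m A ** mcoeff 0 B"
proof -
  have A: "fps_nth (A $ i $ j) k = 0" if "k < m" for i j k
    using assms[OF that] by (simp add: vec_eq_iff)
  have "(\<Sum>s=0..m. fps_nth (A $ i $ r) s * fps_nth (B $ r $ j) (m - s))
      = (\<Sum>s\<in>{m}. fps_nth (A $ i $ r) s * fps_nth (B $ r $ j) (m - s))" for i j r
    by (rule sum.mono_neutral_right) (auto simp: A)
  then show ?thesis
    by (simp add: vec_eq_iff matrix_matrix_mult_def fps_sum_nth fps_mult_nth)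
qed

lemma mcoeff_mult_low:
  fixes A :: "'a::comm_ring_1 fps ^ 'q ^ 'p"
  assumes "\<And>k. k < m \<Longrightarrow> mcoeff k A = 0" "k < m"
  shows "mcoeff k (A ** B) = 0" "mcoeff k (C ** A) = 0"
  using mcoeff_mult_top'[of k A B] mcoeff_mult_top[of k A C] assms by simp_all

lemma unipotent_cancel:
  fixes A :: "'a::comm_ring_1 fps ^ 'p ^ 'p"
  assumes "mcoeff 0 A = mat 1" "A ** B = 0"
  shows "B = 0"
proof -
  have "mcoeff k B = 0" for k
    using unipotent_mult_zero[OF assms(1), of k B k] assms(2) by (simp add: vec_eq_iff)
  then show ?thesis by (simp add: vec_eq_iff fps_eq_iff)
qed

text \<open>Reduces to \<open>unipotent_cancel\<close> for the transpose of \<open>G\<close> and the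
  square matrix all of whose columns are \<open>U\<close>.\<close>

lemma unipotent_cancel_row:
  fixes G :: "'a::comm_ring_1 fps ^ 'p ^ 'p"
  assumes "mcoeff 0 G = mat 1" "\<And>b. (\<Sum>j\<in>UNIV. U j * G $ j $ b) = 0"
  shows "U j = 0"
proof -
  define B :: "'a fps ^ 'p ^ 'p" where "B = (\<chi> j b. U j)"
  have "mcoeff 0 (transpose G) = mat 1"
    using assms(1) by (simp add: vec_eq_iff transpose_def mat_def)
  moreover have "transpose G ** B = 0"
    using assms(2) by (simp add: vec_eq_iff matrix_matrix_mult_def transpose_def B_def mult.commute)
  ultimately have "B = 0" by (rule unipotent_cancel)
  then have "B $ j $ j = 0" by simp
  then show ?thesis by (simp add: B_def)
qed

lemma fps_mult_nth_cong_low: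
  fixes a :: "'a::comm_ring_1 fps"
  assumes "fps_nth a 0 = 0" "\<And>r. r < k \<Longrightarrow> fps_nth F r = fps_nth F' r"
  shows "fps_nth (a * F) k = fps_nth (a * F') k"
  unfolding fps_mult_nth
proof (rule sum.cong[OF refl])
  fix r assume "r \<in> {0..k}"
  then show "fps_nth a r * fps_nth F (k - r) = fps_nth a r * fps_nth F' (k - r)"
    using assms by (cases "r = 0") auto
qed

definition fls_mat :: "'a::comm_ring_1 fps ^ 'q ^ 'p \<Rightarrow> 'a fls ^ 'q ^ 'p" where
  "fls_mat A = (\<chi> i j. fps_to_fls (A $ i $ j))"

lemma fps_to_fls_sum: "fps_to_fls (\<Sum>i\<in>A. f i) = (\<Sum>i\<in>A. fps_to_fls (f i :: 'a::comm_ring_1 fps))"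
  by (induction A rule: infinite_finite_induct) auto

lemma fls_mat_mult: "fls_mat (A ** B) = fls_mat A ** fls_mat B"
  and fls_mat_add: "fls_mat (A + A') = fls_mat A + fls_mat A'"
  and fls_mat_diff: "fls_mat (A - A') = fls_mat A - fls_mat A'"
  and fls_mat_uminus: "fls_mat (- A) = - fls_mat A"
  and fls_mat_transpose: "fls_mat (transpose A) = transpose (fls_mat A)"
  and fls_mat_smat: "fls_mat (smat k A) = smat (fps_to_fls k) (fls_mat A)"
  and fls_mat_zero: "fls_mat (0 :: 'a fps ^ 'q ^ 'p) = 0"
  for A :: "'a::comm_ring_1 fps ^ 'q ^ 'p"
  by (simp_all add: vec_eq_iff fls_mat_def matrix_matrix_mult_def fps_to_fls_sum fls_times_fps_to_fls
    transpose_def)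

lemma fls_mat_mat_1: "fls_mat (mat 1 :: 'a::comm_ring_1 fps ^ 'p ^ 'p) = mat 1"
  by (simp add: vec_eq_iff fls_mat_def mat_def)

definition const_mat :: "real ^ 'q ^ 'p \<Rightarrow> real fps ^ 'q ^ 'p" where
  "const_mat A = (\<chi> i j. fps_const (A $ i $ j))"

lemma const_mat_nth [simp]: "const_mat A $ i $ j = fps_const (A $ i $ j)"
  by (simp add: const_mat_def)

lemma fps_const_sum: "fps_const (\<Sum>i\<in>A. f i) = (\<Sum>i\<in>A. fps_const (f i :: real))"
  by (induction A rule: infinite_finite_induct) (auto simp flip: fps_const_add)

lemma const_mat_mult: "const_mat (A ** B) = const_mat A ** const_mat B"
  and const_mat_transpose: "const_mat (transpose A) = transpose (const_mat A)"
  and const_mat_uminus: "const_mat (- A) = - const_mat A"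
  by (simp_all add: vec_eq_iff matrix_matrix_mult_def fps_const_sum transpose_def)

lemma const_mat_mat_1: "const_mat (mat 1) = mat 1"
  by (simp add: vec_eq_iff mat_def)

lemma symplectic_space_const_mat:
  assumes "symplectic_space W Wi"
  shows "symplectic_space (const_mat W) (const_mat Wi)"
    and "symplectic_space (fls_mat (const_mat W)) (fls_mat (const_mat Wi))"
proof -
  interpret symplectic_space W Wi by (rule assms)
  show "symplectic_space (const_mat W) (const_mat Wi)"
    by standard (simp_all add: const_mat_mult[symmetric] const_mat_transpose[symmetric]
       const_mat_uminus[symmetric] inverse antisym const_mat_mat_1)
  then interpret c: symplectic_space "const_mat W" "const_mat Wi" .
  show "symplectic_space (fls_mat (const_mat W)) (fls_mat (const_mat Wi))"
    by standard (simp_all add: fls_mat_mult[symmetric] fls_mat_transpose[symmetric]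
       fls_mat_uminus[symmetric] c.inverse c.antisym fls_mat_mat_1)
qed

text \<open>The last two assumptions say that \<open>A\<close> has order \<open>s\<close> and that
  the basis vector \<open>i0\<close> pairs nontrivially with its image under the leading
  coefficient. This vector serves as \<open>f\<close> in \<open>heisenberg_rep\<close>.\<close>

locale formal_tractor_connection = formal_central_connection W Wi h A
  for W Wi :: "real ^ 'm ^ 'm" and h :: "'m \<Rightarrow> real ^ 'm \<Rightarrow> real fps ^ 'm option option ^ 'm option option"
   and A :: "real ^ 'm \<Rightarrow> real fps ^ 'm option option ^ 'm option option" +
  fixes Om :: "real fps ^ 'm option option ^ 'm option option" and n :: nat and s :: nat and i0 :: "'m option option"
  assumes n: "n \<ge> 2" "CARD('m) = 2 * n"
    and Om_antisym: "transpose Om = - Om"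
    and Om_const: "\<And>k. k > 0 \<Longrightarrow> mcoeff k Om = 0"
    and sp_h: "\<And>c x. transpose (h c x) ** Om + Om ** h c x = 0"
    and A_low: "\<And>k x. k < s \<Longrightarrow> mcoeff k (A x) = 0"
    and A_top: "\<And>x. (mcoeff 0 Om ** mcoeff s (A x)) $ i0 $ i0 \<noteq> 0"
begin

lemma constant_representation:
  obtains G a Z where "\<And>x. mcoeff 0 (G x) = mat 1" "torus_mat G"
    "\<And>c. mcoeff 0 (a c) = 0" "\<And>c x. md c G x = G x ** a c - h c x ** G x"
    "\<And>c d. a c ** a d - a d ** a c = smat (fps_const (W $ c $ d)) Z"
    "\<And>x. G x ** Z = A x ** G x"
proof -
  obtain G a where G: "torus_mat G" and G0: "\<And>x. mcoeff 0 (G x) = mat 1" and a0: "\<And>c. mcoeff 0 (a c) = 0"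
    and dG: "\<And>c x. md c G x = G x ** a c - h c x ** G x"
    using constant_gauge by blast
  have D: "defect G a c = (\<lambda>x. 0)" for c by (rule ext) (simp add: defect_def dG)
  have K: "G x ** (a c ** a d - a d ** a c) = smat (fps_const (W $ c $ d)) (A x ** G x)" for c d x
  proof -
    have "smat (fps_const 0) B = 0" for B :: "real fps ^ 'm option option ^ 'm option option"
      by (simp add: vec_eq_iff)
    have "0 = G x ** (a c ** a d - a d ** a c) - smat (fps_const (W $ c $ d)) (A x ** G x)"
      using md_defect[OF G, of c a d x] unfolding D by simp
    then show ?thesis by simp
  qed
  obtain p q where pq: "W $ p $ q \<noteq> 0" by (rule W_nonzero)
  define Z where "Z = smat (fps_const (1 / W $ p $ q)) (a p ** a q - a q ** a p)"
  have GZ: "G x ** Z = A x ** G x" for x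
    unfolding Z_def smat_mult_right K using pq by (simp add: vec_eq_iff mult.assoc[symmetric])
  have "a c ** a d - a d ** a c = smat (fps_const (W $ c $ d)) Z" for c d
  proof -
    have "G 0 ** (a c ** a d - a d ** a c - smat (fps_const (W $ c $ d)) Z) = 0"
      unfolding matrix_sub_ldistrib[of "G 0" "a c ** a d - a d ** a c"] K smat_mult_right GZ by simp
    from unipotent_cancel[OF G0 this] show ?thesis by simp
  qed
  then show ?thesis using that G0 G a0 dG GZ by blast
qed

text \<open>The form pulled back by \<open>G\<close> satisfies a linear differential equation with
  coefficient \<open>a\<close>, which has no constant term. If the lower coefficients of the form
  are constant, those of index \<open>k\<close> have constant derivatives, and periodicity makes
  these zero.\<close>

lemma gauged_form_constant:
  assumes G: "torus_mat G" and a0: "\<And>c. mcoeff 0 (a c) = 0"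
    and dG: "\<And>c x. md c G x = G x ** a c - h c x ** G x"
  shows "transpose (G x) ** Om ** G x = transpose (G 0) ** Om ** G 0"
    and "transpose (a c) ** (transpose (G 0) ** Om ** G 0) + (transpose (G 0) ** Om ** G 0) ** a c = 0"
proof -
  define F where "F x = transpose (G x) ** Om ** G x" for x
  have F: "torus_mat F" unfolding F_def[abs_def] by (intro torus_mat_intros G)
  have dF: "md c F x = transpose (a c) ** F x + F x ** a c" for c x
  proof -
    have "md c F x = transpose (G x ** a c - h c x ** G x) ** Om ** G x + transpose (G x) ** Om ** (G x ** a c - h c x ** G x)"
      unfolding F_def[abs_def] by (simp add: md_mult torus_mat_intros G md_transpose dG)
    also have "\<dots> = transpose (a c) ** F x + F x ** a c - transpose (G x) ** (transpose (h c x) ** Om + Om ** h c x) ** G x"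
    proof -
      have "transpose (G x ** a c - h c x ** G x) = transpose (a c) ** transpose (G x) - transpose (G x) ** transpose (h c x)"
        by (simp add: matrix_transpose_mul[symmetric]) (simp add: vec_eq_iff transpose_def)
      then show ?thesis
        by (simp add: F_def matrix_sub_ldistrib matrix_sub_rdistrib matrix_add_ldistrib matrix_add_rdistrib matrix_mul_assoc)
    qed
    finally show ?thesis by (simp add: sp_h)
  qed
  have a00: "fps_nth (a c $ i $ j) 0 = 0" for c i j using a0[of c] by (simp add: vec_eq_iff)
  have const: "fps_nth (F x $ i $ j) k = fps_nth (F 0 $ i $ j) k" for x i j k
  proof (induction k arbitrary: x i j rule: less_induct)
    case (less k)
    have "pd c (\<lambda>x. fps_nth (F x $ i $ j) k) x = 0" for c x
    proof -
      have t: "fps_nth (a c $ p $ q * F x $ u $ v) k = fps_nth (a c $ p $ q * F 0 $ u $ v) k" for p q u v x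
        by (rule fps_mult_nth_cong_low[OF a00]) (rule less.IH)
      have u: "fps_nth ((transpose (a c) ** F x + F x ** a c) $ i $ j) k =
        (\<Sum>p\<in>UNIV. fps_nth (a c $ p $ i * F x $ p $ j) k) + (\<Sum>p\<in>UNIV. fps_nth (a c $ p $ j * F x $ i $ p) k)" for x
        by (simp add: matrix_matrix_mult_def transpose_def fps_sum_nth mult.commute[of "F x $ _ $ _"])
      have "pd c (\<lambda>x. fps_nth (F x $ i $ j) k) x = fps_nth ((transpose (a c) ** F x + F x ** a c) $ i $ j) k" for x
        unfolding dF[symmetric] by simp
      also have "fps_nth ((transpose (a c) ** F x + F x ** a c) $ i $ j) k = fps_nth ((transpose (a c) ** F 0 + F 0 ** a c) $ i $ j) k" for x
        unfolding u by (intro arg_cong2[where f="(+)"] sum.cong refl t)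
      finally have p: "pd c (\<lambda>x. fps_nth (F x $ i $ j) k) x = fps_nth ((transpose (a c) ** F 0 + F 0 ** a c) $ i $ j) k" for x .
      then show ?thesis using torus_fun_pd_const[OF torus_fps_nth[OF torus_matD[OF F]] p] by simp
    qed
    then show ?case by (rule pd_zero_imp_const[OF torus_fps_smooth[OF torus_matD[OF F]]])
  qed
  have F0: "F x = F 0" for x unfolding vec_eq_iff fps_eq_iff by (intro allI) (rule const)
  show "transpose (G x) ** Om ** G x = transpose (G 0) ** Om ** G 0" using F0[of x] by (simp add: F_def)
  have "F = (\<lambda>_. F 0)" by (rule ext) (rule F0)
  then have "md c F 0 = 0" by (metis md_const)
  then show "transpose (a c) ** (transpose (G 0) ** Om ** G 0) + (transpose (G 0) ** Om ** G 0) ** a c = 0"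
    unfolding dF by (simp add: F_def)
qed

text \<open>Over Laurent series \<open>Z\<close> has rank one, so its 2 x 2 minors vanish, and with
  them those of \<open>G x ** Z = A x ** G x\<close>. The unipotent \<open>G x\<close> is then
  cancelled from the two column indices in turn.\<close>

theorem rank_one_curvature: "A x $ i $ j * A x $ k $ l = A x $ i $ l * A x $ k $ j"
proof -
  obtain G a Z where G0: "\<And>x. mcoeff 0 (G x) = mat 1" and G: "torus_mat G"
    and a0: "\<And>c. mcoeff 0 (a c) = 0" and dG: "\<And>c x. md c G x = G x ** a c - h c x ** G x"
    and heis: "\<And>c d. a c ** a d - a d ** a c = smat (fps_const (W $ c $ d)) Z"
    and GZ: "\<And>x. G x ** Z = A x ** G x"
    by (rule constant_representation) blast
  define F where "F = transpose (G 0) ** Om ** G 0"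
  note sp = gauged_form_constant(2)[OF G a0 dG, folded F_def]
  have bmat: "bform F' (A' *v axis j 1) (B' *v axis k 1) = (transpose A' ** F' ** B') $ j $ k"
    for F' A' B' :: "real fls ^ 'm option option ^ 'm option option" and j k
    by (simp only: bform_def matrix_vector_axis matrix_vector_mul_assoc matrix_mul_assoc[symmetric])
      (simp add: matrix_matrix_mult_def transpose_def)
  interpret fs: symplectic_space "fls_mat (const_mat W)" "fls_mat (const_mat Wi)"
    by (rule symplectic_space_const_mat) unfold_locales
  interpret rep: heisenberg_rep "fls_mat (const_mat W)" "fls_mat (const_mat Wi)" "fls_mat F" "fls_mat Z"
    "\<lambda>c. fls_mat (a c)" "axis i0 1" n
  proof
    show "2 \<le> n" "CARD('m) = 2 * n" by (rule n)+
    show "transpose (fls_mat F) = - fls_mat F"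
    proof -
      have "transpose F = - F"
        unfolding F_def by (simp add: matrix_transpose_mul Om_antisym mm_neg matrix_mul_assoc)
      then show ?thesis by (metis fls_mat_transpose fls_mat_uminus)
    qed
    then have anti: "bform (fls_mat F) x y = - bform (fls_mat F) y x" for x y by (rule bform_antisym)
    show "bform (fls_mat F) (fls_mat (a c) *v x) y + bform (fls_mat F) x (fls_mat (a c) *v y) = 0" for c x y
    proof -
      have "transpose (fls_mat (a c)) ** fls_mat F + fls_mat F ** fls_mat (a c) = 0"
        using arg_cong[OF sp[of c], of fls_mat] by (simp add: fls_mat_add fls_mat_mult fls_mat_transpose fls_mat_zero)
      moreover have "bform F' (B *v x) y + bform F' x (B *v y) = (\<Sum>i\<in>UNIV. x $ i * ((transpose B ** F' + F' ** B) *v y) $ i)"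
        for F' B :: "real fls ^ 'm option option ^ 'm option option"
      proof -
        have "(\<Sum>i\<in>UNIV. (B *v x) $ i * z $ i) = (\<Sum>i\<in>UNIV. x $ i * (transpose B *v z) $ i)" for z
        proof -
          have "(\<Sum>i\<in>UNIV. (B *v x) $ i * z $ i) = (\<Sum>i\<in>UNIV. \<Sum>j\<in>UNIV. B $ i $ j * x $ j * z $ i)"
            by (simp only: matrix_vector_mult_def vec_lambda_beta sum_distrib_right)
          also have "\<dots> = (\<Sum>j\<in>UNIV. \<Sum>i\<in>UNIV. B $ i $ j * x $ j * z $ i)" by (rule sum.swap)
          also have "\<dots> = (\<Sum>i\<in>UNIV. x $ i * (transpose B *v z) $ i)"
            by (simp only: matrix_vector_mult_def vec_lambda_beta sum_distrib_left transpose_def) (simp add: ac_simps)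
          finally show ?thesis .
        qed
        then show ?thesis
          by (simp only: bform_def mv_simps vector_add_component distrib_left sum.distrib)
      qed
      ultimately show ?thesis by simp
    qed
    show "fls_mat (a c) *v (fls_mat (a d) *v x) - fls_mat (a d) *v (fls_mat (a c) *v x) =
        fls_mat (const_mat W) $ c $ d *s (fls_mat Z *v x)" for c d x
    proof -
      have "fls_mat (a c) ** fls_mat (a d) - fls_mat (a d) ** fls_mat (a c) = smat (fls_mat (const_mat W) $ c $ d) (fls_mat Z)"
        using arg_cong[OF heis[of c d], of fls_mat]
        by (simp add: fls_mat_diff fls_mat_mult fls_mat_smat) (simp add: fls_mat_def)
      then have "(fls_mat (a c) ** fls_mat (a d) - fls_mat (a d) ** fls_mat (a c)) *v x =
         smat (fls_mat (const_mat W) $ c $ d) (fls_mat Z) *v x" by simp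
      then show ?thesis by (simp only: smat_vec mv_simps)
    qed
    show "bform (fls_mat F) (axis i0 1) (fls_mat Z *v axis i0 1) \<noteq> 0"
    proof -
      have "F ** Z = transpose (G 0) ** (Om ** (A 0 ** G 0))"
        by (simp only: F_def matrix_mul_assoc[symmetric] GZ)
      \<comment> \<open>\<open>G\<close> starts with the identity, so the leading coefficient of
        \<open>F ** Z\<close> is the one of \<open>Om ** A\<close>, to which \<open>A_top\<close>
        applies.\<close>
      moreover have "mcoeff s (transpose (G 0) ** (Om ** (A 0 ** G 0))) = mcoeff 0 Om ** mcoeff s (A 0)"
      proof -
        have 1: "mcoeff s (A 0 ** G 0) = mcoeff s (A 0)"
          by (subst mcoeff_mult_top') (simp_all add: A_low G0)
        have 2: "mcoeff s (Om ** (A 0 ** G 0)) = mcoeff 0 Om ** mcoeff s (A 0)"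
          by (subst mcoeff_mult_top) (simp_all add: 1 mcoeff_mult_low[OF A_low])
        have 3: "mcoeff 0 (transpose (G 0)) = mat 1"
          using G0[of 0] by (simp add: vec_eq_iff transpose_def mat_def)
        show ?thesis
          by (subst mcoeff_mult_top) (simp_all add: 2 3 mcoeff_mult_low[of s "A 0 ** G 0", OF mcoeff_mult_low(1)[OF A_low]])
      qed
      ultimately have "mcoeff s (F ** Z) $ i0 $ i0 \<noteq> 0" using A_top[of 0] by simp
      then have "(F ** Z) $ i0 $ i0 \<noteq> 0" by auto
      moreover have "bform (fls_mat F) (axis i0 1) (fls_mat Z *v axis i0 1) = fps_to_fls ((F ** Z) $ i0 $ i0)"
        using bmat[of "fls_mat F" "mat 1" i0 "fls_mat Z" i0]
        by (simp add: fls_mat_mult[symmetric]) (simp add: fls_mat_def)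
      ultimately show ?thesis by simp
    qed
  qed
  have minors_Z: "Z $ i $ j * Z $ k $ l = Z $ i $ l * Z $ k $ j" for i j k l
  proof -
    define \<kappa> where "\<kappa> = bform (fls_mat F) (axis i0 1) (fls_mat Z *v axis i0 1)"
    define e where "e = fls_mat Z *v axis i0 1"
    have "\<kappa> *s (fls_mat Z *v axis j 1) = bform (fls_mat F) (axis j 1) e *s e" for j
      unfolding \<kappa>_def e_def by (rule rep.rank_one)
    then have "\<kappa> * fls_mat Z $ i $ j = bform (fls_mat F) (axis j 1) e * e $ i" for i j
      by (metis matrix_vector_axis vector_smult_component)
    then have "(\<kappa> * fls_mat Z $ i $ j) * (\<kappa> * fls_mat Z $ k $ l) = (\<kappa> * fls_mat Z $ i $ l) * (\<kappa> * fls_mat Z $ k $ j)"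
      by (simp add: ac_simps)
    then have "\<kappa> * \<kappa> * (fls_mat Z $ i $ j * fls_mat Z $ k $ l) = \<kappa> * \<kappa> * (fls_mat Z $ i $ l * fls_mat Z $ k $ j)"
      by (simp add: ac_simps)
    moreover have "\<kappa> \<noteq> 0" unfolding \<kappa>_def by (rule rep.cyclic)
    ultimately have "fls_mat Z $ i $ j * fls_mat Z $ k $ l = fls_mat Z $ i $ l * fls_mat Z $ k $ j" by simp
    then show ?thesis by (simp add: fls_mat_def fls_times_fps_to_fls[symmetric])
  qed
  have minors_GZ: "(G x ** Z) $ i $ j * (G x ** Z) $ k $ l = (G x ** Z) $ i $ l * (G x ** Z) $ k $ j" for i j k l
  proof -
    have "(G x ** Z) $ i $ j * (G x ** Z) $ k $ l = (\<Sum>p\<in>UNIV. \<Sum>q\<in>UNIV. G x $ i $ p * G x $ k $ q * (Z $ p $ j * Z $ q $ l))" for j l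
      by (simp add: matrix_matrix_mult_def sum_product ac_simps)
    then show ?thesis by (simp only: minors_Z[of _ j _ l])
  qed
  define T where "T j l = A x $ i $ j * A x $ k $ l - A x $ i $ l * A x $ k $ j" for j l
  have TGG: "(\<Sum>j\<in>UNIV. (\<Sum>l\<in>UNIV. T j l * G x $ l $ d) * G x $ j $ b) = 0" for b d
  proof -
    have "(\<Sum>j\<in>UNIV. (\<Sum>l\<in>UNIV. T j l * G x $ l $ d) * G x $ j $ b) =
      (\<Sum>j\<in>UNIV. \<Sum>l\<in>UNIV. (A x $ i $ j * G x $ j $ b) * (A x $ k $ l * G x $ l $ d)) -
      (\<Sum>j\<in>UNIV. \<Sum>l\<in>UNIV. (A x $ k $ j * G x $ j $ b) * (A x $ i $ l * G x $ l $ d))"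
      unfolding T_def sum_subtractf[symmetric] sum_distrib_right by (simp add: algebra_simps)
    also have "\<dots> = (A x ** G x) $ i $ b * (A x ** G x) $ k $ d - (A x ** G x) $ k $ b * (A x ** G x) $ i $ d"
      by (simp add: matrix_matrix_mult_def sum_product)
    also have "\<dots> = 0"
      unfolding GZ[symmetric] using minors_GZ[of i b k d] by (simp add: ac_simps)
    finally show ?thesis .
  qed
  have "(\<Sum>l\<in>UNIV. T j l * G x $ l $ d) = 0" for j d
    by (rule unipotent_cancel_row[OF G0 TGG])
  then have "T j l = 0" by (rule unipotent_cancel_row[OF G0])
  then show ?thesis by (simp add: T_def)
qed

end

section \<open>Formal connections of Ricci type\<close>

lemma bform_axis_axis_mult: "bform W (A *v axis b 1) (axis t 1) = (\<Sum>k\<in>UNIV. A $ k $ b * W $ k $ t)"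
  by (simp only: bform_def matrix_vector_axis)

lemma smult_cancel: "k *s V = 0 \<Longrightarrow> k \<noteq> 0 \<Longrightarrow> V = 0" for k :: "'a::idom"
  by (simp add: vec_eq_iff)

lemma (in symplectic_space) nondegenerate_axis:
  assumes "\<And>t. w (axis t 1) Y = w (axis t 1) Y'" shows "Y = Y'"
proof -
  have "W *v Y = W *v Y'" using assms by (simp add: bform_axis_left vec_eq_iff)
  then have "Wi *v (W *v Y) = Wi *v (W *v Y')" by simp
  then show ?thesis by (simp add: matrix_vector_mul_assoc inverse)
qed

text \<open>Row \<open>a\<close> and column \<open>b\<close> of \<open>\<Gamma> c x\<close> hold the
  Christoffel symbol with upper index \<open>a\<close> and lower indices \<open>c\<close>,
  \<open>b\<close>. Thus \<open>\<Gamma>_sym\<close> is absence of torsion and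
  \<open>\<Gamma>_sp\<close> says that omega is parallel.\<close>

locale formal_ricci_type_connection = symplectic_torus W Wi for W Wi :: "real ^ 'm ^ 'm" +
  fixes \<Gamma> :: "'m \<Rightarrow> real ^ 'm \<Rightarrow> real fps ^ 'm ^ 'm" and n :: nat
  assumes n: "n \<ge> 2" "CARD('m) = 2 * n"
    and torus_\<Gamma>: "\<And>c. torus_mat (\<Gamma> c)"
    and \<Gamma>_low: "\<And>c x a b k. k < 5 \<Longrightarrow> fps_nth (\<Gamma> c x $ a $ b) k = 0"
    and \<Gamma>_sym: "\<And>c x a b. \<Gamma> c x $ a $ b = \<Gamma> b x $ a $ c"
    and \<Gamma>_sp: "\<And>c x. transpose (\<Gamma> c x) ** const_mat W + const_mat W ** \<Gamma> c x = 0"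
begin

definition \<kappa> :: "real fps" where "\<kappa> = fps_const (- 1 / (2 * (real n + 1)))"

definition Rm where "Rm c d x = md c (\<Gamma> d) x - md d (\<Gamma> c) x + (\<Gamma> c x ** \<Gamma> d x - \<Gamma> d x ** \<Gamma> c x)"

definition ric where "ric x = (\<chi> a b. \<Sum>k\<in>UNIV. Rm a k x $ k $ b)"

definition ricci_type where "ricci_type \<longleftrightarrow> (\<forall>c d b t x. (\<Sum>k\<in>UNIV. Rm c d x $ k $ b * fps_const (W $ k $ t)) =
   \<kappa> * (2 * fps_const (W $ c $ d) * ric x $ b $ t + fps_const (W $ c $ b) * ric x $ d $ t
    + fps_const (W $ c $ t) * ric x $ d $ b - fps_const (W $ d $ b) * ric x $ c $ t - fps_const (W $ d $ t) * ric x $ c $ b))"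

abbreviation CW where "CW \<equiv> const_mat W"

sublocale c: symplectic_space CW "const_mat Wi"
  by (rule symplectic_space_const_mat) unfold_locales

abbreviation om where "om \<equiv> bform CW"

lemma of_nat_nonzero: "k > 0 \<Longrightarrow> (of_nat k :: real fps) \<noteq> 0"
  by simp

lemma \<Gamma>_comm: "\<Gamma> c x *v axis d 1 = \<Gamma> d x *v axis c 1"
  by (simp add: vec_eq_iff matrix_vector_axis \<Gamma>_sym[of c _ _ d])

lemma sp_matrix_iff: "c.sp A \<longleftrightarrow> transpose A ** CW + CW ** A = 0"
proof
  assume "c.sp A"
  have 1: "(transpose A ** CW) $ a $ b = om (A *v axis a 1) (axis b 1)" for a b
    by (simp add: bform_axis_axis_mult matrix_matrix_mult_def transpose_def)
  have 2: "(CW ** A) $ a $ b = om (axis a 1) (A *v axis b 1)" for a b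
    by (simp only: bform_axis_left matrix_vector_mul_assoc matrix_vector_axis)
  show "transpose A ** CW + CW ** A = 0"
    using \<open>c.sp A\<close> by (simp add: vec_eq_iff 1 2 c.sp_def)
next
  assume 0: "transpose A ** CW + CW ** A = 0"
  have "om (A *v X) Y + om X (A *v Y) = (\<Sum>i\<in>UNIV. X $ i * ((transpose A ** CW + CW ** A) *v Y) $ i)" for X Y
  proof -
    have "(\<Sum>i\<in>UNIV. (A *v X) $ i * Z $ i) = (\<Sum>i\<in>UNIV. X $ i * (transpose A *v Z) $ i)" for Z
    proof -
      have "(\<Sum>i\<in>UNIV. (A *v X) $ i * Z $ i) = (\<Sum>i\<in>UNIV. \<Sum>j\<in>UNIV. A $ i $ j * X $ j * Z $ i)"
        by (simp only: matrix_vector_mult_def vec_lambda_beta sum_distrib_right)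
      also have "\<dots> = (\<Sum>j\<in>UNIV. \<Sum>i\<in>UNIV. A $ i $ j * X $ j * Z $ i)" by (rule sum.swap)
      also have "\<dots> = (\<Sum>i\<in>UNIV. X $ i * (transpose A *v Z) $ i)"
        by (simp only: matrix_vector_mult_def vec_lambda_beta sum_distrib_left transpose_def) (simp add: ac_simps)
      finally show ?thesis .
    qed
    then show ?thesis
      by (simp only: bform_def mv_simps vector_add_component distrib_left sum.distrib)
  qed
  then show "c.sp A" unfolding c.sp_def 0 by simp
qed

lemma sp_\<Gamma>: "c.sp (\<Gamma> c x)"
  unfolding sp_matrix_iff by (rule \<Gamma>_sp)

lemma torus_Rm: "torus_mat (Rm c d)"
  unfolding Rm_def[abs_def] by (intro torus_mat_intros torus_\<Gamma>)

lemma sp_Rm: "c.sp (Rm c d x)"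
proof -
  have md: "c.sp (md c (\<Gamma> d) x)" for c d
  proof -
    have "md c (\<lambda>x. transpose (\<Gamma> d x) ** CW + CW ** \<Gamma> d x) x = 0"
      unfolding \<Gamma>_sp by simp
    then show ?thesis
      unfolding sp_matrix_iff by (simp add: md_add md_mult md_transpose torus_mat_intros torus_\<Gamma>)
  qed
  have "om (Rm c d x *v X) Y + om X (Rm c d x *v Y) = 0" for X Y
    using c.sp_move[OF md, of c d X Y] c.sp_move[OF md, of d c X Y]
    by (simp add: Rm_def mv_simps bform_simps c.sp_move[OF sp_\<Gamma>])
  then show ?thesis by (simp add: c.sp_def)
qed

text \<open>Second Bianchi identity. Only the matrix indices receive Christoffel terms; those for
  the two form indices would cancel in the cyclic sum.\<close>

lemma bianchi:
  "(md e (Rm c d) x + (\<Gamma> e x ** Rm c d x - Rm c d x ** \<Gamma> e x))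
   + (md c (Rm d e) x + (\<Gamma> c x ** Rm d e x - Rm d e x ** \<Gamma> c x))
   + (md d (Rm e c) x + (\<Gamma> d x ** Rm e c x - Rm e c x ** \<Gamma> d x)) = 0"
proof -
  have 1: "md e (Rm c d) x = md e (md c (\<Gamma> d)) x - md e (md d (\<Gamma> c)) x +
     ((md e (\<Gamma> c) x ** \<Gamma> d x + \<Gamma> c x ** md e (\<Gamma> d) x) - (md e (\<Gamma> d) x ** \<Gamma> c x + \<Gamma> d x ** md e (\<Gamma> c) x))" for c d e
    unfolding Rm_def[abs_def] by (simp add: md_add md_diff md_mult torus_mat_intros torus_\<Gamma>)
  show ?thesis
    unfolding 1 unfolding Rm_def md_commute[OF torus_\<Gamma>, of c e] md_commute[OF torus_\<Gamma>, of d e] md_commute[OF torus_\<Gamma>, of d c]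
    by (simp add: matrix_sub_ldistrib matrix_sub_rdistrib matrix_add_ldistrib matrix_add_rdistrib matrix_mul_assoc)
qed

text \<open>The Ricci part of the curvature as an endomorphism applied to \<open>Z\<close>, up to
  the factor \<open>\<kappa>\<close>, with \<open>M\<close> in the place of the Ricci
  endomorphism.\<close>

definition Ef where "Ef M X Y Z = (- 2 * om X Y) *s (M *v Z) - om X Z *s (M *v Y) + om Y (M *v Z) *s X
   + om Y Z *s (M *v X) - om X (M *v Z) *s Y"

definition \<rho> where "\<rho> x = const_mat Wi ** ric x"

end

text \<open>A separate locale, since the assumption is phrased in terms of \<open>Rm\<close> and
  \<open>ric\<close> from the preceding one.\<close>

locale formal_ricci_type = formal_ricci_type_connection W Wi \<Gamma> n
  for W Wi :: "real ^ 'm ^ 'm" and \<Gamma> and n +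
  assumes ricci: ricci_type
begin

lemma om_\<rho>: "om (axis a 1) (\<rho> x *v axis b 1) = ric x $ a $ b"
  unfolding bform_axis_left \<rho>_def matrix_vector_mul_assoc matrix_mul_assoc c.inverse
  by (simp add: matrix_vector_axis)

lemma Rm_lower: "om (Rm c d x *v axis b 1) (axis t 1) =
   \<kappa> * (2 * om (axis c 1) (axis d 1) * ric x $ b $ t + om (axis c 1) (axis b 1) * ric x $ d $ t
    + om (axis c 1) (axis t 1) * ric x $ d $ b - om (axis d 1) (axis b 1) * ric x $ c $ t - om (axis d 1) (axis t 1) * ric x $ c $ b)"
  using ricci unfolding ricci_type_def bform_axis_axis_mult bform_axis const_mat_nth by blast

text \<open>As the connection preserves omega, the lowered curvature is symmetric in its last two
  indices. In the Ricci type formula the remaining four terms form symmetric pairs, so the term with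
  the factor \<open>2 * om (axis c 1) (axis d 1)\<close> has to be symmetric too.\<close>

lemma ric_sym: "ric x $ a $ b = ric x $ b $ a"
proof -
  obtain c d where cd: "W $ c $ d \<noteq> 0" by (rule W_nonzero)
  have "om (Rm c d x *v axis a 1) (axis b 1) = om (Rm c d x *v axis b 1) (axis a 1)"
    by (rule c.sp_swap[OF sp_Rm])
  then have "\<kappa> * (2 * (fps_const (W $ c $ d) * (ric x $ a $ b - ric x $ b $ a))) = 0"
    unfolding Rm_lower by (simp add: algebra_simps bform_axis)
  moreover have "\<kappa> \<noteq> 0" by (simp add: \<kappa>_def)
  moreover have "fps_const (W $ c $ d) \<noteq> 0" using cd by simp
  ultimately show ?thesis by simp
qed

lemma sp_\<rho>: "c.sp (\<rho> x)"
proof -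
  have CW\<rho>: "CW ** \<rho> x = ric x"
    unfolding \<rho>_def matrix_mul_assoc c.inverse by simp
  have "transpose (CW ** \<rho> x) = CW ** \<rho> x"
    unfolding CW\<rho> by (simp add: vec_eq_iff transpose_def ric_sym[of x])
  then show ?thesis
    unfolding sp_matrix_iff by (simp add: matrix_transpose_mul c.antisym c.mm_neg eq_neg_iff_add_eq_0)
      (metis add.commute add.right_inverse minus_minus)
qed

lemma Rm_eq: "Rm c d x *v Z = \<kappa> *s Ef (\<rho> x) (axis c 1) (axis d 1) Z"
proof -
  have b: "Rm c d x *v axis b 1 = \<kappa> *s Ef (\<rho> x) (axis c 1) (axis d 1) (axis b 1)" for b
  proof (rule c.nondegenerate_axis)
    fix t
    show "om (axis t 1) (Rm c d x *v axis b 1) = om (axis t 1) (\<kappa> *s Ef (\<rho> x) (axis c 1) (axis d 1) (axis b 1))"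
      unfolding c.w_antisym[of "axis t 1" "Rm c d x *v axis b 1"] Rm_lower
      by (simp add: Ef_def bform_simps om_\<rho> ric_sym[of x t] c.w_antisym[of "axis t 1"] algebra_simps)
  qed
  show ?thesis
    by (rule linear_map_eqI[of "\<lambda>Z. Rm c d x *v Z" "\<lambda>Z. \<kappa> *s Ef (\<rho> x) (axis c 1) (axis d 1) Z", OF _ _ b])
      (auto simp: linear_map_def Ef_def mv_simps bform_simps vec_eq_iff algebra_simps)
qed

lemma torus_ric: "torus_mat ric"
  unfolding torus_mat_def ric_def by (auto intro!: torus_fps_intros torus_matD[OF torus_Rm])

lemma torus_\<rho>: "torus_mat \<rho>"
  unfolding \<rho>_def[abs_def] by (intro torus_mat_intros torus_ric)

text \<open>Covariant derivative of the Ricci endomorphism.\<close>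

definition N where "N c x = md c \<rho> x + (\<Gamma> c x ** \<rho> x - \<rho> x ** \<Gamma> c x)"

lemma N_vec: "N c x *v Z = md c \<rho> x *v Z + \<Gamma> c x *v (\<rho> x *v Z) - \<rho> x *v (\<Gamma> c x *v Z)"
  by (simp add: N_def mv_simps)

lemma sp_md: assumes "torus_mat A" "\<And>x. c.sp (A x)" shows "c.sp (md c A x)"
proof -
  have "md c (\<lambda>x. transpose (A x) ** CW + CW ** A x) x = 0"
    using assms(2) unfolding sp_matrix_iff by simp
  then show ?thesis
    unfolding sp_matrix_iff by (simp add: md_add md_mult md_transpose torus_mat_intros assms(1))
qed

lemma sp_N: "c.sp (N c x)"
  using sp_md[OF torus_\<rho> sp_\<rho>, of c x]
  by (simp add: c.sp_def N_vec bform_simps c.sp_move[OF sp_md[OF torus_\<rho> sp_\<rho>]] c.sp_move[OF sp_\<rho>] c.sp_move[OF sp_\<Gamma>])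

lemma md_Rm: "md e (Rm c d) x *v Z = \<kappa> *s Ef (md e \<rho> x) (axis c 1) (axis d 1) Z"
proof -
  have comp: "Rm c d x $ a $ b = \<kappa> * (- 2 * om (axis c 1) (axis d 1) * \<rho> x $ a $ b - om (axis c 1) (axis b 1) * \<rho> x $ a $ d
     + om (axis d 1) (\<rho> x *v axis b 1) * axis c 1 $ a + om (axis d 1) (axis b 1) * \<rho> x $ a $ c
     - om (axis c 1) (\<rho> x *v axis b 1) * axis d 1 $ a)" for a b x
    using arg_cong[OF Rm_eq[of c d x "axis b 1"], of "\<lambda>v. v $ a"]
    by (simp add: Ef_def matrix_vector_axis algebra_simps)
  have om_r: "om (axis a 1) (B *v axis b 1) = (\<Sum>k\<in>UNIV. CW $ a $ k * B $ k $ b)" for B :: "real fps ^ 'm ^ 'm" and a b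
    unfolding bform_axis_left matrix_vector_mul_assoc matrix_vector_axis by (simp add: matrix_matrix_mult_def)
  have t: "torus_fps (\<lambda>x. \<rho> x $ a $ b)" for a b by (rule torus_matD[OF torus_\<rho>])
  have "md e (Rm c d) x $ a $ b = \<kappa> * (- 2 * om (axis c 1) (axis d 1) * md e \<rho> x $ a $ b - om (axis c 1) (axis b 1) * md e \<rho> x $ a $ d
     + om (axis d 1) (md e \<rho> x *v axis b 1) * axis c 1 $ a + om (axis d 1) (axis b 1) * md e \<rho> x $ a $ c
     - om (axis c 1) (md e \<rho> x *v axis b 1) * axis d 1 $ a)" for a b
    unfolding md_nth comp om_r
    by (simp add: fd_mult fd_add fd_diff fd_uminus fd_sum fd_cmult torus_fps_intros t)
  then have "md e (Rm c d) x *v axis b 1 = \<kappa> *s Ef (md e \<rho> x) (axis c 1) (axis d 1) (axis b 1)" for b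
    by (simp add: vec_eq_iff Ef_def matrix_vector_axis algebra_simps)
  note b = this
  show ?thesis
    by (rule linear_map_eqI[of "\<lambda>Z. md e (Rm c d) x *v Z" "\<lambda>Z. \<kappa> *s Ef (md e \<rho> x) (axis c 1) (axis d 1) Z", OF _ _ b])
      (auto simp: linear_map_def Ef_def mv_simps bform_simps vec_eq_iff algebra_simps)
qed

text \<open>\<open>Ef\<close> is built from omega and evaluation alone, so a symplectic matrix acts
  on it as a derivation.\<close>

lemma Ef_equivariant:
  assumes A: "c.sp A"
  shows "A *v Ef M X Y Z - Ef M X Y (A *v Z) = Ef (A ** M - M ** A) X Y Z + Ef M (A *v X) Y Z + Ef M X (A *v Y) Z"
proof -
  have m: "om X (A *v Y) = - om (A *v X) Y" for X Y using c.sp_move[OF A, of X Y] by simp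
  show ?thesis
    unfolding Ef_def
    by (simp add: mv_simps bform_simps m) (simp add: vec_eq_iff algebra_simps)
qed

lemma Ef_swap: "Ef M X Y Z = - Ef M Y X Z"
  using c.w_antisym[of X Y] by (simp add: Ef_def vec_eq_iff algebra_simps)

lemma Ef_add: "Ef (M + M') X Y Z = Ef M X Y Z + Ef M' X Y Z"
  and Ef_diff: "Ef (M - M') X Y Z = Ef M X Y Z - Ef M' X Y Z"
  by (simp_all add: Ef_def mv_simps bform_simps vec_eq_iff algebra_simps)

text \<open>The Bianchi identity for a curvature of the form \<open>\<kappa> *s Ef\<close>. By
  equivariance the covariant derivative falls on \<open>\<rho>\<close>; the terms in which
  \<open>\<Gamma>\<close> acts on a form index cancel in pairs, \<open>\<Gamma>\<close> being
  symmetric and \<open>Ef\<close> antisymmetric in these indices.\<close>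

lemma cyclic_N: "Ef (N e x) (axis c 1) (axis d 1) Z + Ef (N c x) (axis d 1) (axis e 1) Z + Ef (N d x) (axis e 1) (axis c 1) Z = 0"
proof -
  have 1: "(md e (Rm c d) x + (\<Gamma> e x ** Rm c d x - Rm c d x ** \<Gamma> e x)) *v Z =
    \<kappa> *s (Ef (N e x) (axis c 1) (axis d 1) Z + Ef (\<rho> x) (\<Gamma> e x *v axis c 1) (axis d 1) Z
     + Ef (\<rho> x) (axis c 1) (\<Gamma> e x *v axis d 1) Z)" for e c d
  proof -
    have "(md e (Rm c d) x + (\<Gamma> e x ** Rm c d x - Rm c d x ** \<Gamma> e x)) *v Z =
      \<kappa> *s (Ef (md e \<rho> x) (axis c 1) (axis d 1) Z + (\<Gamma> e x *v Ef (\<rho> x) (axis c 1) (axis d 1) Z - Ef (\<rho> x) (axis c 1) (axis d 1) (\<Gamma> e x *v Z)))"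
      by (simp add: mv_simps md_Rm Rm_eq vector_ssub_ldistrib vector_add_ldistrib)
    also have "\<dots> = \<kappa> *s (Ef (N e x) (axis c 1) (axis d 1) Z + Ef (\<rho> x) (\<Gamma> e x *v axis c 1) (axis d 1) Z
     + Ef (\<rho> x) (axis c 1) (\<Gamma> e x *v axis d 1) Z)"
      unfolding Ef_equivariant[OF sp_\<Gamma>] N_def Ef_add by (simp add: add.assoc)
    finally show ?thesis .
  qed
  have "0 = \<kappa> *s (Ef (N e x) (axis c 1) (axis d 1) Z + Ef (N c x) (axis d 1) (axis e 1) Z + Ef (N d x) (axis e 1) (axis c 1) Z)"
    using arg_cong[OF bianchi[of e c d x], of "\<lambda>M. M *v Z"]
    unfolding matrix_vector_mult_add_rdistrib[of "_ + _" "md d (Rm e c) x + _"]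
      matrix_vector_mult_add_rdistrib[of "md e (Rm c d) x + _" "md c (Rm d e) x + _"] 1
    using Ef_swap[of "\<rho> x" "\<Gamma> e x *v axis c 1" "axis d 1" Z] Ef_swap[of "\<rho> x" "\<Gamma> c x *v axis d 1" "axis e 1" Z]
      Ef_swap[of "\<rho> x" "\<Gamma> d x *v axis e 1" "axis c 1" Z]
    by (simp add: \<Gamma>_comm[of c x e] \<Gamma>_comm[of d x c] \<Gamma>_comm[of e x d] vec_eq_iff algebra_simps)
  moreover have "\<kappa> \<noteq> 0" by (simp add: \<kappa>_def)
  ultimately show ?thesis by (metis smult_cancel)
qed

end

section \<open>Prolongation: the derivatives of the Ricci endomorphism and of
  \<open>u\<close>\<close>

lemma basis_contract_right_id: "(\<Sum>k\<in>UNIV. bform W X (axis k 1) * v $ k) = bform W X v"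
  and basis_contract_left_id: "(\<Sum>k\<in>UNIV. bform W (axis k 1) X * v $ k) = bform W v X"
  using basis_contract_right[of W X "mat 1" v] basis_contract_left[of W "mat 1" X v] by simp_all

lemma axis_sum': "(\<Sum>k\<in>UNIV. g k * axis b 1 $ k) = (g b :: 'a::comm_ring_1)"
  by (simp add: axis_def if_distrib if_distribR cong: if_cong)

lemma axis_trace: "(\<Sum>k\<in>UNIV. axis (k::'m::finite) (1::'a::comm_ring_1) $ k) = of_nat CARD('m)"
  by (simp add: axis_def)

context formal_ricci_type
begin

text \<open>Divergence of the Ricci endomorphism.\<close>

definition v :: "real ^ 'm \<Rightarrow> real fps ^ 'm" where "v x = (\<chi> k. \<Sum>d\<in>UNIV. N d x $ d $ k)"

text \<open>Trace of \<open>cyclic_N\<close> over \<open>d\<close> and the output component. It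
  expresses the part of \<open>N\<close> antisymmetric in \<open>c\<close> and \<open>e\<close>
  through the divergence.\<close>

lemma N_trace_eq:
  "of_nat (2 * n + 1) * (om (axis c 1) (N e x *v Z) - om (axis e 1) (N c x *v Z)) =
   - 2 * om (axis e 1) (axis c 1) * (\<Sum>k\<in>UNIV. v x $ k * Z $ k) - om (axis e 1) Z * v x $ c + om (axis c 1) Z * v x $ e"
proof -
  have vZ: "(\<Sum>d\<in>UNIV. (N d x *v Z) $ d) = (\<Sum>k\<in>UNIV. v x $ k * Z $ k)"
  proof -
    have "(\<Sum>d\<in>UNIV. (N d x *v Z) $ d) = (\<Sum>d\<in>UNIV. \<Sum>k\<in>UNIV. N d x $ d $ k * Z $ k)"
      by (simp add: matrix_vector_mult_def)
    also have "\<dots> = (\<Sum>k\<in>UNIV. \<Sum>d\<in>UNIV. N d x $ d $ k * Z $ k)" by (rule sum.swap)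
    finally show ?thesis by (simp add: v_def sum_distrib_right)
  qed
  have va: "(\<Sum>d\<in>UNIV. (N d x *v axis c 1) $ d) = v x $ c" for c
    by (simp add: v_def matrix_vector_axis)
  have 1: "(\<Sum>d\<in>UNIV. Ef (N e x) (axis c 1) (axis d 1) Z $ d) =
     - 2 * (\<Sum>d\<in>UNIV. om (axis c 1) (axis d 1) * (N e x *v Z) $ d) - om (axis c 1) Z * (\<Sum>d\<in>UNIV. (N e x *v axis d 1) $ d)
     + (\<Sum>d\<in>UNIV. om (axis d 1) (N e x *v Z) * axis c 1 $ d) + (\<Sum>d\<in>UNIV. om (axis d 1) Z * (N e x *v axis c 1) $ d)
     - om (axis c 1) (N e x *v Z) * (\<Sum>d\<in>UNIV. axis (d::'m) 1 $ d)"
    by (simp only: Ef_def sum.distrib sum_subtractf sum_distrib_left mult.assoc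
         vector_add_component vector_minus_component vector_smult_component)
  have 2: "(\<Sum>d\<in>UNIV. Ef (N c x) (axis d 1) (axis e 1) Z $ d) =
     - 2 * (\<Sum>d\<in>UNIV. om (axis d 1) (axis e 1) * (N c x *v Z) $ d) - (\<Sum>d\<in>UNIV. om (axis d 1) Z * (N c x *v axis e 1) $ d)
     + om (axis e 1) (N c x *v Z) * (\<Sum>d\<in>UNIV. axis (d::'m) 1 $ d) + om (axis e 1) Z * (\<Sum>d\<in>UNIV. (N c x *v axis d 1) $ d)
     - (\<Sum>d\<in>UNIV. om (axis d 1) (N c x *v Z) * axis e 1 $ d)"
    by (simp only: Ef_def sum.distrib sum_subtractf sum_distrib_left mult.assoc
         vector_add_component vector_minus_component vector_smult_component)
  have 3: "(\<Sum>d\<in>UNIV. Ef (N d x) (axis e 1) (axis c 1) Z $ d) =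
     - 2 * om (axis e 1) (axis c 1) * (\<Sum>d\<in>UNIV. (N d x *v Z) $ d) - om (axis e 1) Z * (\<Sum>d\<in>UNIV. (N d x *v axis c 1) $ d)
     + (\<Sum>d\<in>UNIV. om (axis c 1) (N d x *v Z) * axis e 1 $ d) + om (axis c 1) Z * (\<Sum>d\<in>UNIV. (N d x *v axis e 1) $ d)
     - (\<Sum>d\<in>UNIV. om (axis e 1) (N d x *v Z) * axis c 1 $ d)"
    by (simp only: Ef_def sum.distrib sum_subtractf sum_distrib_left mult.assoc
         vector_add_component vector_minus_component vector_smult_component)
  have "0 = (\<Sum>d\<in>UNIV. (Ef (N e x) (axis c 1) (axis d 1) Z + Ef (N c x) (axis d 1) (axis e 1) Z + Ef (N d x) (axis e 1) (axis c 1) Z) $ d)"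
    unfolding cyclic_N by simp
  also have "\<dots> = (\<Sum>d\<in>UNIV. Ef (N e x) (axis c 1) (axis d 1) Z $ d) + (\<Sum>d\<in>UNIV. Ef (N c x) (axis d 1) (axis e 1) Z $ d)
     + (\<Sum>d\<in>UNIV. Ef (N d x) (axis e 1) (axis c 1) Z $ d)"
    by (simp add: sum.distrib)
  finally show ?thesis
    unfolding 1 2 3 basis_contract_right_id basis_contract_left_id axis_sum' vZ va trace_basis axis_trace n(2) c.sp_trace[OF sp_N]
    using c.w_antisym[of "N c x *v Z" "axis e 1"] c.sp_move[OF sp_N, of e x "axis c 1" Z] c.sp_move[OF sp_N, of c x "axis e 1" Z]
    by (simp add: algebra_simps)
qed

text \<open>The vector dual to the divergence, scaled so that \<open>C\<close> has the antisymmetric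
  part prescribed by \<open>N_trace_eq\<close>.\<close>

definition u :: "real ^ 'm \<Rightarrow> real fps ^ 'm" where
  "u x = fps_const (- 1 / (2 * real n + 1)) *s (const_mat Wi *v v x)"

lemma om_u: "of_nat (2 * n + 1) * om X (u x) = - (\<Sum>k\<in>UNIV. v x $ k * X $ k)"
proof -
  have "om X (const_mat Wi *v v x) = (\<Sum>k\<in>UNIV. v x $ k * X $ k)"
    by (simp add: bform_def matrix_vector_mul_assoc c.inverse mult.commute)
  moreover have "of_nat (2 * n + 1) * fps_const (- 1 / (2 * real n + 1)) = - 1"
    by (simp add: fps_of_nat[symmetric] fps_eq_iff)
  ultimately show ?thesis
    by (simp add: u_def bform_simps mult.assoc[symmetric] del: of_nat_add of_nat_mult)
qed

text \<open>The symmetric product of \<open>u\<close> and \<open>axis c 1\<close>, regarded as a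
  symplectic matrix; the candidate for \<open>N\<close>.\<close>

definition C :: "'m \<Rightarrow> real ^ 'm \<Rightarrow> real fps ^ 'm ^ 'm" where
  "C c x = (\<chi> i j. om (axis c 1) (axis j 1) * u x $ i + om (u x) (axis j 1) * axis c 1 $ i)"

lemma C_vec: "C c x *v Z = om (axis c 1) Z *s u x + om (u x) Z *s axis c 1"
proof -
  have "(C c x *v Z) $ i = (\<Sum>j\<in>UNIV. om (axis c 1) (axis j 1) * Z $ j) * u x $ i + (\<Sum>j\<in>UNIV. om (u x) (axis j 1) * Z $ j) * axis c 1 $ i" for i
    unfolding C_def matrix_vector_mult_def vec_lambda_beta distrib_right sum.distrib sum_distrib_right by (simp add: ac_simps)
  then show ?thesis unfolding basis_contract_right_id by (simp add: vec_eq_iff)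
qed

lemma sp_C: "c.sp (C c x)"
  using c.w_antisym[of _ "u x"] c.w_antisym[of _ "axis c 1"] by (simp add: c.sp_def C_vec bform_simps)

lemma cyclic_C: "Ef (C e x) (axis c 1) (axis d 1) Z + Ef (C c x) (axis d 1) (axis e 1) Z + Ef (C d x) (axis e 1) (axis c 1) Z = 0"
  using c.w_antisym[of "axis d 1" "axis c 1"] c.w_antisym[of "axis d 1" "axis e 1"] c.w_antisym[of "axis e 1" "axis c 1"]
   c.w_antisym[of _ "u x"]
  by (simp add: Ef_def C_vec bform_simps mv_simps vec_eq_iff)

text \<open>The difference \<open>D\<close> satisfies the same cyclic identity as \<open>N\<close>
  and \<open>C\<close>, and by the choice of \<open>u\<close> it becomes totally symmetric once its
  index is lowered. For such a tensor the cyclic identity reduces to the vanishing of its wedge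
  product with omega.\<close>

lemma N_eq: "N c x = C c x"
proof -
  define D where "D c = N c x - C c x" for c
  have spD: "c.sp (D c)" for c
    using c.sp_move[OF sp_N] c.sp_move[OF sp_C] by (simp add: D_def c.sp_def mv_simps bform_simps)
  have cyc: "Ef (D e) (axis c 1) (axis d 1) Z + Ef (D c) (axis d 1) (axis e 1) Z + Ef (D d) (axis e 1) (axis c 1) Z = 0" for c d e Z
  proof -
    have "(p - p') + (q - q') + (r - r') = (p + q + r) - (p' + q' + r')" for p p' q q' r r' :: "real fps ^ 'm"
      by simp
    then show ?thesis unfolding D_def Ef_diff by (simp only: cyclic_N cyclic_C diff_self)
  qed
  have l: "om (axis c 1) (D e *v Z) = om (axis e 1) (D c *v Z)" for c e Z
  proof -
    have "of_nat (2 * n + 1) * (om (axis c 1) (C e x *v Z) - om (axis e 1) (C c x *v Z)) =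
      om (axis e 1) Z * (of_nat (2 * n + 1) * om (axis c 1) (u x)) - om (axis c 1) Z * (of_nat (2 * n + 1) * om (axis e 1) (u x))
      + 2 * om (axis e 1) (axis c 1) * (of_nat (2 * n + 1) * om Z (u x))"
      unfolding C_vec bform_simps using c.w_antisym[of "u x" Z] c.w_antisym[of "axis c 1" "axis e 1"]
      by (simp add: algebra_simps)
    also have "\<dots> = of_nat (2 * n + 1) * (om (axis c 1) (N e x *v Z) - om (axis e 1) (N c x *v Z))"
      unfolding om_u N_trace_eq axis_sum' by (simp add: algebra_simps)
    finally have "of_nat (2 * n + 1) * (om (axis c 1) (D e *v Z) - om (axis e 1) (D c *v Z)) = 0"
      by (simp add: D_def mv_simps bform_simps algebra_simps)
    moreover have "of_nat (2 * n + 1) \<noteq> (0 :: real fps)" by (rule of_nat_nonzero) simp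
    ultimately show ?thesis by (metis mult_eq_0_iff eq_iff_diff_eq_0)
  qed
  have s: "D e *v axis c 1 = D c *v axis e 1" for c e
  proof (rule c.nondegenerate_axis)
    fix t
    show "om (axis t 1) (D e *v axis c 1) = om (axis t 1) (D c *v axis e 1)"
      using l[of c e "axis t 1"] c.sp_right[OF spD, of "axis t 1" e "axis c 1"] c.sp_right[OF spD, of "axis t 1" c "axis e 1"] by simp
  qed
  have "(D e *v Z) $ i = 0" for e Z i
  proof (rule c.wedge_omega_zero[where y="\<lambda>e. (D e *v Z) $ i"])
    show "CARD('m) > 2" by (rule dim)
    fix c d e
    have "- 2 * (CW $ c $ d * (D e *v Z) $ i + CW $ d $ e * (D c *v Z) $ i + CW $ e $ c * (D d *v Z) $ i) =
       (Ef (D e) (axis c 1) (axis d 1) Z + Ef (D c) (axis d 1) (axis e 1) Z + Ef (D d) (axis e 1) (axis c 1) Z) $ i"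
      using l[of c e Z] l[of c d Z] l[of d e Z] s[of c e] s[of c d] s[of d e]
      by (simp add: Ef_def bform_axis algebra_simps)
    then show "CW $ c $ d * (D e *v Z) $ i + CW $ d $ e * (D c *v Z) $ i + CW $ e $ c * (D d *v Z) $ i = 0"
      unfolding cyc zero_index mult_eq_0_iff by simp
  qed
  then have "D c *v Z = 0" for c Z by (simp add: vec_eq_iff)
  then have "D c = 0" for c by (simp add: matrix_eq)
  then show ?thesis by (simp add: D_def)
qed

lemma torus_N: "torus_mat (N c)"
  unfolding N_def[abs_def] by (intro torus_mat_intros torus_\<rho> torus_\<Gamma>)

lemma torus_u: "torus_fps (\<lambda>x. u x $ i)"
  unfolding u_def v_def matrix_vector_mult_def
  by (simp, intro torus_fps_intros torus_matD[OF torus_N])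

definition ud :: "'m \<Rightarrow> real ^ 'm \<Rightarrow> real fps ^ 'm" where "ud e x = (\<chi> i. fd e (\<lambda>x. u x $ i) x)"

lemma md_N: "md e (N c) x *v Z = om (axis c 1) Z *s ud e x + om (ud e x) Z *s axis c 1"
proof -
  have NC: "N c = C c" by (rule ext) (rule N_eq)
  have om_l: "om X (axis j 1) = (\<Sum>a\<in>UNIV. CW $ a $ j * X $ a)" for X j
    by (simp add: bform_def matrix_vector_axis mult.commute)
  have m: "md e (N c) x $ i $ j = om (axis c 1) (axis j 1) * ud e x $ i + om (ud e x) (axis j 1) * axis c 1 $ i" for i j
    unfolding NC C_def om_l[of "u _"] om_l[of "ud _ _"]
    by (simp add: fd_mult fd_add fd_sum fd_cmult torus_fps_intros torus_u ud_def)
  have "(md e (N c) x *v Z) $ i = (\<Sum>j\<in>UNIV. om (axis c 1) (axis j 1) * Z $ j) * ud e x $ i + (\<Sum>j\<in>UNIV. om (ud e x) (axis j 1) * Z $ j) * axis c 1 $ i" for i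
    unfolding matrix_vector_mult_def vec_lambda_beta m distrib_right sum.distrib sum_distrib_right by (simp add: ac_simps)
  then show ?thesis unfolding basis_contract_right_id by (simp add: vec_eq_iff)
qed

lemma ricci_identity:
  "(md e (N c) x + (\<Gamma> e x ** N c x - N c x ** \<Gamma> e x)) - (md c (N e) x + (\<Gamma> c x ** N e x - N e x ** \<Gamma> c x))
    = Rm e c x ** \<rho> x - \<rho> x ** Rm e c x"
proof -
  have "md e (N c) x = md e (md c \<rho>) x + ((md e (\<Gamma> c) x ** \<rho> x + \<Gamma> c x ** md e \<rho> x) - (md e \<rho> x ** \<Gamma> c x + \<rho> x ** md e (\<Gamma> c) x))" for e c
    unfolding N_def[abs_def] by (simp add: md_add md_diff md_mult torus_mat_intros torus_\<Gamma> torus_\<rho>)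
  then show ?thesis
    unfolding N_def Rm_def
    by (simp add: md_commute[OF torus_\<rho>, of e c] matrix_sub_ldistrib matrix_sub_rdistrib matrix_add_ldistrib matrix_add_rdistrib matrix_mul_assoc)
qed

text \<open>Covariant derivative of \<open>u\<close>, corrected by the square of the Ricci
  endomorphism so that \<open>ricci_identity\<close> becomes the algebraic symmetry
  \<open>U_sym\<close>.\<close>

definition U where "U e x = ud e x + \<Gamma> e x *v u x + \<kappa> *s (\<rho> x *v (\<rho> x *v axis e 1))"

lemma U_sym: "om (axis c 1) Z *s U e x + om (U e x) Z *s axis c 1 = om (axis e 1) Z *s U c x + om (U c x) Z *s axis e 1"
proof -
  have L: "(md e (N c) x + (\<Gamma> e x ** N c x - N c x ** \<Gamma> e x)) *v Z =
     om (axis c 1) Z *s (ud e x + \<Gamma> e x *v u x) + om (ud e x + \<Gamma> e x *v u x) Z *s axis c 1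
      + (om (\<Gamma> e x *v axis c 1) Z *s u x + om (u x) Z *s (\<Gamma> e x *v axis c 1))" for e c
    by (simp add: mv_simps md_N N_eq C_vec c.sp_move[OF sp_\<Gamma>] bform_simps vec_eq_iff algebra_simps)
  have R: "(Rm e c x ** \<rho> x - \<rho> x ** Rm e c x) *v Z = \<kappa> *s (Ef (\<rho> x) (axis e 1) (axis c 1) (\<rho> x *v Z) - \<rho> x *v Ef (\<rho> x) (axis e 1) (axis c 1) Z)"
    by (simp add: mv_simps Rm_eq vector_ssub_ldistrib)
  have m: "om X (\<rho> x *v Y) = - om (\<rho> x *v X) Y" for X Y using c.sp_move[OF sp_\<rho>, of x X Y] by simp
  have E: "Ef (\<rho> x) (axis e 1) (axis c 1) (\<rho> x *v Z) - \<rho> x *v Ef (\<rho> x) (axis e 1) (axis c 1) Z =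
     (om (axis e 1) Z *s (\<rho> x *v (\<rho> x *v axis c 1)) + om (\<rho> x *v (\<rho> x *v axis c 1)) Z *s axis e 1)
     - (om (axis c 1) Z *s (\<rho> x *v (\<rho> x *v axis e 1)) + om (\<rho> x *v (\<rho> x *v axis e 1)) Z *s axis c 1)"
    unfolding Ef_def by (simp add: mv_simps bform_simps m vec_eq_iff algebra_simps)
  have "((md e (N c) x + (\<Gamma> e x ** N c x - N c x ** \<Gamma> e x)) - (md c (N e) x + (\<Gamma> c x ** N e x - N e x ** \<Gamma> c x))) *v Z
    = \<kappa> *s ((om (axis e 1) Z *s (\<rho> x *v (\<rho> x *v axis c 1)) + om (\<rho> x *v (\<rho> x *v axis c 1)) Z *s axis e 1)
     - (om (axis c 1) Z *s (\<rho> x *v (\<rho> x *v axis e 1)) + om (\<rho> x *v (\<rho> x *v axis e 1)) Z *s axis c 1))"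
    unfolding ricci_identity R E ..
  then show ?thesis
    unfolding matrix_vector_mult_diff_rdistrib[of "md e (N c) x + _"] L
    by (simp add: U_def bform_simps mv_simps \<Gamma>_comm[of e x c] vec_eq_iff algebra_simps)
qed

definition \<beta> where "\<beta> x = fps_const (1 / (2 * real n)) * (\<Sum>k\<in>UNIV. U k x $ k)"

text \<open>Contract \<open>c\<close> with the output index in \<open>U_sym\<close>: one term on
  each side cancels, and the trace of \<open>U\<close> alone determines
  \<open>U e x\<close>.\<close>

lemma U_eq: "U e x = \<beta> x *s axis e 1"
proof -
  have "om (U e x) (axis t 1) = om (\<beta> x *s axis e 1) (axis t 1)" for t
  proof -
    let ?Z = "axis t 1"
    have "(\<Sum>c\<in>UNIV. (om (axis c 1) ?Z *s U e x + om (U e x) ?Z *s axis c 1) $ c) =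
      (\<Sum>c\<in>UNIV. om (axis c 1) ?Z * U e x $ c) + om (U e x) ?Z * (\<Sum>c\<in>UNIV. axis (c::'m) 1 $ c)"
      by (simp only: vector_add_component vector_smult_component sum.distrib sum_distrib_left)
    moreover have "(\<Sum>c\<in>UNIV. (om (axis e 1) ?Z *s U c x + om (U c x) ?Z *s axis e 1) $ c) =
      om (axis e 1) ?Z * (\<Sum>c\<in>UNIV. U c x $ c) + (\<Sum>c\<in>UNIV. om (U c x) ?Z * axis e 1 $ c)"
      by (simp only: vector_add_component vector_smult_component sum.distrib sum_distrib_left)
    ultimately have "of_nat (2 * n) * om (U e x) ?Z = om (axis e 1) ?Z * (\<Sum>c\<in>UNIV. U c x $ c)"
      unfolding U_sym[of _ ?Z e x] basis_contract_left_id axis_sum' axis_trace n(2) by (simp add: algebra_simps)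
    moreover have "(\<Sum>c\<in>UNIV. U c x $ c) = of_nat (2 * n) * \<beta> x"
    proof -
      have "of_nat (2 * n) * fps_const (1 / (2 * real n)) = 1"
        using n by (simp add: fps_of_nat[symmetric] fps_eq_iff)
      then show ?thesis by (simp add: \<beta>_def mult.assoc[symmetric] del: of_nat_mult)
    qed
    ultimately have "of_nat (2 * n) * om (U e x) ?Z = of_nat (2 * n) * om (\<beta> x *s axis e 1) ?Z"
      by (simp add: bform_simps ac_simps)
    moreover have "of_nat (2 * n) \<noteq> (0 :: real fps)" using n by (intro of_nat_nonzero) simp
    ultimately show ?thesis by (metis mult_left_cancel)
  qed
  then show ?thesis
    by (intro c.nondegenerate_axis) (metis c.w_antisym)
qed

text \<open>Exterior derivative of the 1-form dual to \<open>u\<close>, obtained from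
  \<open>U_eq\<close>. It gives the entry of \<open>ht_curvature\<close> between the two line
  bundles that contains \<open>\<beta>\<close>.\<close>

lemma du_antisym:
  "fd c (\<lambda>x. om (u x) (axis d 1)) x - fd d (\<lambda>x. om (u x) (axis c 1)) x
   - 2 * \<kappa> * om (\<rho> x *v axis c 1) (\<rho> x *v axis d 1) = 2 * \<beta> x * om (axis c 1) (axis d 1)"
proof -
  have om_l: "om X (axis j 1) = (\<Sum>a\<in>UNIV. CW $ a $ j * X $ a)" for X j
    by (simp add: bform_def matrix_vector_axis mult.commute)
  have fdu: "fd c (\<lambda>x. om (u x) (axis d 1)) x = om (ud c x) (axis d 1)" for c d
    unfolding om_l by (simp add: fd_sum fd_cmult torus_fps_intros torus_u ud_def)
  have ud: "ud c x = \<beta> x *s axis c 1 - \<Gamma> c x *v u x - \<kappa> *s (\<rho> x *v (\<rho> x *v axis c 1))" for c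
    using U_eq[of c x] by (simp add: U_def algebra_simps)
  have m: "om (\<rho> x *v X) Y = - om X (\<rho> x *v Y)" for X Y by (rule c.sp_move[OF sp_\<rho>])
  have m': "om (\<Gamma> e x *v X) Y = - om X (\<Gamma> e x *v Y)" for e X Y by (rule c.sp_move[OF sp_\<Gamma>])
  show ?thesis
    unfolding fdu ud by (simp add: bform_simps m m' \<Gamma>_comm[of c x d] c.w_antisym[of "axis d 1" "axis c 1"]
       c.w_antisym[of "axis d 1" "\<rho> x *v (\<rho> x *v axis c 1)"] algebra_simps)
qed

lemma d_ric:
  "md c ric x $ d $ t = - om (axis c 1) (axis t 1) * om (u x) (axis d 1) * (- 1) * (- 1)
    - om (axis c 1) (axis d 1) * om (u x) (axis t 1) + (\<Sum>k\<in>UNIV. \<Gamma> c x $ k $ d * ric x $ k $ t) + (\<Sum>k\<in>UNIV. ric x $ d $ k * \<Gamma> c x $ k $ t)"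
proof -
  have "ric = (\<lambda>x. CW ** \<rho> x)"
    by (rule ext) (simp add: \<rho>_def matrix_mul_assoc c.inverse)
  then have 1: "md c ric x = CW ** md c \<rho> x"
    by (simp add: md_mult torus_\<rho>)
  have "md c \<rho> x *v axis t 1 = om (axis c 1) (axis t 1) *s u x + om (u x) (axis t 1) *s axis c 1
     - \<Gamma> c x *v (\<rho> x *v axis t 1) + \<rho> x *v (\<Gamma> c x *v axis t 1)"
    using N_vec[of c x "axis t 1"] unfolding N_eq C_vec by (simp add: algebra_simps)
  then have "om (axis d 1) (md c \<rho> x *v axis t 1) = om (axis c 1) (axis t 1) * om (axis d 1) (u x) + om (u x) (axis t 1) * om (axis d 1) (axis c 1)
     + om (\<Gamma> c x *v axis d 1) (\<rho> x *v axis t 1) + om (axis d 1) (\<rho> x *v (\<Gamma> c x *v axis t 1))"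
    by (simp add: bform_simps c.sp_move[OF sp_\<Gamma>])
  moreover have "om (\<Gamma> c x *v axis d 1) (\<rho> x *v axis t 1) = (\<Sum>k\<in>UNIV. \<Gamma> c x $ k $ d * ric x $ k $ t)"
    unfolding basis_contract_left_id[of CW "\<rho> x *v axis t 1" "\<Gamma> c x *v axis d 1", symmetric] om_\<rho> matrix_vector_axis
    by (simp add: mult.commute)
  moreover have "om (axis d 1) (\<rho> x *v (\<Gamma> c x *v axis t 1)) = (\<Sum>k\<in>UNIV. ric x $ d $ k * \<Gamma> c x $ k $ t)"
    unfolding basis_contract_right[of CW "axis d 1" "\<rho> x" "\<Gamma> c x *v axis t 1", symmetric] om_\<rho> matrix_vector_axis ..
  moreover have "om (axis d 1) (md c \<rho> x *v axis t 1) = md c ric x $ d $ t"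
    unfolding 1 bform_axis_left matrix_vector_mul_assoc matrix_vector_axis ..
  ultimately show ?thesis
    using c.w_antisym[of "axis d 1" "u x"] c.w_antisym[of "axis d 1" "axis c 1"] by (simp add: algebra_simps)
qed

end

section \<open>Rescaling by weights\<close>

definition low :: "real fps \<Rightarrow> bool" where "low F \<longleftrightarrow> (\<forall>k<5. fps_nth F k = 0)"

lemma low_add: "low F \<Longrightarrow> low G \<Longrightarrow> low (F + G)"
  and low_diff: "low F \<Longrightarrow> low G \<Longrightarrow> low (F - G)"
  and low_uminus: "low F \<Longrightarrow> low (- F)"
  and low_mult_left: "low F \<Longrightarrow> low (F * G)"
  and low_mult_right: "low G \<Longrightarrow> low (F * G)"
  and low_zero: "low 0"
  by (simp_all add: low_def fps_mult_nth)

lemma low_sum: "(\<And>i. i \<in> A \<Longrightarrow> low (F i)) \<Longrightarrow> low (\<Sum>i\<in>A. F i)"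
  by (induction A rule: infinite_finite_induct) (auto intro: low_add low_zero)

lemma low_fd: assumes "\<And>y. low (F y)" shows "low (fd c F x)"
  using assms by (simp add: low_def)

lemmas low_intros = low_add low_diff low_uminus low_sum low_fd

text \<open>The weights \<open>0\<close>, \<open>1\<close>, \<open>2\<close> of the summands of the tractor bundle turn conjugation by
  \<open>diag(1, X, X^2)\<close> into a rescaling which makes the soldering form small.\<close>

fun weight :: "'m option option \<Rightarrow> nat" where
  "weight None = 0" | "weight (Some (Some a)) = 1" | "weight (Some None) = 2"

definition rescale :: "'m option option \<Rightarrow> 'm option option \<Rightarrow> real fps \<Rightarrow> real fps" where
  "rescale i j F = (if weight i \<le> weight j then fps_X ^ (weight j - weight i) * F else fps_shift (weight i - weight j) F)"

lemma weight_le: "weight i \<le> 2"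
  by (cases i rule: weight.cases) auto

text \<open>States the conjugation without denominators. Where a division occurs it is exact,
  because weights differ by at most 2 and \<open>low\<close> entries have order at least 5.\<close>

lemma rescale_eq:
  assumes "weight i \<le> weight j \<or> low F"
  shows "fps_X ^ weight i * rescale i j F = fps_X ^ weight j * F"
proof (cases "weight i \<le> weight j")
  case True
  then show ?thesis by (simp add: rescale_def mult.assoc[symmetric] power_add[symmetric])
next
  case False
  then have "low F" using assms by simp
  then show ?thesis using False weight_le[of i]
    by (auto simp: rescale_def fps_eq_iff fps_X_power_mult_nth low_def)
qed

lemma torus_rescale: assumes "torus_fps F" shows "torus_fps (\<lambda>x. rescale i j (F x))"
proof (cases "weight i \<le> weight j")
  case True
  then show ?thesis using assms by (simp add: rescale_def) (intro torus_fps_intros)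
next
  case False
  then show ?thesis using assms by (simp add: rescale_def torus_fps_def)
qed

lemma rescale_low: "low F \<Longrightarrow> k < 3 \<Longrightarrow> fps_nth (rescale i j F) k = 0"
  using weight_le[of i] by (simp add: rescale_def low_def fps_X_power_mult_nth)

lemma rescale_low_0: "weight i < weight j \<or> low F \<Longrightarrow> fps_nth (rescale i j F) 0 = 0"
proof -
  have "weight i - weight j < 5" using weight_le[of i] by simp
  then show "weight i < weight j \<or> low F \<Longrightarrow> fps_nth (rescale i j F) 0 = 0"
    by (auto simp: rescale_def low_def fps_X_power_mult_nth)
qed

definition hf :: "real fps" where "hf = fps_const (1 / 2)"

lemma two_hf: "2 * hf = 1"
  by (simp add: hf_def numeral_fps_const)

lemma hf: "hf * (2 * F) = F" "2 * (hf * F) = F" "hf * F * 2 = F"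
proof -
  have "hf * 2 = 1" by (simp add: hf_def numeral_fps_const)
  then show "hf * (2 * F) = F" by (metis mult.assoc mult.left_neutral)
  then show "2 * (hf * F) = F" "hf * F * 2 = F" by (simp_all only: ac_simps)
qed

section \<open>The tractor connection and its curvature\<close>

context formal_ricci_type
begin

lemma low_\<Gamma>: "low (\<Gamma> c x $ a $ b)"
  by (simp add: low_def \<Gamma>_low)

lemma low_Rm: "low (Rm c d x $ a $ b)"
  unfolding Rm_def by (auto simp: matrix_matrix_mult_def intro!: low_intros low_\<Gamma> intro: low_mult_left)

lemma low_ric: "low (ric x $ a $ b)"
  unfolding ric_def by (auto intro!: low_intros low_Rm)

lemma low_\<rho>: "low (\<rho> x $ a $ b)"
  unfolding \<rho>_def by (auto simp: matrix_matrix_mult_def intro!: low_intros low_ric low_mult_right)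

lemma low_u: "low (u x $ a)"
proof -
  have "low (N c x $ a $ b)" for c a b
    unfolding N_def by (auto simp: matrix_matrix_mult_def intro!: low_intros low_\<rho> low_mult_right[OF low_\<rho>] low_mult_left[OF low_\<rho>])
  then have "low (v x $ a)" for a
    unfolding v_def by (auto intro!: low_intros)
  then show ?thesis
    unfolding u_def by (auto simp: matrix_vector_mult_def intro!: low_intros low_mult_right)
qed

lemma low_om_u: "low (om (u x) X)"
  unfolding bform_def by (intro low_intros low_mult_left low_u)

lemma low_\<beta>: "low (\<beta> x)"
proof -
  have "low (U e x $ k)" for e k
  proof -
    have "low ((\<rho> x *v V) $ k)" "low ((\<Gamma> e x *v V) $ k)" for V
      by (auto simp: matrix_vector_mult_def intro!: low_intros low_mult_left low_\<rho> low_\<Gamma>)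
    then show ?thesis
      unfolding U_def ud_def by (auto intro!: low_intros low_u low_mult_right)
  qed
  then show ?thesis
    unfolding \<beta>_def by (auto intro!: low_mult_right low_intros)
qed

text \<open>The indices \<open>None\<close>, \<open>Some (Some a)\<close>, \<open>Some None\<close> stand for the first line bundle, the
  tangent bundle and the second line bundle; the entries of \<open>ht\<close> are solved from requiring
  curvature \<open>\<omega> At\<close>.\<close>

definition ht :: "'m \<Rightarrow> real ^ 'm \<Rightarrow> real fps ^ 'm option option ^ 'm option option" where
  "ht c x = (\<chi> i j. case i of
     None \<Rightarrow> (case j of Some (Some b) \<Rightarrow> hf * CW $ c $ b | _ \<Rightarrow> 0)
   | Some None \<Rightarrow> (case j of None \<Rightarrow> 2 * \<kappa> * om (u x) (axis c 1) | Some None \<Rightarrow> 0 | Some (Some b) \<Rightarrow> - \<kappa> * ric x $ c $ b)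
   | Some (Some a) \<Rightarrow> (case j of None \<Rightarrow> - 2 * \<kappa> * \<rho> x $ a $ c | Some None \<Rightarrow> axis c 1 $ a | Some (Some b) \<Rightarrow> \<Gamma> c x $ a $ b))"

definition At :: "real ^ 'm \<Rightarrow> real fps ^ 'm option option ^ 'm option option" where
  "At x = (\<chi> i j. case i of
     None \<Rightarrow> (case j of Some None \<Rightarrow> 1 | _ \<Rightarrow> 0)
   | Some None \<Rightarrow> (case j of None \<Rightarrow> 4 * \<kappa> * \<beta> x | Some None \<Rightarrow> 0 | Some (Some c) \<Rightarrow> 2 * \<kappa> * om (u x) (axis c 1))
   | Some (Some a) \<Rightarrow> (case j of None \<Rightarrow> - 4 * \<kappa> * u x $ a | Some None \<Rightarrow> 0 | Some (Some c) \<Rightarrow> - 2 * \<kappa> * \<rho> x $ a $ c))"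

lemma ht_nth:
  "ht c x $ None $ None = 0" "ht c x $ None $ Some None = 0" "ht c x $ None $ Some (Some b) = hf * CW $ c $ b"
  "ht c x $ Some None $ None = 2 * \<kappa> * om (u x) (axis c 1)" "ht c x $ Some None $ Some None = 0"
  "ht c x $ Some None $ Some (Some b) = - \<kappa> * ric x $ c $ b"
  "ht c x $ Some (Some a) $ None = - 2 * \<kappa> * \<rho> x $ a $ c" "ht c x $ Some (Some a) $ Some None = axis c 1 $ a"
  "ht c x $ Some (Some a) $ Some (Some b) = \<Gamma> c x $ a $ b"
  by (simp_all add: ht_def)

lemma At_nth:
  "At x $ None $ None = 0" "At x $ None $ Some None = 1" "At x $ None $ Some (Some c) = 0"
  "At x $ Some None $ None = 4 * \<kappa> * \<beta> x" "At x $ Some None $ Some None = 0"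
  "At x $ Some None $ Some (Some c) = 2 * \<kappa> * om (u x) (axis c 1)"
  "At x $ Some (Some a) $ None = - 4 * \<kappa> * u x $ a" "At x $ Some (Some a) $ Some None = 0"
  "At x $ Some (Some a) $ Some (Some c) = - 2 * \<kappa> * \<rho> x $ a $ c"
  by (simp_all add: At_def)

lemma om_mat: "om (axis a 1) (A *v axis b 1) = (\<Sum>k\<in>UNIV. CW $ a $ k * A $ k $ b)"
  unfolding bform_axis_left matrix_vector_mul_assoc matrix_vector_axis by (simp add: matrix_matrix_mult_def)

lemma om_ric: "(\<Sum>k\<in>UNIV. CW $ a $ k * \<rho> x $ k $ b) = ric x $ a $ b"
  unfolding om_mat[symmetric] om_\<rho> ..

lemma torus_om_u: "torus_fps (\<lambda>x. om (u x) (axis c 1))"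
proof -
  have om_l: "om X (axis j 1) = (\<Sum>a\<in>UNIV. CW $ a $ j * X $ a)" for X j
    by (simp add: bform_def matrix_vector_axis mult.commute)
  show ?thesis unfolding om_l by (intro torus_fps_intros torus_u)
qed

lemma md_\<rho>: "md c \<rho> x $ a $ d = om (axis c 1) (axis d 1) * u x $ a + om (u x) (axis d 1) * axis c 1 $ a
   - (\<Sum>k\<in>UNIV. \<Gamma> c x $ a $ k * \<rho> x $ k $ d) + (\<Sum>k\<in>UNIV. \<rho> x $ a $ k * \<Gamma> c x $ k $ d)"
proof -
  have "N c x $ a $ d = om (axis c 1) (axis d 1) * u x $ a + om (u x) (axis d 1) * axis c 1 $ a"
    unfolding N_eq C_def by simp
  then show ?thesis by (simp add: N_def matrix_matrix_mult_def algebra_simps)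
qed

text \<open>Checked block by block, row first, with \<open>E\<close>, \<open>T\<close>,
  \<open>F\<close> for the indices \<open>None\<close>, \<open>Some (Some a)\<close>,
  \<open>Some None\<close>. \<open>TT\<close> is the Ricci type formula, \<open>TE\<close> and
  \<open>FT\<close> are the equation for the derivative of the Ricci tensor, and \<open>FE\<close>
  is \<open>du_antisym\<close>. \<open>TF\<close> expresses absence of torsion, \<open>ET\<close>
  uses that \<open>\<Gamma>\<close> is symplectic, \<open>EE\<close> and \<open>FF\<close> use
  symmetry of the Ricci tensor, and \<open>EF\<close> produces the entry 1 of
  \<open>At\<close>.\<close>

lemma ht_curvature:
  "md c (ht d) x - md d (ht c) x + ht c x ** ht d x - ht d x ** ht c x = smat (fps_const (W $ c $ d)) (At x)"
proof -
  let ?F = "\<lambda>i j. fd c (\<lambda>x. ht d x $ i $ j) x - fd d (\<lambda>x. ht c x $ i $ j) x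
     + (\<Sum>k\<in>UNIV. ht c x $ i $ k * ht d x $ k $ j) - (\<Sum>k\<in>UNIV. ht d x $ i $ k * ht c x $ k $ j)"
  have W: "om (axis c 1) (axis d 1) = fps_const (W $ c $ d)" for c d by (simp add: bform_axis)
  note half = hf(1)
  have EE: "?F None None = 0"
  proof -
    have "(\<Sum>k\<in>UNIV. hf * CW $ c $ k * (- 2 * \<kappa> * \<rho> x $ k $ d)) = - \<kappa> * ric x $ c $ d" for c d
    proof -
      have "hf * CW $ c $ k * (- 2 * \<kappa> * \<rho> x $ k $ d) = - \<kappa> * (CW $ c $ k * \<rho> x $ k $ d)" for k
        using half[of "- \<kappa> * (CW $ c $ k * \<rho> x $ k $ d)"] by (simp add: ac_simps del: const_mat_nth)
      then show ?thesis unfolding om_ric[symmetric] sum_distrib_left by (rule sum.cong[OF refl])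
    qed
    then show ?thesis unfolding ht_nth sum_option2 by (simp add: ric_sym[of x d c] del: const_mat_nth)
  qed
  have EF: "?F None (Some None) = fps_const (W $ c $ d)"
  proof -
    have "hf * CW $ c $ d - hf * CW $ d $ c = CW $ c $ d"
      using c.W_swap[of d c] half[of "CW $ c $ d"] by (simp add: algebra_simps del: const_mat_nth)
    then show ?thesis unfolding ht_nth sum_option2 by (simp add: axis_sum' del: const_mat_nth) simp
  qed
  have ET: "?F None (Some (Some b)) = 0" for b
  proof -
    have "(\<Sum>k\<in>UNIV. hf * CW $ c $ k * \<Gamma> d x $ k $ b) = hf * om (axis c 1) (\<Gamma> d x *v axis b 1)" for c d
      unfolding om_mat sum_distrib_left by (simp add: ac_simps)
    moreover have "om (axis c 1) (\<Gamma> d x *v axis b 1) = om (axis d 1) (\<Gamma> c x *v axis b 1)"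
      using c.sp_right[OF sp_\<Gamma>, of "axis c 1" d x "axis b 1"] c.sp_right[OF sp_\<Gamma>, of "axis d 1" c x "axis b 1"] \<Gamma>_comm[of c x d] by simp
    ultimately show ?thesis unfolding ht_nth sum_option2 by (simp del: const_mat_nth)
  qed
  have FF: "?F (Some None) (Some None) = 0"
    unfolding ht_nth sum_option2 axis_sum' by (simp add: ric_sym[of x c d])
  have FE: "?F (Some None) None = fps_const (W $ c $ d) * (4 * \<kappa> * \<beta> x)"
  proof -
    have "(\<Sum>k\<in>UNIV. - \<kappa> * ric x $ c $ k * (- 2 * \<kappa> * \<rho> x $ k $ d)) = - 2 * \<kappa> * \<kappa> * om (\<rho> x *v axis c 1) (\<rho> x *v axis d 1)" for c d
    proof -
      have "om (\<rho> x *v axis c 1) (\<rho> x *v axis d 1) = - om (axis c 1) (\<rho> x *v (\<rho> x *v axis d 1))"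
        by (rule c.sp_move[OF sp_\<rho>])
      also have "om (axis c 1) (\<rho> x *v (\<rho> x *v axis d 1)) = (\<Sum>k\<in>UNIV. ric x $ c $ k * \<rho> x $ k $ d)"
        unfolding basis_contract_right[of CW "axis c 1" "\<rho> x" "\<rho> x *v axis d 1", symmetric] om_\<rho> matrix_vector_axis ..
      finally show ?thesis by (simp add: sum_distrib_left sum_negf ac_simps)
    qed
    note s = this
    have d: "fd c (\<lambda>x. 2 * \<kappa> * om (u x) (axis d 1)) x = 2 * \<kappa> * fd c (\<lambda>x. om (u x) (axis d 1)) x" for c d
      by (intro fd_cmult torus_om_u)
    have "?F (Some None) None = 2 * \<kappa> * (fd c (\<lambda>x. om (u x) (axis d 1)) x - fd d (\<lambda>x. om (u x) (axis c 1)) x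
       - 2 * \<kappa> * om (\<rho> x *v axis c 1) (\<rho> x *v axis d 1))"
      unfolding ht_nth sum_option2 d s using c.w_antisym[of "\<rho> x *v axis d 1" "\<rho> x *v axis c 1"] by (simp add: algebra_simps)
    then show ?thesis unfolding du_antisym W by (simp add: ac_simps)
  qed
  have FT: "?F (Some None) (Some (Some t)) = fps_const (W $ c $ d) * (2 * \<kappa> * om (u x) (axis t 1))" for t
  proof -
    have d: "fd c (\<lambda>x. - \<kappa> * ric x $ d $ t) x = - \<kappa> * md c ric x $ d $ t" for c d
      by (simp add: fd_mult fd_uminus torus_fps_intros torus_matD[OF torus_ric])
    have s: "(\<Sum>k\<in>UNIV. \<Gamma> c x $ k $ d * ric x $ k $ t) = (\<Sum>k\<in>UNIV. \<Gamma> d x $ k $ c * ric x $ k $ t)"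
      by (simp add: \<Gamma>_sym[of c x _ d])
    have "2 * \<kappa> * om (u x) (axis c 1) * (hf * CW $ d $ t) = \<kappa> * om (u x) (axis c 1) * om (axis d 1) (axis t 1)" for c d
      unfolding W using half[of "\<kappa> * om (u x) (axis c 1) * fps_const (W $ d $ t)"] by (simp add: ac_simps)
    note h = this
    have r: "(\<Sum>k\<in>UNIV. - \<kappa> * ric x $ c $ k * \<Gamma> d x $ k $ t) = - \<kappa> * (\<Sum>k\<in>UNIV. ric x $ c $ k * \<Gamma> d x $ k $ t)" for c d
      by (simp add: sum_distrib_left ac_simps)
    show ?thesis
      unfolding ht_nth sum_option2 d h r d_ric s W[symmetric]
      using c.w_antisym[of "axis d 1" "axis c 1"] by (simp add: algebra_simps)
  qed
  have TE: "?F (Some (Some a)) None = fps_const (W $ c $ d) * (- 4 * \<kappa> * u x $ a)" for a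
  proof -
    have d: "fd c (\<lambda>x. - 2 * \<kappa> * \<rho> x $ a $ d) x = - 2 * \<kappa> * md c \<rho> x $ a $ d" for c d
      by (simp add: fd_mult fd_uminus torus_fps_intros torus_matD[OF torus_\<rho>])
    have s: "(\<Sum>k\<in>UNIV. \<rho> x $ a $ k * \<Gamma> c x $ k $ d) = (\<Sum>k\<in>UNIV. \<rho> x $ a $ k * \<Gamma> d x $ k $ c)"
      by (simp add: \<Gamma>_sym[of c x _ d])
    have r: "(\<Sum>k\<in>UNIV. \<Gamma> c x $ a $ k * (- 2 * \<kappa> * \<rho> x $ k $ d)) = - 2 * \<kappa> * (\<Sum>k\<in>UNIV. \<Gamma> c x $ a $ k * \<rho> x $ k $ d)" for c d
      by (simp add: sum_distrib_left ac_simps)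
    show ?thesis
      unfolding ht_nth sum_option2 d r md_\<rho> s W[symmetric]
      using c.w_antisym[of "axis d 1" "axis c 1"] by (simp add: algebra_simps)
  qed
  have TF: "?F (Some (Some a)) (Some None) = 0" for a
    unfolding ht_nth sum_option2 by (simp add: axis_sum' \<Gamma>_sym[of c x a d])
  have TT: "?F (Some (Some a)) (Some (Some t)) = fps_const (W $ c $ d) * (- 2 * \<kappa> * \<rho> x $ a $ t)" for a t
  proof -
    have R: "Rm c d x $ a $ t = fd c (\<lambda>x. \<Gamma> d x $ a $ t) x - fd d (\<lambda>x. \<Gamma> c x $ a $ t) x
      + ((\<Sum>k\<in>UNIV. \<Gamma> c x $ a $ k * \<Gamma> d x $ k $ t) - (\<Sum>k\<in>UNIV. \<Gamma> d x $ a $ k * \<Gamma> c x $ k $ t))"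
      by (simp add: Rm_def matrix_matrix_mult_def)
    have E: "Rm c d x $ a $ t = \<kappa> * ((- 2 * om (axis c 1) (axis d 1)) * \<rho> x $ a $ t - om (axis c 1) (axis t 1) * \<rho> x $ a $ d
       + ric x $ d $ t * axis c 1 $ a + om (axis d 1) (axis t 1) * \<rho> x $ a $ c - ric x $ c $ t * axis d 1 $ a)"
      using arg_cong[OF Rm_eq[of c d x "axis t 1"], of "\<lambda>V. V $ a"]
      unfolding matrix_vector_axis Ef_def vector_smult_component vector_add_component vector_minus_component om_\<rho> .
    have "- 2 * \<kappa> * \<rho> x $ a $ c * (hf * CW $ d $ t) = - \<kappa> * \<rho> x $ a $ c * om (axis d 1) (axis t 1)" for c d
      unfolding W using half[of "- \<kappa> * \<rho> x $ a $ c * fps_const (W $ d $ t)"] by (simp add: ac_simps)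
    note h = this
    show ?thesis
      using E unfolding R ht_nth sum_option2 h W[symmetric] by (simp add: algebra_simps)
  qed
  have "(md c (ht d) x - md d (ht c) x + ht c x ** ht d x - ht d x ** ht c x) $ i $ j = ?F i j" for i j
    by (simp add: matrix_matrix_mult_def)
  then show ?thesis
    unfolding vec_eq_iff all_option2 smat_nth At_nth
    by (simp only: EE EF ET FE FF FT TE TF TT mult_zero_right mult_1_right simp_thms)
qed

definition h where "h c x = (\<chi> i j. rescale i j (ht c x $ i $ j))"
definition A where "A x = (\<chi> i j. rescale i j (At x $ i $ j))"

lemma ht_low: "weight i \<le> weight j \<or> low (ht c x $ i $ j)"
  by (cases i rule: weight.cases; cases j rule: weight.cases)
    (auto simp: ht_nth intro: low_uminus low_mult_right low_om_u low_ric low_\<rho>)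

lemma At_low: "weight i \<le> weight j \<or> low (At x $ i $ j)"
  by (cases i rule: weight.cases; cases j rule: weight.cases)
    (auto simp: At_nth intro: low_uminus low_mult_right low_om_u low_u low_\<beta>)

lemma h_scaled: "fps_X ^ weight i * h c x $ i $ j = fps_X ^ weight j * ht c x $ i $ j"
  unfolding h_def by (simp add: rescale_eq[OF ht_low])

lemma A_scaled: "fps_X ^ weight i * A x $ i $ j = fps_X ^ weight j * At x $ i $ j"
  unfolding A_def by (simp add: rescale_eq[OF At_low])

lemma torus_ht: "torus_mat (ht c)"
  unfolding torus_mat_def all_option2 ht_nth
  by (auto intro!: torus_fps_intros torus_om_u torus_matD[OF torus_ric] torus_matD[OF torus_\<rho>] torus_matD[OF torus_\<Gamma>])

lemma torus_h: "torus_mat (h c)"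
  unfolding torus_mat_def h_def by (auto intro!: torus_rescale torus_matD[OF torus_ht])

text \<open>Conjugation by a diagonal matrix that does not depend on \<open>x\<close> respects the
  curvature equation. After multiplication by the power of \<open>fps_X\<close> belonging to the
  row, it becomes \<open>ht_curvature\<close>.\<close>

lemma h_curvature:
  "md c (h d) x - md d (h c) x + h c x ** h d x - h d x ** h c x = smat (fps_const (W $ c $ d)) (A x)"
proof -
  have d: "fps_X ^ weight i * fd c (\<lambda>x. h d x $ i $ j) x = fps_X ^ weight j * fd c (\<lambda>x. ht d x $ i $ j) x" for c d i j
    unfolding fd_cmult[OF torus_matD[OF torus_h], symmetric] fd_cmult[OF torus_matD[OF torus_ht], symmetric] h_scaled ..
  have m: "fps_X ^ weight i * (\<Sum>k\<in>UNIV. h c x $ i $ k * h d x $ k $ j) = fps_X ^ weight j * (\<Sum>k\<in>UNIV. ht c x $ i $ k * ht d x $ k $ j)" for c d i j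
  proof -
    have "fps_X ^ weight i * (h c x $ i $ k * h d x $ k $ j) = fps_X ^ weight j * (ht c x $ i $ k * ht d x $ k $ j)" for k
    proof -
      have "fps_X ^ weight i * (h c x $ i $ k * h d x $ k $ j) = (fps_X ^ weight i * h c x $ i $ k) * h d x $ k $ j"
        by (simp only: mult.assoc)
      also have "\<dots> = (fps_X ^ weight k * h d x $ k $ j) * ht c x $ i $ k"
        unfolding h_scaled[of i c x k] by (simp only: ac_simps)
      finally show ?thesis unfolding h_scaled[of k d x j] by (simp only: ac_simps)
    qed
    then show ?thesis by (simp add: sum_distrib_left)
  qed
  have "fps_X ^ weight i * (md c (h d) x - md d (h c) x + h c x ** h d x - h d x ** h c x) $ i $ j =
      fps_X ^ weight i * smat (fps_const (W $ c $ d)) (A x) $ i $ j" for i j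
  proof -
    have "fps_X ^ weight i * (md c (h d) x - md d (h c) x + h c x ** h d x - h d x ** h c x) $ i $ j
      = fps_X ^ weight j * (md c (ht d) x - md d (ht c) x + ht c x ** ht d x - ht d x ** ht c x) $ i $ j"
      by (simp add: matrix_matrix_mult_def distrib_left right_diff_distrib d m)
    also have "\<dots> = fps_X ^ weight i * smat (fps_const (W $ c $ d)) (A x) $ i $ j"
      unfolding ht_curvature smat_nth mult.left_commute[of "fps_X ^ _" "fps_const _"] A_scaled ..
    finally show ?thesis .
  qed
  then show ?thesis by (simp add: vec_eq_iff)
qed

text \<open>The parallel symplectic form of the tractor bundle. The line bundles pair to 2 in order
  to match the factor \<open>hf\<close> in \<open>ht\<close>.\<close>

definition Om :: "real fps ^ 'm option option ^ 'm option option" where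
  "Om = (\<chi> i j. case i of
     None \<Rightarrow> (if j = Some None then 2 else 0)
   | Some None \<Rightarrow> (if j = None then - 2 else 0)
   | Some (Some a) \<Rightarrow> (case j of Some (Some b) \<Rightarrow> CW $ a $ b | _ \<Rightarrow> 0))"

lemma Om_nth:
  "Om $ None $ None = 0" "Om $ None $ Some None = 2" "Om $ None $ Some (Some c) = 0"
  "Om $ Some None $ None = - 2" "Om $ Some None $ Some None = 0" "Om $ Some None $ Some (Some c) = 0"
  "Om $ Some (Some a) $ None = 0" "Om $ Some (Some a) $ Some None = 0" "Om $ Some (Some a) $ Some (Some c) = CW $ a $ c"
  by (simp_all add: Om_def)

lemma sp_ht: "(\<Sum>k\<in>UNIV. ht c x $ k $ i * Om $ k $ j) + (\<Sum>k\<in>UNIV. Om $ i $ k * ht c x $ k $ j) = 0"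
proof -
  have TE: "(\<Sum>k\<in>UNIV. CW $ a $ k * (- 2 * \<kappa> * \<rho> x $ k $ c)) = - 2 * \<kappa> * ric x $ a $ c" for a
    unfolding om_ric[symmetric] sum_distrib_left by (simp add: ac_simps del: const_mat_nth)
  have ET: "(\<Sum>k\<in>UNIV. - 2 * \<kappa> * \<rho> x $ k $ c * CW $ k $ a) = 2 * \<kappa> * ric x $ a $ c" for a
  proof -
    have "- 2 * \<kappa> * \<rho> x $ k $ c * CW $ k $ a = 2 * \<kappa> * (CW $ a $ k * \<rho> x $ k $ c)" for k
      by (subst c.W_swap) (simp add: ac_simps del: const_mat_nth)
    then show ?thesis
      unfolding om_ric[symmetric] sum_distrib_left by (rule sum.cong[OF refl])
  qed
  have TT: "(\<Sum>k\<in>UNIV. \<Gamma> c x $ k $ a * CW $ k $ t) + (\<Sum>k\<in>UNIV. CW $ a $ k * \<Gamma> c x $ k $ t) = 0" for a t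
    unfolding om_mat[symmetric] bform_axis_axis_mult[symmetric] using sp_\<Gamma>[of c x] unfolding c.sp_def by blast
  note half = hf(2,3)
  have "\<forall>i j. (\<Sum>k\<in>UNIV. ht c x $ k $ i * Om $ k $ j) + (\<Sum>k\<in>UNIV. Om $ i $ k * ht c x $ k $ j) = 0"
    unfolding all_option2 sum_option2 ht_nth Om_nth mult_zero_left mult_zero_right add_0_left add_0_right sum.neutral_const TE ET axis_sum axis_sum'
    by (intro conjI allI TT)
      (simp_all add: half two_hf c.W_swap[of _ c] ric_sym[of x c] mult.assoc mult.left_commute[of 2] mult.commute[of _ 2] del: const_mat_nth)
  then show ?thesis by blast
qed

text \<open>The nonzero entries of \<open>Om\<close> sit where the weights add up to 2, so the
  conjugation only scales the form by \<open>fps_X ^ 2\<close> and \<open>sp_ht\<close> carries over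
  to \<open>h\<close>.\<close>

lemma Om_weight: "fps_X ^ 2 * Om $ i $ j = fps_X ^ weight i * fps_X ^ weight j * Om $ i $ j"
  by (cases i rule: weight.cases; cases j rule: weight.cases) (simp_all add: Om_nth power2_eq_square)

lemma sp_h: "transpose (h c x) ** Om + Om ** h c x = 0"
proof -
  have aux: "xj * q * (g * o') = xi * xj * xj * (g' * o')"
    if "q * o' = xk * xj * o'" "xk * g = xi * g'" for xi xj xk q g g' o' :: "real fps"
  proof -
    have "xj * q * (g * o') = xj * g * (q * o')" by (simp only: ac_simps)
    also have "\<dots> = xj * xj * (xk * g) * o'" unfolding that(1) by (simp only: ac_simps)
    finally show ?thesis unfolding that(2) by (simp only: ac_simps)
  qed
  define q :: "real fps" where "q = fps_X ^ 2"
  define X where "X i = (fps_X :: real fps) ^ weight i" for i :: "'m option option"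
  have O: "q * Om $ i $ j = X i * X j * Om $ i $ j" and H: "X i * h c x $ i $ j = X j * ht c x $ i $ j" for i j
    unfolding q_def X_def by (rule Om_weight, rule h_scaled)
  have 1: "X j * q * (h c x $ k $ i * Om $ k $ j) = X i * X j * X j * (ht c x $ k $ i * Om $ k $ j)" for i j k
    by (rule aux[OF O H])
  have 2: "X i * q * (h c x $ k $ j * Om $ i $ k) = X j * X i * X i * (ht c x $ k $ j * Om $ i $ k)" for i j k
    by (rule aux[OF _ H]) (simp only: O ac_simps)
  have "X i * X j * q * ((transpose (h c x) ** Om + Om ** h c x) $ i $ j) = 0" for i j
  proof -
    have "X i * X j * q * ((transpose (h c x) ** Om + Om ** h c x) $ i $ j) =
      X i * (\<Sum>k\<in>UNIV. X j * q * (h c x $ k $ i * Om $ k $ j))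
      + X j * (\<Sum>k\<in>UNIV. X i * q * (h c x $ k $ j * Om $ i $ k))"
      by (simp add: matrix_matrix_mult_def transpose_def sum_distrib_left distrib_left) (simp add: ac_simps)
    also have "\<dots> = X i * X i * X j * X j *
       ((\<Sum>k\<in>UNIV. ht c x $ k $ i * Om $ k $ j) + (\<Sum>k\<in>UNIV. Om $ i $ k * ht c x $ k $ j))"
      unfolding 1 2 by (simp add: sum_distrib_left distrib_left) (simp add: ac_simps)
    finally show ?thesis unfolding sp_ht by simp
  qed
  then have "(transpose (h c x) ** Om + Om ** h c x) $ i $ j = 0" for i j
    unfolding mult_eq_0_iff by (simp add: X_def q_def)
  then show ?thesis by (simp add: vec_eq_iff)
qed

text \<open>The corner 1 is moved to order 2 by the weights 0 and 2. Every other entry starts with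
  order at least 5 and loses at most 2, so the corner alone is the leading term.\<close>

lemma A_small: "fps_nth (A x $ i $ j) k = (if i = None \<and> j = Some None \<and> k = 2 then 1 else 0)" if "k < 3"
proof (cases "i = None \<and> j = Some None")
  case True
  then show ?thesis by (simp add: A_def At_nth rescale_def fps_X_power_nth)
next
  case False
  then have "low (At x $ i $ j)"
    by (cases i rule: weight.cases; cases j rule: weight.cases)
      (auto simp: At_nth intro: low_uminus low_mult_right low_om_u low_u low_\<beta> low_\<rho> low_zero)
  then show ?thesis using False that by (auto simp: A_def rescale_low)
qed

theorem ric_zero: "ric x = 0"
proof -
  \<comment> \<open>The leading coefficient of \<open>A\<close> sends the basis vector
    \<open>Some None\<close> to \<open>None\<close>, with which it pairs to -2; hence the order 2
    and the choice of \<open>i0\<close>.\<close>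
  interpret tr: formal_tractor_connection W Wi h A Om n 2 "Some None"
  proof
    show "torus_mat (h c)" for c by (rule torus_h)
    show "mcoeff 0 (h c x) = 0" for c x
    proof -
      have "weight i < weight j \<or> low (ht c x $ i $ j)" for i j
        by (cases i rule: weight.cases; cases j rule: weight.cases)
         (auto simp: ht_nth intro: low_uminus low_mult_right low_om_u low_ric low_\<rho> low_\<Gamma> low_zero)
      then show ?thesis by (simp add: vec_eq_iff h_def rescale_low_0)
    qed
    show "md c (h d) x - md d (h c) x + h c x ** h d x - h d x ** h c x = smat (fps_const (W $ c $ d)) (A x)" for c d x
      by (rule h_curvature)
    show "2 \<le> n" "CARD('m) = 2 * n" by (rule n)+
    show "transpose Om = - Om"
      unfolding vec_eq_iff all_option2 by (simp add: transpose_def Om_nth del: const_mat_nth) (intro allI, rule c.W_swap)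
    show "mcoeff k Om = 0" if "k > 0" for k
      using that unfolding vec_eq_iff all_option2 by (simp add: Om_nth numeral_fps_const)
    show "transpose (h c x) ** Om + Om ** h c x = 0" for c x by (rule sp_h)
    show "mcoeff k (A x) = 0" if "k < 2" for k x
      using that by (simp add: vec_eq_iff A_small)
    show "(mcoeff 0 Om ** mcoeff 2 (A x)) $ Some None $ Some None \<noteq> 0" for x
      by (simp add: matrix_matrix_mult_def sum_option2 A_small Om_nth numeral_fps_const)
  qed
  \<comment> \<open>In this minor the corner is \<open>fps_X ^ 2\<close> and both entries on the
    right vanish, so the remaining entry, \<open>\<rho>\<close> up to a nonzero factor, is
    zero.\<close>
  have "A x $ None $ Some None * A x $ Some (Some a) $ Some (Some t) = A x $ None $ Some (Some t) * A x $ Some (Some a) $ Some None" for a t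
    by (rule tr.rank_one_curvature)
  then have "\<rho> x $ a $ t = 0" for a t
    by (simp add: A_def At_nth rescale_def \<kappa>_def)
  then show ?thesis
    by (simp add: vec_eq_iff om_ric[symmetric])
qed

end

section \<open>Connections in coordinates\<close>

lemma torus_field_const: "torus_field (\<lambda>_. v)"
  by (simp add: torus_field_def)

lemma torus_field_coord: "torus_field (coord_field a)"
  unfolding coord_field_def by (rule torus_field_const)

lemma torus_field_component: "torus_field X \<Longrightarrow> torus_fun (\<lambda>x. X x $ a)"
  by (simp add: torus_field_def)

lemma torus_field_scale: "torus_fun f \<Longrightarrow> torus_field X \<Longrightarrow> torus_field (\<lambda>x. f x *\<^sub>R X x)"
  by (auto simp: torus_field_def intro: torus_intros)

lemma torus_field_sum: "(\<And>i. i \<in> A \<Longrightarrow> torus_field (X i)) \<Longrightarrow> torus_field (\<lambda>x. \<Sum>i\<in>A. X i x)"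
  by (auto simp: torus_field_def intro: torus_intros)

lemma sum_coord_field: "(\<Sum>a\<in>UNIV. coord_field i x $ a * f a) = f i"
  by (simp add: coord_field_def axis_def mult_delta_left)

lemma pd_coord_field: "pd a (\<lambda>y. coord_field b y $ c) x = 0"
  by (simp only: coord_field_def[of b] pd_const)

lemma field_expansion: "X = (\<lambda>x. \<Sum>a\<in>UNIV. X x $ a *\<^sub>R coord_field a x)"
  by (simp add: coord_field_def fun_eq_iff vec_eq_iff axis_def mult_delta_right)

lemma field_deriv_expansion:
  assumes "smooth_fun f"
  shows "field_deriv X f x = (\<Sum>a\<in>UNIV. X x $ a * pd a f x)"
  using frechet_derivative_at[OF smooth_fun_has_derivative[OF assms, of x]]
  by (simp add: field_deriv_def fun_eq_iff)

lemma lie_bracket_component: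
  assumes "torus_field X" "torus_field Y"
  shows "lie_bracket X Y x $ b = (\<Sum>a\<in>UNIV. X x $ a * pd a (\<lambda>y. Y y $ b) x - Y x $ a * pd a (\<lambda>y. X y $ b) x)"
  using assms by (simp add: lie_bracket_def field_deriv_expansion torus_fun_smooth torus_field_component sum_subtractf)

locale torus_connection =
  fixes D :: "'m::finite connection"
  assumes linear: "linear_connection D"
begin

lemma torus_field_D: "torus_field X \<Longrightarrow> torus_field Y \<Longrightarrow> torus_field (D X Y)"
  using linear by (simp add: linear_connection_def)

lemma D_add_left: "torus_field X \<Longrightarrow> torus_field X' \<Longrightarrow> torus_field Y \<Longrightarrow>
    D (\<lambda>x. X x + X' x) Y = (\<lambda>x. D X Y x + D X' Y x)"
  using linear unfolding linear_connection_def by blast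

lemma D_scale_left: "torus_fun f \<Longrightarrow> torus_field X \<Longrightarrow> torus_field Y \<Longrightarrow> D (\<lambda>x. f x *\<^sub>R X x) Y = (\<lambda>x. f x *\<^sub>R D X Y x)"
  using linear unfolding linear_connection_def by blast

lemma D_add_right: "torus_field X \<Longrightarrow> torus_field Y \<Longrightarrow> torus_field Y' \<Longrightarrow>
    D X (\<lambda>x. Y x + Y' x) = (\<lambda>x. D X Y x + D X Y' x)"
  using linear unfolding linear_connection_def by blast

lemma D_leibniz: "torus_fun f \<Longrightarrow> torus_field X \<Longrightarrow> torus_field Y \<Longrightarrow>
    D X (\<lambda>x. f x *\<^sub>R Y x) = (\<lambda>x. field_deriv X f x *\<^sub>R Y x + f x *\<^sub>R D X Y x)"
  using linear unfolding linear_connection_def by blast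

lemma D_zero_left: "torus_field Y \<Longrightarrow> D (\<lambda>_. 0) Y = (\<lambda>_. 0)"
  using D_scale_left[of "\<lambda>_. 0" "\<lambda>_. 0" Y] by (simp add: torus_field_const)

lemma D_zero_right: "torus_field X \<Longrightarrow> D X (\<lambda>_. 0) = (\<lambda>_. 0)"
  using D_leibniz[of "\<lambda>_. 0" X "\<lambda>_. 0"] by (simp add: torus_field_const)

lemma D_sum_left:
  assumes "\<And>i. i \<in> A \<Longrightarrow> torus_field (X i)" and Y: "torus_field Y"
  shows "D (\<lambda>x. \<Sum>i\<in>A. X i x) Y = (\<lambda>x. \<Sum>i\<in>A. D (X i) Y x)"
  using assms(1) by (induction A rule: infinite_finite_induct)
    (simp_all add: D_zero_left D_add_left torus_field_sum Y)

lemma D_sum_right: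
  assumes "\<And>i. i \<in> A \<Longrightarrow> torus_field (Y i)" and X: "torus_field X"
  shows "D X (\<lambda>x. \<Sum>i\<in>A. Y i x) = (\<lambda>x. \<Sum>i\<in>A. D X (Y i) x)"
  using assms(1) by (induction A rule: infinite_finite_induct)
    (simp_all add: D_zero_right D_add_right torus_field_sum X)

abbreviation G where "G \<equiv> christoffel D"

lemma torus_fun_christoffel: "torus_fun (G c a b)"
  unfolding christoffel_def by (intro torus_field_component torus_field_D torus_field_coord)

definition cov :: "'m \<Rightarrow> (real ^ 'm \<Rightarrow> real ^ 'm) \<Rightarrow> 'm \<Rightarrow> real ^ 'm \<Rightarrow> real" where
  "cov a Y c x = pd a (\<lambda>y. Y y $ c) x + (\<Sum>b\<in>UNIV. G c a b x * Y x $ b)"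

lemma torus_fun_cov: "torus_field Y \<Longrightarrow> torus_fun (cov a Y c)"
  unfolding cov_def[abs_def] by (intro torus_intros torus_fun_christoffel torus_field_component)

lemma D_component:
  assumes X: "torus_field X" and Y: "torus_field Y"
  shows "D X Y x $ c = (\<Sum>a\<in>UNIV. X x $ a * cov a Y c x)"
proof -
  have "D (coord_field a) Y x $ c = cov a Y c x" for a
  proof -
    have "D (coord_field a) Y = D (coord_field a) (\<lambda>x. \<Sum>b\<in>UNIV. Y x $ b *\<^sub>R coord_field b x)"
      using field_expansion[of Y] by simp
    also have "\<dots> = (\<lambda>x. \<Sum>b\<in>UNIV. pd a (\<lambda>x. Y x $ b) x *\<^sub>R coord_field b x + Y x $ b *\<^sub>R D (coord_field a) (coord_field b) x)"
      by (subst D_sum_right) (simp_all add: D_leibniz torus_field_scale torus_field_coord torus_field_component Y)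
    finally show ?thesis
      by (simp add: cov_def sum.distrib christoffel_def) (simp add: coord_field_def axis_def mult_delta_right mult_delta_left mult.commute)
  qed
  moreover have "D X Y = D (\<lambda>x. \<Sum>a\<in>UNIV. X x $ a *\<^sub>R coord_field a x) Y"
    using field_expansion[of X] by simp
  moreover have "\<dots> = (\<lambda>x. \<Sum>a\<in>UNIV. X x $ a *\<^sub>R D (coord_field a) Y x)"
    by (subst D_sum_left) (simp_all add: D_scale_left torus_field_scale torus_field_coord torus_field_component X Y)
  ultimately show ?thesis by simp
qed

definition K :: "'m \<Rightarrow> 'm \<Rightarrow> 'm \<Rightarrow> 'm \<Rightarrow> real ^ 'm \<Rightarrow> real" where
  "K a b e d x = pd a (G e b d) x - pd b (G e a d) x + (\<Sum>f\<in>UNIV. G e a f x * G f b d x - G e b f x * G f a d x)"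

text \<open>The index \<open>b\<close> is only a label and gets no Christoffel term: this is the
  derivative along the coordinate field \<open>a\<close> of the derivative of \<open>Z\<close> along
  the coordinate field \<open>b\<close>.\<close>

definition cov2 :: "'m \<Rightarrow> 'm \<Rightarrow> (real ^ 'm \<Rightarrow> real ^ 'm) \<Rightarrow> 'm \<Rightarrow> real ^ 'm \<Rightarrow> real" where
  "cov2 a b Z e x = pd a (cov b Z e) x + (\<Sum>f\<in>UNIV. G e a f x * cov b Z f x)"

lemma cov2_commutator:
  assumes Z: "torus_field Z"
  shows "cov2 a b Z e x - cov2 b a Z e x = (\<Sum>d\<in>UNIV. Z x $ d * K a b e d x)"
proof -
  note s = torus_fun_smooth[OF torus_fun_christoffel] torus_fun_smooth[OF torus_field_component[OF Z]]
  have "cov2 a b Z e x = pd a (pd b (\<lambda>y. Z y $ e)) x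
      + (\<Sum>d\<in>UNIV. G e b d x * pd a (\<lambda>y. Z y $ d) x + G e a d x * pd b (\<lambda>y. Z y $ d) x)
      + (\<Sum>d\<in>UNIV. Z x $ d * (pd a (G e b d) x + (\<Sum>f\<in>UNIV. G e a f x * G f b d x)))" for a b
  proof -
    have "pd a (cov b Z e) x = pd a (pd b (\<lambda>y. Z y $ e)) x
      + (\<Sum>d\<in>UNIV. G e b d x * pd a (\<lambda>y. Z y $ d) x + pd a (G e b d) x * Z x $ d)"
      unfolding cov_def[abs_def] by (simp add: pd_add pd_sum pd_mult smooth_intros s)
    moreover have "(\<Sum>f\<in>UNIV. G e a f x * cov b Z f x) = (\<Sum>f\<in>UNIV. G e a f x * pd b (\<lambda>y. Z y $ f) x)
      + (\<Sum>d\<in>UNIV. Z x $ d * (\<Sum>f\<in>UNIV. G e a f x * G f b d x))"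
    proof -
      have "(\<Sum>f\<in>UNIV. G e a f x * (\<Sum>d\<in>UNIV. G f b d x * Z x $ d)) = (\<Sum>d\<in>UNIV. Z x $ d * (\<Sum>f\<in>UNIV. G e a f x * G f b d x))"
        unfolding sum_distrib_left by (subst sum.swap) (simp add: ac_simps)
      then show ?thesis by (simp add: cov_def distrib_left sum.distrib)
    qed
    ultimately show ?thesis
      by (simp add: cov2_def sum.distrib algebra_simps)
  qed
  moreover have "pd a (pd b (\<lambda>y. Z y $ e)) x = pd b (pd a (\<lambda>y. Z y $ e)) x"
    by (rule pd_commute) (rule s)
  ultimately show ?thesis
    by (simp add: K_def sum.distrib sum_subtractf algebra_simps)
qed

text \<open>The terms that differentiate the components of \<open>X\<close> or \<open>Y\<close> are
  cancelled by the Lie bracket term; what remains is the commutator of derivatives along coordinate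
  fields.\<close>

lemma curvature_component:
  assumes X: "torus_field X" and Y: "torus_field Y" and Z: "torus_field Z"
  shows "curvature D X Y Z x $ e = (\<Sum>a\<in>UNIV. \<Sum>b\<in>UNIV. X x $ a * Y x $ b * (\<Sum>d\<in>UNIV. Z x $ d * K a b e d x))"
proof -
  have DD: "D X (D Y Z) x $ e = (\<Sum>a\<in>UNIV. \<Sum>b\<in>UNIV. X x $ a * pd a (\<lambda>y. Y y $ b) x * cov b Z e x)
      + (\<Sum>a\<in>UNIV. \<Sum>b\<in>UNIV. X x $ a * Y x $ b * cov2 a b Z e x)"
    if X: "torus_field X" and Y: "torus_field Y" for X Y
  proof -
    have "cov a (D Y Z) e x = (\<Sum>b\<in>UNIV. pd a (\<lambda>y. Y y $ b) x * cov b Z e x) + (\<Sum>b\<in>UNIV. Y x $ b * cov2 a b Z e x)" for a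
    proof -
      have "(\<Sum>f\<in>UNIV. G e a f x * (\<Sum>b\<in>UNIV. Y x $ b * cov b Z f x)) = (\<Sum>b\<in>UNIV. Y x $ b * (\<Sum>f\<in>UNIV. G e a f x * cov b Z f x))"
        unfolding sum_distrib_left by (subst sum.swap) (simp add: ac_simps)
      moreover have "pd a (\<lambda>y. \<Sum>b\<in>UNIV. Y y $ b * cov b Z e y) x = (\<Sum>b\<in>UNIV. Y x $ b * pd a (cov b Z e) x + pd a (\<lambda>y. Y y $ b) x * cov b Z e x)"
        by (simp add: pd_sum pd_mult smooth_fun_mult torus_fun_smooth torus_fun_cov Z torus_field_component Y)
      ultimately show ?thesis
        unfolding cov_def[of a "D Y Z"] by (simp add: D_component Y Z cov2_def distrib_left sum.distrib)
    qed
    then show ?thesis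
      by (simp add: D_component[OF X torus_field_D[OF Y Z]] distrib_left sum.distrib sum_distrib_left mult.assoc)
  qed
  have "torus_field (lie_bracket X Y)"
    unfolding torus_field_def using X Y
    by (simp add: lie_bracket_component[OF X Y]) (intro allI torus_intros torus_field_component)
  then have "D (lie_bracket X Y) Z x $ e = (\<Sum>b\<in>UNIV. \<Sum>a\<in>UNIV. X x $ a * pd a (\<lambda>y. Y y $ b) x * cov b Z e x)
      - (\<Sum>b\<in>UNIV. \<Sum>a\<in>UNIV. Y x $ a * pd a (\<lambda>y. X y $ b) x * cov b Z e x)"
    by (simp add: D_component Z lie_bracket_component X Y sum_subtractf sum_distrib_right left_diff_distrib)
  also have "\<dots> = (\<Sum>a\<in>UNIV. \<Sum>b\<in>UNIV. X x $ a * pd a (\<lambda>y. Y y $ b) x * cov b Z e x)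
      - (\<Sum>a\<in>UNIV. \<Sum>b\<in>UNIV. Y x $ a * pd a (\<lambda>y. X y $ b) x * cov b Z e x)"
    by (intro arg_cong2[where f="(-)"] sum.swap)
  finally have "curvature D X Y Z x $ e = (\<Sum>a\<in>UNIV. \<Sum>b\<in>UNIV. X x $ a * Y x $ b * cov2 a b Z e x)
      - (\<Sum>a\<in>UNIV. \<Sum>b\<in>UNIV. Y x $ a * X x $ b * cov2 a b Z e x)"
    by (simp add: curvature_def DD X Y)
  also have "(\<Sum>a\<in>UNIV. \<Sum>b\<in>UNIV. Y x $ a * X x $ b * cov2 a b Z e x) = (\<Sum>a\<in>UNIV. \<Sum>b\<in>UNIV. X x $ a * Y x $ b * cov2 b a Z e x)"
    by (subst sum.swap) (simp add: ac_simps)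
  finally show ?thesis
    by (simp add: cov2_commutator[OF Z, symmetric] right_diff_distrib sum_subtractf)
qed

lemma curvature_coord: "curvature D (coord_field a) (coord_field b) (coord_field d) x $ e = K a b e d x"
  by (simp add: curvature_component torus_field_coord mult.assoc sum_distrib_left[symmetric] sum_coord_field)

text \<open>In the trace each basis vector is extended to a constant field, which is a coordinate
  field.\<close>

lemma ricci_coord: "ricci D (coord_field a) (coord_field b) x = (\<Sum>i\<in>UNIV. K a i i b x)"
  by (simp add: ricci_def trace_def matrix_def curvature_coord[symmetric] coord_field_def)

lemma curvature_vanishesI: "(\<And>a b e d x. K a b e d x = 0) \<Longrightarrow> curvature_vanishes D"
  by (simp add: curvature_vanishes_def vec_eq_iff curvature_component)

lemma christoffel_sym:
  assumes "torsion_free D"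
  shows "G c a b x = G c b a x"
proof -
  have "lie_bracket (coord_field a) (coord_field b) = (\<lambda>x. 0)"
    by (simp add: fun_eq_iff vec_eq_iff lie_bracket_component torus_field_coord pd_coord_field)
  moreover have "D (coord_field a) (coord_field b) x - D (coord_field b) (coord_field a) x - lie_bracket (coord_field a) (coord_field b) x = 0"
    using assms unfolding torsion_free_def by (blast intro: torus_field_coord)
  ultimately show ?thesis by (simp add: christoffel_def)
qed

end

lemma invariant_form_expansion:
  assumes "torus_two_form \<omega>" "invariant_form \<omega>"
  shows "\<omega> x u v = (\<Sum>i\<in>UNIV. \<Sum>j\<in>UNIV. u $ i * v $ j * form_comp \<omega> i j 0)"
proof -
  have b: "bilinear (\<omega> x)" using assms by (simp add: torus_two_form_def)
  have u: "u = (\<Sum>i\<in>UNIV. u $ i *\<^sub>R axis i 1)" for u :: "real ^ 'a"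
    using basis_expansion[of u] by (simp add: scalar_mult_eq_scaleR)
  have "\<omega> x u v = \<omega> x (\<Sum>i\<in>UNIV. u $ i *\<^sub>R axis i 1) (\<Sum>j\<in>UNIV. v $ j *\<^sub>R axis j 1)"
    using u[of u] u[of v] by simp
  also have "\<dots> = (\<Sum>i\<in>UNIV. \<Sum>j\<in>UNIV. u $ i * v $ j * \<omega> x (axis i 1) (axis j 1))"
    by (simp add: bilinear_sum[OF b] sum.cartesian_product[symmetric] bilinear_lmul[OF b] bilinear_rmul[OF b] ac_simps del: UNIV_Times_UNIV)
  also have "\<dots> = (\<Sum>i\<in>UNIV. \<Sum>j\<in>UNIV. u $ i * v $ j * form_comp \<omega> i j 0)"
  proof -
    have "form_comp \<omega> i j x = form_comp \<omega> i j 0" for i j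
      using assms(2) unfolding invariant_form_def by blast
    then show ?thesis by (simp add: form_comp_def coord_field_def)
  qed
  finally show ?thesis .
qed

lemma invariant_form_coord:
  assumes "torus_two_form \<omega>" "invariant_form \<omega>"
  shows "\<omega> x u (coord_field b y) = (\<Sum>i\<in>UNIV. u $ i * form_comp \<omega> i b 0)"
    and "\<omega> x (coord_field a y) v = (\<Sum>j\<in>UNIV. form_comp \<omega> a j 0 * v $ j)"
    and "\<omega> x (coord_field a y) (coord_field b y') = form_comp \<omega> a b 0"
  unfolding invariant_form_expansion[OF assms, of x]
  by (simp_all add: mult.assoc sum_distrib_left[symmetric] sum_coord_field) (simp add: mult.commute)

context torus_connection
begin

text \<open>The components of an invariant form are constant, so the derivative term of
  \<open>parallel_form\<close> drops out on coordinate fields.\<close>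

lemma christoffel_parallel:
  assumes \<omega>: "torus_two_form \<omega>" "invariant_form \<omega>" and p: "parallel_form \<omega> D"
  shows "(\<Sum>k\<in>UNIV. G k a b x * form_comp \<omega> k c 0) + (\<Sum>k\<in>UNIV. form_comp \<omega> b k 0 * G k a c x) = 0"
proof -
  have "field_deriv (coord_field a) (\<lambda>y. \<omega> y (coord_field b y) (coord_field c y)) x
     - \<omega> x (D (coord_field a) (coord_field b) x) (coord_field c x) - \<omega> x (coord_field b x) (D (coord_field a) (coord_field c) x) = 0"
    using p unfolding parallel_form_def by (blast intro: torus_field_coord)
  then show ?thesis
    by (simp only: invariant_form_coord(3)[OF \<omega>] pd_const) (simp add: invariant_form_coord(1,2)[OF \<omega>] christoffel_def)
qed

lemma ricci_type_coord:
  assumes \<omega>: "torus_two_form \<omega>" "invariant_form \<omega>" and W: "weyl_part_vanishes \<omega> D"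
    and n: "CARD('m) = 2 * n"
  defines "w a b \<equiv> form_comp \<omega> a b 0" and "r a b x \<equiv> \<Sum>i\<in>UNIV. K a i i b x"
  shows "(\<Sum>k\<in>UNIV. K c d k b x * w k t) = - 1 / (2 * (real n + 1)) *
    (2 * w c d * r b t x + w c b * r d t x + w c t * r d b x - w d b * r c t x - w d t * r c b x)"
proof -
  have "weyl_part \<omega> D (coord_field c) (coord_field d) (coord_field b) (coord_field t) x = 0"
    using W unfolding weyl_part_vanishes_def by (blast intro: torus_field_coord)
  then have "curvature4 \<omega> D (coord_field c) (coord_field d) (coord_field b) (coord_field t) x
      = ricci_part \<omega> D (coord_field c) (coord_field d) (coord_field b) (coord_field t) x"
    by (simp add: weyl_part_def)
  moreover have "real CARD('m) / 2 = real n" by (simp add: n)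
  ultimately show ?thesis
    by (simp only: w_def r_def curvature4_def ricci_part_def invariant_form_coord[OF \<omega>] sum_coord_field curvature_coord ricci_coord)
qed

end

lemma invariant_symplectic_space:
  fixes \<omega> :: "'m::finite two_form"
  assumes s: "symplectic_form \<omega>" and i: "invariant_form \<omega>"
  obtains Wi where "symplectic_space (\<chi> a b. form_comp \<omega> a b 0) Wi"
proof -
  let ?W = "\<chi> a b. form_comp \<omega> a b 0"
  have \<omega>: "torus_two_form \<omega>" and nd: "\<And>u. (\<And>v. \<omega> 0 u v = 0) \<Longrightarrow> u = 0"
    using s unfolding symplectic_form_def nondegenerate_form_def by blast+
  have alt: "\<omega> 0 u u = 0" for u using \<omega> by (simp add: torus_two_form_def)
  have b: "bilinear (\<omega> 0)" using \<omega> by (simp add: torus_two_form_def)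
  have anti: "\<omega> 0 u v = - \<omega> 0 v u" for u v
  proof -
    have "\<omega> 0 (u + v) (u + v) = \<omega> 0 u u + \<omega> 0 u v + (\<omega> 0 v u + \<omega> 0 v v)"
      by (simp only: bilinear_ladd[OF b] bilinear_radd[OF b])
    then show ?thesis unfolding alt by simp
  qed
  have anti': "transpose ?W = - ?W"
    by (simp add: vec_eq_iff transpose_def form_comp_def) (intro allI, rule anti)
  have "u = 0" if "?W *v u = 0" for u
  proof (rule nd)
    fix v
    have "\<omega> 0 v u = (\<Sum>i\<in>UNIV. v $ i * (?W *v u) $ i)"
      by (subst invariant_form_expansion[OF \<omega> i]) (simp add: matrix_vector_mult_def sum_distrib_left ac_simps)
    then have "\<omega> 0 v u = 0" by (simp add: that)
    then show "\<omega> 0 u v = 0" by (subst anti) simp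
  qed
  then obtain Wi where Wi: "Wi ** ?W = mat 1"
    using matrix_left_invertible_ker[of ?W] by blast
  then have "?W ** Wi = mat 1" using matrix_left_right_inverse by blast
  then have "symplectic_space ?W Wi"
    by (intro symplectic_space.intro Wi anti')
  then show ?thesis by (rule that)
qed

section \<open>Analytic curves of Ricci type\<close>

definition curv_comp :: "('m \<Rightarrow> 'm \<Rightarrow> 'm \<Rightarrow> real \<times> (real ^ 'm::finite) \<Rightarrow> real) \<Rightarrow> 'm \<Rightarrow> 'm \<Rightarrow> 'm \<Rightarrow> 'm \<Rightarrow> real \<times> (real ^ 'm) \<Rightarrow> real" where
  "curv_comp g a b e d z = dx a (g e b d) z - dx b (g e a d) z + (\<Sum>f\<in>UNIV. g e a f z * g f b d z - g e b f z * g f a d z)"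

text \<open>The hypotheses of the theorem in coordinates, with the upper index of the Christoffel
  symbols first; the locale mentions functions of time and position only.\<close>

locale ricci_type_curve = symplectic_space W Wi for W Wi :: "real ^ 'm ^ 'm" +
  fixes n :: nat and I :: "real set" and g :: "'m \<Rightarrow> 'm \<Rightarrow> 'm \<Rightarrow> real \<times> (real ^ 'm) \<Rightarrow> real"
  assumes n: "n \<ge> 2" "CARD('m) = 2 * n"
    and I: "open I" "is_interval I" "0 \<in> I"
    and analytic: "\<And>c a b. real_analytic_on (g c a b) (I \<times> UNIV)"
    and periodic: "\<And>c a b t. t \<in> I \<Longrightarrow> lattice_periodic (\<lambda>x. g c a b (t, x))"
    and g_0: "\<And>c a b x. g c a b (0, x) = 0"
    and g_sym: "\<And>c a b t x. t \<in> I \<Longrightarrow> g c a b (t, x) = g c b a (t, x)"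
    and g_sp: "\<And>a b c t x. t \<in> I \<Longrightarrow> (\<Sum>k\<in>UNIV. g k a b (t, x) * W $ k $ c) + (\<Sum>k\<in>UNIV. W $ b $ k * g k a c (t, x)) = 0"
    and g_ricci: "\<And>c d b e t x. t \<in> I \<Longrightarrow> (\<Sum>k\<in>UNIV. curv_comp g c d k b (t, x) * W $ k $ e) = - 1 / (2 * (real n + 1)) *
      (2 * W $ c $ d * (\<Sum>i\<in>UNIV. curv_comp g b i i e (t, x)) + W $ c $ b * (\<Sum>i\<in>UNIV. curv_comp g d i i e (t, x))
      + W $ c $ e * (\<Sum>i\<in>UNIV. curv_comp g d i i b (t, x)) - W $ d $ b * (\<Sum>i\<in>UNIV. curv_comp g c i i e (t, x))
      - W $ d $ e * (\<Sum>i\<in>UNIV. curv_comp g c i i b (t, x)))"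
begin

definition F where "F c a b x = tser (g c a b) x"

definition KF where "KF a b e d x = tser (dx a (g e b d)) x - tser (dx b (g e a d)) x
  + (\<Sum>f\<in>UNIV. F e a f x * F f b d x - F e b f x * F f a d x)"

abbreviation P :: "real fps \<Rightarrow> real fps" where "P A \<equiv> fps_compose A (fps_X ^ 5)"

text \<open>The substitution \<open>t = s^5\<close> makes room for the divisions by \<open>s^2\<close> in \<open>rescale\<close>.\<close>

definition \<Gamma> where "\<Gamma> c x = (\<chi> a b. P (F a c b x))"

lemma P_nth: "fps_nth (P A) k = (if 5 dvd k then fps_nth A (k div 5) else 0)"
  by (rule fps_nth_compose_X_power)

lemma P_mult: "P (A * B) = P A * P B"
  by (rule fps_compose_mult_distrib) simp

lemmas P_simps = fps_compose_add_distrib fps_compose_sub_distrib fps_compose_sum_distrib P_mult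

lemma F_expansion: "(\<lambda>s. g c a b (s, x)) has_fps_expansion F c a b x"
  unfolding F_def by (rule has_fps_expansion_tser[OF I(1) analytic I(3)])

lemma KF_expansion: "(\<lambda>s. curv_comp g a b e d (s, x)) has_fps_expansion KF a b e d x"
  unfolding curv_comp_def KF_def
  by (intro fps_expansion_intros F_expansion has_fps_expansion_tser[OF I(1) _ I(3)] real_analytic_on_dx analytic)

text \<open>Transfers the equations assumed at each time in \<open>I\<close> to formal power series
  in time.\<close>

lemma expansion_eq:
  assumes "\<And>s. s \<in> I \<Longrightarrow> f s = f' s" "f has_fps_expansion A" "f' has_fps_expansion A'"
  shows "A = A'"
proof (rule fps_expansion_unique[OF _ assms(3)])
  have "\<forall>\<^sub>F s in nhds 0. s \<in> I" using I(1,3) by (rule eventually_nhds_in_open)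
  then have "\<forall>\<^sub>F s in nhds 0. f s = f' s" by eventually_elim (rule assms(1))
  then show "f' has_fps_expansion A" by (rule fps_expansion_cong[OF assms(2)])
qed

lemma F_sym: "F c a b x = F c b a x"
  by (rule expansion_eq[OF g_sym F_expansion F_expansion])

lemma F_sp: "(\<Sum>k\<in>UNIV. F k a b x * fps_const (W $ k $ c)) + (\<Sum>k\<in>UNIV. fps_const (W $ b $ k) * F k a c x) = 0"
proof (rule expansion_eq)
  show "(\<lambda>s. (\<Sum>k\<in>UNIV. g k a b (s, x) * W $ k $ c) + (\<Sum>k\<in>UNIV. W $ b $ k * g k a c (s, x))) has_fps_expansion
      (\<Sum>k\<in>UNIV. F k a b x * fps_const (W $ k $ c)) + (\<Sum>k\<in>UNIV. fps_const (W $ b $ k) * F k a c x)"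
    by (intro fps_expansion_intros F_expansion)
  show "(\<lambda>s::real. 0::real) has_fps_expansion 0" by (rule has_fps_expansion_0)
qed (rule g_sp)

lemma F_0: "fps_nth (F c a b x) 0 = 0"
  by (simp add: F_def tser_def[OF I(1)] g_0)

definition RF where "RF a b x = (\<Sum>i\<in>UNIV. KF a i i b x)"

lemma KF_ricci: "(\<Sum>k\<in>UNIV. KF c d k b x * fps_const (W $ k $ e)) = fps_const (- 1 / (2 * (real n + 1))) *
      (2 * fps_const (W $ c $ d) * RF b e x + fps_const (W $ c $ b) * RF d e x
      + fps_const (W $ c $ e) * RF d b x - fps_const (W $ d $ b) * RF c e x - fps_const (W $ d $ e) * RF c b x)"
  unfolding RF_def
proof (rule expansion_eq)
  show "(\<lambda>s. \<Sum>k\<in>UNIV. curv_comp g c d k b (s, x) * W $ k $ e) has_fps_expansion (\<Sum>k\<in>UNIV. KF c d k b x * fps_const (W $ k $ e))"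
    by (intro fps_expansion_intros KF_expansion)
  show "(\<lambda>s. - 1 / (2 * (real n + 1)) *
      (2 * W $ c $ d * (\<Sum>i\<in>UNIV. curv_comp g b i i e (s, x)) + W $ c $ b * (\<Sum>i\<in>UNIV. curv_comp g d i i e (s, x))
      + W $ c $ e * (\<Sum>i\<in>UNIV. curv_comp g d i i b (s, x)) - W $ d $ b * (\<Sum>i\<in>UNIV. curv_comp g c i i e (s, x))
      - W $ d $ e * (\<Sum>i\<in>UNIV. curv_comp g c i i b (s, x)))) has_fps_expansion fps_const (- 1 / (2 * (real n + 1))) *
      (2 * fps_const (W $ c $ d) * (\<Sum>i\<in>UNIV. KF b i i e x) + fps_const (W $ c $ b) * (\<Sum>i\<in>UNIV. KF d i i e x)
      + fps_const (W $ c $ e) * (\<Sum>i\<in>UNIV. KF d i i b x) - fps_const (W $ d $ b) * (\<Sum>i\<in>UNIV. KF c i i e x)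
      - fps_const (W $ d $ e) * (\<Sum>i\<in>UNIV. KF c i i b x))"
    by (intro has_fps_expansion_add has_fps_expansion_diff has_fps_expansion_mult has_fps_expansion_sum
        has_fps_expansion_const has_fps_expansion_numeral KF_expansion)
qed (rule g_ricci)

sublocale f: formal_ricci_type_connection W Wi \<Gamma> n
proof
  show "CARD('m) > 2" "2 \<le> n" "CARD('m) = 2 * n" using n by simp_all
  show "torus_mat (\<Gamma> c)" for c
  proof -
    have "torus_fun (\<lambda>x. fps_nth (F a c b x) k)" for a b k
      unfolding F_def by (rule torus_fun_tser[OF I(1) analytic I(3) periodic])
    then have "torus_fun (\<lambda>x. if 5 dvd k then fps_nth (F a c b x) (k div 5) else 0)" for a b k
      by (cases "5 dvd k") auto
    then show ?thesis by (simp add: torus_mat_def torus_fps_def \<Gamma>_def P_nth)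
  qed
  show "fps_nth (\<Gamma> c x $ a $ b) k = 0" if "k < 5" for c x a b k
    using that by (cases "k = 0") (auto simp: \<Gamma>_def P_nth F_0 dest: dvd_imp_le)
  show "\<Gamma> c x $ a $ b = \<Gamma> b x $ a $ c" for c x a b
    by (simp add: \<Gamma>_def F_sym[of a c b])
  show "transpose (\<Gamma> c x) ** const_mat W + const_mat W ** \<Gamma> c x = 0" for c x
  proof -
    have "P ((\<Sum>k\<in>UNIV. F k c a x * fps_const (W $ k $ b)) + (\<Sum>k\<in>UNIV. fps_const (W $ a $ k) * F k c b x)) = 0" for a b
      unfolding F_sp by simp
    then show ?thesis
      by (simp add: vec_eq_iff matrix_matrix_mult_def transpose_def \<Gamma>_def P_simps)
  qed
qed

text \<open>The substitution \<open>P\<close> is a ring homomorphism and commutes with derivatives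
  in position.\<close>

lemma Rm_eq_KF: "f.Rm c d x $ a $ b = P (KF c d a b x)"
proof -
  have "fd c (\<lambda>x. P (F a d b x)) x = P (tser (dx c (g a d b)) x)" for c d
    by (rule fps_ext) (simp add: P_nth F_def pd_tser[OF I(1) analytic I(3)])
  then show ?thesis
    by (simp add: f.Rm_def KF_def \<Gamma>_def matrix_matrix_mult_def P_simps sum_subtractf)
qed

lemma ric_eq_RF: "f.ric x $ a $ b = P (RF a b x)"
  by (simp add: f.ric_def RF_def Rm_eq_KF P_simps)

sublocale f: formal_ricci_type W Wi \<Gamma> n
proof
  show "f.ricci_type"
    unfolding f.ricci_type_def Rm_eq_KF ric_eq_RF f.\<kappa>_def
  proof (intro allI)
    fix c d b e x
    have "P (\<Sum>k\<in>UNIV. KF c d k b x * fps_const (W $ k $ e)) = P (fps_const (- 1 / (2 * (real n + 1))) *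
      (2 * fps_const (W $ c $ d) * RF b e x + fps_const (W $ c $ b) * RF d e x
      + fps_const (W $ c $ e) * RF d b x - fps_const (W $ d $ b) * RF c e x - fps_const (W $ d $ e) * RF c b x))"
      unfolding KF_ricci ..
    then show "(\<Sum>k\<in>UNIV. P (KF c d k b x) * fps_const (W $ k $ e)) = fps_const (- 1 / (2 * (real n + 1))) *
      (2 * fps_const (W $ c $ d) * P (RF b e x) + fps_const (W $ c $ b) * P (RF d e x)
      + fps_const (W $ c $ e) * P (RF d b x) - fps_const (W $ d $ b) * P (RF c e x) - fps_const (W $ d $ e) * P (RF c b x))"
      unfolding P_simps fps_const_compose numeral_compose .
  qed
qed

lemma KF_zero: "KF c d a b x = 0"
proof -
  have "f.Rm c d x *v axis b 1 = 0"
    unfolding f.Rm_eq f.\<rho>_def f.ric_zero by (simp add: f.Ef_def bform_def)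
  then have "P (KF c d a b x) = 0"
    unfolding Rm_eq_KF[symmetric] by (simp add: vec_eq_iff matrix_vector_axis)
  \<comment> \<open>The substitution is injective: the coefficients at multiples of 5 are those of
    the original series.\<close>
  then have "fps_nth (P (KF c d a b x)) (5 * k) = 0" for k by simp
  then show ?thesis by (simp add: P_nth fps_eq_iff)
qed

text \<open>At fixed position the curvature component is analytic in time, and by
  \<open>KF_zero\<close> its expansion at time 0 vanishes.\<close>

theorem curvature_zero:
  assumes "t \<in> I"
  shows "curv_comp g a b e d (t, x) = 0"
proof (rule identity_theorem[OF I assms])
  fix s assume s: "s \<in> I"
  note slice = has_fps_expansion_slice[OF I(1) _ s, where x=x]
  obtain A where A: "\<And>c a b. (\<lambda>h. g c a b (s + h, x)) has_fps_expansion A c a b"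
    using slice[OF analytic] by metis
  obtain B where B: "\<And>i c a b. (\<lambda>h. dx i (g c a b) (s + h, x)) has_fps_expansion B i c a b"
    using slice[OF real_analytic_on_dx[OF analytic]] by metis
  have "(\<lambda>h. curv_comp g a b e d (s + h, x)) has_fps_expansion
      B a e b d - B b e a d + (\<Sum>f\<in>UNIV. A e a f * A f b d - A e b f * A f a d)"
    unfolding curv_comp_def by (intro fps_expansion_intros A B)
  then show "\<exists>A. (\<lambda>h. curv_comp g a b e d (s + h, x)) has_fps_expansion A" by blast
next
  show "(\<lambda>s. curv_comp g a b e d (s, x)) has_fps_expansion 0"
    using KF_expansion[of a b e d x] unfolding KF_zero .
qed

end

theorem theorem2:
  fixes n :: nat
    and \<omega> :: "'m::finite two_form"
    and I :: "real set"
    and D :: "real \<Rightarrow> 'm connection"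
  assumes "CARD('m) = 2 * n" and "2 * n \<ge> 4"
    and "symplectic_form \<omega>" and "invariant_form \<omega>"
    and "open I" and "is_interval I" and "0 \<in> I"
    and "analytic_symplectic_curve \<omega> I D"
    and "standard_flat_connection (D 0)"
    and "\<forall>t\<in>I. weyl_part_vanishes \<omega> (D t)"
  shows "\<forall>t\<in>I. curvature_vanishes (D t)"
proof
  fix t assume t: "t \<in> I"
  have \<omega>: "torus_two_form \<omega>" "invariant_form \<omega>" using assms(3,4) by (simp_all add: symplectic_form_def)
  define W where "W = (\<chi> a b. form_comp \<omega> a b 0)"
  have W: "W $ a $ b = form_comp \<omega> a b 0" for a b by (simp add: W_def)
  obtain Wi where WWi: "symplectic_space W Wi"
    unfolding W_def by (rule invariant_symplectic_space[OF assms(3,4)])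
  define g where "g c a b = (\<lambda>(t, x). christoffel (D t) c a b x)" for c a b
  have analytic: "real_analytic_on (g c a b) (I \<times> UNIV)" for c a b
    using assms(8) by (simp add: analytic_symplectic_curve_def g_def)
  have symplectic: "linear_connection (D t)" "torsion_free (D t)" "parallel_form \<omega> (D t)" if "t \<in> I" for t
    using assms(8) that by (simp_all add: analytic_symplectic_curve_def symplectic_connection_def)
  have conn: "torus_connection (D t)" if "t \<in> I" for t
    by (rule torus_connection.intro) (rule symplectic(1)[OF that])
  \<comment> \<open>At a fixed time, \<open>dx\<close> of \<open>g\<close> is the partial derivative
    of the Christoffel symbol of that time, so the two coordinate expressions of the curvature
    agree.\<close>
  have K: "curv_comp g a b e d (t, x) = torus_connection.K (D t) a b e d x" if t: "t \<in> I" for a b e d t x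
  proof -
    have "dx a (g e b d) (t, x) = pd a (\<lambda>x. g e b d (t, x)) x" for a b e d
      by (rule pd_slice[symmetric]) (rule analytic_differentiable[OF assms(5) analytic t])
    then show ?thesis
      unfolding curv_comp_def torus_connection.K_def[OF conn[OF t]] by (simp add: g_def)
  qed
  interpret ricci_type_curve W Wi n I g
  proof (intro ricci_type_curve.intro ricci_type_curve_axioms.intro)
    show "symplectic_space W Wi" by (rule WWi)
    show "2 \<le> n" "CARD('m) = 2 * n" using assms(1,2) by simp_all
    show "open I" "is_interval I" "0 \<in> I" by (rule assms)+
    show "real_analytic_on (g c a b) (I \<times> UNIV)" for c a b by (rule analytic)
    show "lattice_periodic (\<lambda>x. g c a b (t, x))" if "t \<in> I" for c a b t
      using torus_connection.torus_fun_christoffel[OF conn[OF that]] by (simp add: g_def torus_fun_def)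
    \<comment> \<open>Flatness of the initial connection enters here: the series of the Christoffel
      symbols have no constant term, hence order at least 5 after the substitution.\<close>
    show "g c a b (0, x) = 0" for c a b x
      using assms(9) by (simp add: g_def christoffel_def standard_flat_connection_def)
    show "g c a b (t, x) = g c b a (t, x)" if "t \<in> I" for c a b t x
      using torus_connection.christoffel_sym[OF conn[OF that] symplectic(2)[OF that], of c a b x] by (simp add: g_def)
    show "(\<Sum>k\<in>UNIV. g k a b (t, x) * W $ k $ c) + (\<Sum>k\<in>UNIV. W $ b $ k * g k a c (t, x)) = 0" if "t \<in> I" for a b c t x
      using torus_connection.christoffel_parallel[OF conn[OF that] \<omega> symplectic(3)[OF that]] by (simp add: g_def W)
    show "(\<Sum>k\<in>UNIV. curv_comp g c d k b (t, x) * W $ k $ e) = - 1 / (2 * (real n + 1)) *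
      (2 * W $ c $ d * (\<Sum>i\<in>UNIV. curv_comp g b i i e (t, x)) + W $ c $ b * (\<Sum>i\<in>UNIV. curv_comp g d i i e (t, x))
      + W $ c $ e * (\<Sum>i\<in>UNIV. curv_comp g d i i b (t, x)) - W $ d $ b * (\<Sum>i\<in>UNIV. curv_comp g c i i e (t, x))
      - W $ d $ e * (\<Sum>i\<in>UNIV. curv_comp g c i i b (t, x)))" if "t \<in> I" for c d b e t x
      unfolding K[OF that] W
      by (rule torus_connection.ricci_type_coord[OF conn[OF that] \<omega> assms(10)[rule_format, OF that] assms(1)])
  qed
  show "curvature_vanishes (D t)"
    using curvature_zero[OF t] unfolding K[OF t]
    by (intro torus_connection.curvature_vanishesI[OF conn[OF t]])
qed

end
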